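(* Let $S$ be a sectorially dichotomous operator with angle $\theta\in[0,\pi/2[$ on a (complex) Banach space $V$. Let $R$ be $p$-subordinate to $S$ with $p<1$ and $\mathrm i\mathbb R\subset r(S+R)$. Then $S+R$ is dichotomous with dichotomy gap $h>0$, the corresponding projections $P_\pm$ satisfy \[\frac1{\pi\mathrm i}\int_{\mathrm i\mathbb R}'(S+R-z)^{-1}x\,dz=P_+x-P_-x,\qquad x\in V,\] and $S+R$ is bisectorial with some angle $\theta''\in\,]\theta,\pi/2[$. Moreover, for every $\theta'\in\,]\theta,\pi/2[$ there exists $r'\ge0$ such that $S+R$ is also bisectorial with angle $\theta'$ and radius $r'$ and \[\{z\in\mathbb C:|\operatorname{Re}z|<h\}\cup\Omega_{\theta'',0}\cup\Omega_{\theta',r'}\subset\varrho(S+R).\]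
   Context: $\mathcal D(\cdot)$ is the domain, $\varrho(\cdot)$ the resolvent set, $\sigma(\cdot)$ the spectrum; $\mathbb C_\pm$ are the open right/left half-planes. $S+R$ has domain $\mathcal D(S)\cap\mathcal D(R)=\mathcal D(S)$. $\int'_{\mathrm i\mathbb R}$ denotes the Cauchy principal value at infinity, $\lim_{\rho\to\infty}\int_{-\mathrm i\rho}^{\mathrm i\rho}$. Subordination: $R$ is $p$-subordinate to $S$, $p\in[0,1]$, if $\mathcal D(S)\subset\mathcal D(R)$ and there is $c\ge0$ with $\|Rx\|\le c\|x\|^{1-p}\|Sx\|^p$ for all $x\in\mathcal D(S)$. Points of regular type: $r(S)$ is the set of $z\in\mathbb C$ for which there is $c>0$ with $\|(S-z)x\|\ge c\|x\|$ for all $x\in\mathcal D(S)$. Notation: $-\pi<\arg z\le\pi$, $\arg0=0$, $\Sigma_\theta=\{z\in\mathbb C:|\arg z|\le\theta\}$, $\Omega_{\theta',r}=\{z\in\mathbb C:\theta'\le|\arg z|\le\pi-\theta',\ |z|>r\}$. Sectorial: a densely defined linear operator $S$ is sectorial with angle $\theta\in[0,\pi[$ if $\sigma(S)\subset\Sigma_\theta$ and for every $\theta'\in\,]\theta,\pi]$ there is $M>0$ with $\|(S-z)^{-1}\|\le M/|z|$ for $|\arg z|\ge\theta'$, $|z|>0$. Bisectorial: a densely defined $S$ is bisectorial with angle $\theta\in[0,\pi/2[$ and radius $r\ge0$ if $\sigma(S)\subset\Sigma_\theta\cup(-\Sigma_\theta)\cup\{|z|\le r\}$ and for every $\theta'\in\,]\theta,\pi/2]$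 there is $M>0$ with $\|(S-z)^{-1}\|\le M/|z|$ for all $z\in\Omega_{\theta',r}$; bisectorial with angle $\theta$ (no radius mentioned) means radius $0$. Dichotomous: a densely defined linear operator $S$ on $V$ is dichotomous if there exist $h>0$ and complementary closed subspaces $V=V_+\oplus V_-$ with (a) $\{z:|\operatorname{Re}z|<h\}\subset\varrho(S)$; (b) $S(\mathcal D(S)\cap V_\pm)\subset V_\pm$; (c) $\sigma(S|_{V_+})\subset\mathbb C_+$, $\sigma(S|_{V_-})\subset\mathbb C_-$. The maximal $h$ in (a) is the dichotomy gap; $P_\pm$ are the projections onto $V_\pm$ along $V_\mp$; $S_\pm=S|_{V_\pm}$. $S$ is sectorially dichotomous with angle $\theta\in[0,\pi/2[$ if it is dichotomous and $S_+$ and $-S_-$ are sectorial with angle $\theta$. *)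

theory Defs
  imports "HOL-Analysis.Analysis"
begin

section \<open>Complex Banach spaces\<close>

class scaleC =
  fixes scaleC :: "complex \<Rightarrow> 'a \<Rightarrow> 'a"  (infixr "*\<^sub>C" 75)

class complex_banach = banach + scaleC +
  assumes scaleC_add_right: "a *\<^sub>C (x + y) = a *\<^sub>C x + a *\<^sub>C y"
    and scaleC_add_left: "(a + b) *\<^sub>C x = a *\<^sub>C x + b *\<^sub>C x"
    and scaleC_scaleC: "a *\<^sub>C (b *\<^sub>C x) = (a * b) *\<^sub>C x"
    and scaleC_one: "1 *\<^sub>C x = x"
    and scaleR_scaleC: "r *\<^sub>R x = complex_of_real r *\<^sub>C x"
    and norm_scaleC: "norm (a *\<^sub>C x) = cmod a * norm x"

instantiation complex :: complex_banach
begin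
definition scaleC_complex :: "complex \<Rightarrow> complex \<Rightarrow> complex"
  where "scaleC_complex a x = a * x"
instance
  by standard
     (simp_all add: scaleC_complex_def algebra_simps norm_mult scaleR_conv_of_real)
end

interpretation complex_vector: vector_space "scaleC :: complex \<Rightarrow> 'v \<Rightarrow> 'v::complex_banach"
  by standard (simp_all add: scaleC_add_right scaleC_add_left scaleC_scaleC scaleC_one)

section \<open>Unbounded linear operators\<close>

text \<open>
  An operator is given by a domain \<open>D\<close> and a function \<open>S\<close>; the values of \<open>S\<close> outside \<open>D\<close> are
  irrelevant. The argument \<open>X\<close>, where present, is the Banach space on which the operator acts: \<open>UNIV\<close> for the
  whole space, or a closed subspace. The restriction of \<open>(D, S)\<close> to a subspace \<open>X\<close> has
  domain \<open>D \<inter> X\<close> and the same function.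
\<close>

definition lin_operator :: "'v set \<Rightarrow> 'v set \<Rightarrow> ('v \<Rightarrow> 'v::complex_banach) \<Rightarrow> bool" where
  "lin_operator X D S \<longleftrightarrow>
     complex_vector.subspace X \<and> closed X \<and> complex_vector.subspace D \<and> D \<subseteq> X \<and> S ` D \<subseteq> X \<and>
     (\<forall>x\<in>D. \<forall>y\<in>D. S (x + y) = S x + S y) \<and> (\<forall>a. \<forall>x\<in>D. S (a *\<^sub>C x) = a *\<^sub>C S x)"

definition dense_lin_operator :: "'v set \<Rightarrow> 'v set \<Rightarrow> ('v \<Rightarrow> 'v::complex_banach) \<Rightarrow> bool" where
  "dense_lin_operator X D S \<longleftrightarrow> lin_operator X D S \<and> X \<subseteq> closure D"

definition resolvent :: "'v set \<Rightarrow> ('v \<Rightarrow> 'v::complex_banach) \<Rightarrow> complex \<Rightarrow> 'v \<Rightarrow> 'v" where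
  "resolvent D S z = the_inv_into D (\<lambda>x. S x - z *\<^sub>C x)"

definition bounded_by :: "'v set \<Rightarrow> ('v \<Rightarrow> 'v::complex_banach) \<Rightarrow> real \<Rightarrow> bool" where
  "bounded_by X T M \<longleftrightarrow> (\<forall>x\<in>X. norm (T x) \<le> M * norm x)"

definition resolvent_set :: "'v set \<Rightarrow> 'v set \<Rightarrow> ('v \<Rightarrow> 'v::complex_banach) \<Rightarrow> complex set" where
  "resolvent_set X D S =
     {z. bij_betw (\<lambda>x. S x - z *\<^sub>C x) D X \<and> (\<exists>M. bounded_by X (resolvent D S z) M)}"

definition spectrum :: "'v set \<Rightarrow> 'v set \<Rightarrow> ('v \<Rightarrow> 'v::complex_banach) \<Rightarrow> complex set" where
  "spectrum X D S = - resolvent_set X D S"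

definition regular_type :: "'v set \<Rightarrow> ('v \<Rightarrow> 'v::complex_banach) \<Rightarrow> complex set" where
  "regular_type D S = {z. \<exists>c>0. \<forall>x\<in>D. norm (S x - z *\<^sub>C x) \<ge> c * norm x}"

text \<open>Real power of a nonnegative number with \<open>0\<^sup>0 = 1\<close>, whereas \<open>0 powr 0 = 0\<close>.\<close>

definition rpow :: "real \<Rightarrow> real \<Rightarrow> real" where
  "rpow a p = (if p = 0 then 1 else a powr p)"

definition subordinate ::
  "real \<Rightarrow> 'v set \<Rightarrow> ('v \<Rightarrow> 'v) \<Rightarrow> 'v set \<Rightarrow> ('v \<Rightarrow> 'v::complex_banach) \<Rightarrow> bool" where
  "subordinate p DR R DS S \<longleftrightarrow>
     0 \<le> p \<and> p \<le> 1 \<and> DS \<subseteq> DR \<and>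
     (\<exists>c\<ge>0. \<forall>x\<in>DS. norm (R x) \<le> c * rpow (norm x) (1 - p) * rpow (norm (S x)) p)"

section \<open>Sectorial, bisectorial and dichotomous operators\<close>

definition sector :: "real \<Rightarrow> complex set" where
  "sector \<theta> = {z. \<bar>Arg z\<bar> \<le> \<theta>}"

definition bisector_complement :: "real \<Rightarrow> real \<Rightarrow> complex set" where
  "bisector_complement \<theta> r = {z. \<theta> \<le> \<bar>Arg z\<bar> \<and> \<bar>Arg z\<bar> \<le> pi - \<theta> \<and> cmod z > r}"

definition vstrip :: "real \<Rightarrow> complex set" where
  "vstrip h = {z. \<bar>Re z\<bar> < h}"

definition sectorial :: "'v set \<Rightarrow> 'v set \<Rightarrow> ('v \<Rightarrow> 'v::complex_banach) \<Rightarrow> real \<Rightarrow> bool" where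
  "sectorial X D S \<theta> \<longleftrightarrow>
     dense_lin_operator X D S \<and> 0 \<le> \<theta> \<and> \<theta> < pi \<and> spectrum X D S \<subseteq> sector \<theta> \<and>
     (\<forall>\<theta>'. \<theta> < \<theta>' \<and> \<theta>' \<le> pi \<longrightarrow>
        (\<exists>M>0. \<forall>z. \<theta>' \<le> \<bar>Arg z\<bar> \<and> cmod z > 0 \<longrightarrow>
           bounded_by X (resolvent D S z) (M / cmod z)))"

definition bisectorial ::
  "'v set \<Rightarrow> 'v set \<Rightarrow> ('v \<Rightarrow> 'v::complex_banach) \<Rightarrow> real \<Rightarrow> real \<Rightarrow> bool" where
  "bisectorial X D S \<theta> r \<longleftrightarrow>
     dense_lin_operator X D S \<and> 0 \<le> \<theta> \<and> \<theta> < pi / 2 \<and> 0 \<le> r \<and>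
     spectrum X D S \<subseteq> sector \<theta> \<union> uminus ` sector \<theta> \<union> {z. cmod z \<le> r} \<and>
     (\<forall>\<theta>'. \<theta> < \<theta>' \<and> \<theta>' \<le> pi / 2 \<longrightarrow>
        (\<exists>M>0. \<forall>z \<in> bisector_complement \<theta>' r.
           bounded_by X (resolvent D S z) (M / cmod z)))"

definition complementary_closed :: "'v set \<Rightarrow> 'v::complex_banach set \<Rightarrow> bool" where
  "complementary_closed U W \<longleftrightarrow>
     complex_vector.subspace U \<and> closed U \<and> complex_vector.subspace W \<and> closed W \<and>
     U \<inter> W = {0} \<and> (\<forall>x. \<exists>u\<in>U. \<exists>w\<in>W. x = u + w)"

definition proj_along :: "'v set \<Rightarrow> 'v::complex_banach set \<Rightarrow> 'v \<Rightarrow> 'v" where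
  "proj_along U W x = (THE u. u \<in> U \<and> x - u \<in> W)"

text \<open>
  The decomposition \<open>Vp\<close>, \<open>Vm\<close> witnessing that an operator is dichotomous is an explicit argument,
  because it is not determined by the operator alone: parts with empty spectrum may be put
  on either side.
\<close>

definition dichotomous_wrt ::
  "'v set \<Rightarrow> ('v \<Rightarrow> 'v::complex_banach) \<Rightarrow> 'v set \<Rightarrow> 'v set \<Rightarrow> bool" where
  "dichotomous_wrt D S Vp Vm \<longleftrightarrow>
     dense_lin_operator UNIV D S \<and> complementary_closed Vp Vm \<and>
     (\<exists>h>0. vstrip h \<subseteq> resolvent_set UNIV D S) \<and>
     S ` (D \<inter> Vp) \<subseteq> Vp \<and> S ` (D \<inter> Vm) \<subseteq> Vm \<and>
     spectrum Vp (D \<inter> Vp) S \<subseteq> {z. Re z > 0} \<and>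
     spectrum Vm (D \<inter> Vm) S \<subseteq> {z. Re z < 0}"

text \<open>The gap is an extended real, since it is \<open>\<infinity>\<close> if the spectrum is empty.\<close>

definition dichotomy_gap :: "'v set \<Rightarrow> ('v \<Rightarrow> 'v::complex_banach) \<Rightarrow> ereal" where
  "dichotomy_gap D S = Sup (ereal ` {h. h > 0 \<and> vstrip h \<subseteq> resolvent_set UNIV D S})"

definition sectorially_dichotomous ::
  "'v set \<Rightarrow> ('v \<Rightarrow> 'v::complex_banach) \<Rightarrow> real \<Rightarrow> bool" where
  "sectorially_dichotomous D S \<theta> \<longleftrightarrow>
     0 \<le> \<theta> \<and> \<theta> < pi / 2 \<and>
     (\<exists>Vp Vm. dichotomous_wrt D S Vp Vm \<and>
        sectorial Vp (D \<inter> Vp) S \<theta> \<and> sectorial Vm (D \<inter> Vm) (\<lambda>x. - S x) \<theta>)"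

text \<open>
  \<open>has_pv_integral_iR F I\<close>: the limit of the integral of \<open>F\<close> over the segment from \<open>-\<i>\<rho>\<close> to \<open>\<i>\<rho>\<close>,
  parametrized by \<open>t \<mapsto> \<i>t\<close>, exists as \<open>\<rho> \<rightarrow> \<infinity>\<close> and equals \<open>I\<close>.
\<close>

definition has_pv_integral_iR :: "(complex \<Rightarrow> 'v::complex_banach) \<Rightarrow> 'v \<Rightarrow> bool" where
  "has_pv_integral_iR F I \<longleftrightarrow>
     (\<forall>\<rho>>0. (\<lambda>t. \<i> *\<^sub>C F (\<i> * complex_of_real t)) integrable_on {-\<rho>..\<rho>}) \<and>
     ((\<lambda>\<rho>::real. integral {-\<rho>..\<rho>} (\<lambda>t. \<i> *\<^sub>C F (\<i> * complex_of_real t))) \<longlongrightarrow> I) at_top"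

end

theory Submission
  imports Defs
begin

text \<open>
  Write \<open>T = S + R\<close>. Three things make the theorem true.

  \<^emph>\<open>The resolvent of \<open>T\<close>.\<close> Since \<open>S\<close> is the direct sum of the sectorial operator \<open>S\<^sub>+\<close> and the
  negative of a sectorial operator, its resolvent is \<open>O(1 / (1 + |z|))\<close> on every double cone
  \<open>|Re z| \<le> \<kappa> |z|\<close> around the imaginary axis with \<open>\<kappa> < cos \<theta>\<close>; the norms of the two projections enter
  here, and they are finite by a Baire category argument (\<open>proj_along_bounded\<close>). Subordination gives
  \<open>R (S - z)\<^sup>-\<^sup>1 = O((1 + |z|)\<^sup>p\<^sup>-\<^sup>1)\<close>, which is small for large \<open>|z|\<close> because \<open>p < 1\<close>; so a Neumann
  argument carries the estimate to \<open>T\<close> outside a disc. The points of the imaginary axis that lie in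
  the resolvent set form an open set, nonempty by the estimate for large \<open>|z|\<close>, and by regular type a
  closed one; hence it is all of the axis
  (\<open>imaginary_axis_subset_resolvent_set\<close>). A compactness argument on the bounded part of the axis
  yields a strip around it with the same estimate. A thin double cone is covered by the strip near
  \<open>0\<close> and by the wider cone elsewhere, which is bisectoriality with some angle \<open>\<theta>''\<close> and radius \<open>0\<close>.

  \<^emph>\<open>The principal value.\<close> For \<open>S\<^sub>+\<close> the integral along \<open>[-i\<rho>, i\<rho>]\<close> can be deformed into a half circle
  in the left half-plane, on which \<open>z (S\<^sub>+ - z)\<^sup>-\<^sup>1 x \<rightarrow> -x\<close>. Together with the mirror image for \<open>S\<^sub>-\<close> this gives
  \<open>\<pi>i (P\<^sub>+ x - P\<^sub>- x)\<close> in the limit. The difference of the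
  resolvents of \<open>S\<close> and \<open>T\<close> is \<open>O((1 + |z|)\<^sup>p\<^sup>-\<^sup>2)\<close>, hence absolutely integrable along the axis. So the
  principal value for \<open>T\<close> exists as well and defines a bounded operator \<open>\<pi>i Q\<close>.

  \<^emph>\<open>The dichotomy.\<close> The expected projections are \<open>P = (1 + Q) / 2\<close> and \<open>1 - P\<close>. For \<open>Re \<lambda> < 0\<close> the
  absolutely convergent integral of \<open>(T - z)\<^sup>-\<^sup>1 x / (z - \<lambda>)\<close> along the axis yields \<open>L(\<lambda>) x\<close> with
  \<open>(T - \<lambda>) L(\<lambda>) x = P x\<close>. Together with \<open>(T - \<lambda>)\<^sup>-\<^sup>1 P\<close> in the strip this is a family on the closed left
  half-plane that satisfies a resolvent equation up to the factor \<open>P\<close>, which makes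
  \<open>L(\<lambda>) P\<^sup>2 x\<close> holomorphic in \<open>\<lambda>\<close>. On the axis this is \<open>(T - \<lambda>)\<^sup>-\<^sup>1 P\<^sup>3 x\<close>; closing the contour on the left
  evaluates its principal value and shows \<open>Q P\<^sup>3 = P\<^sup>3\<close> (\<open>Q_P_cube\<close>).
  The same statement for \<open>-T\<close> and a binomial expansion give \<open>Q\<^sup>2 = 1\<close> (\<open>Q_involution\<close>). So the eigenspaces of \<open>Q\<close> for \<open>1\<close> and \<open>-1\<close> decompose the space, \<open>L(\<lambda>)\<close> inverts
  \<open>T - \<lambda>\<close> on the first of them for \<open>Re \<lambda> \<le> 0\<close>, and its counterpart for \<open>-T\<close> yields the inverse on
  the second for \<open>Re \<lambda> \<ge> 0\<close> (\<open>strip_dichotomy\<close>).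
\<close>

section \<open>Principal values of vector-valued integrals\<close>

lemma bounded_bilinear_scaleC: "bounded_bilinear (scaleC :: complex \<Rightarrow> 'v \<Rightarrow> 'v::complex_banach)"
proof
  show "(a + b) *\<^sub>C x = a *\<^sub>C x + b *\<^sub>C x" for a b and x :: 'v by (rule scaleC_add_left)
  show "a *\<^sub>C (x + y) = a *\<^sub>C x + a *\<^sub>C y" for a and x y :: 'v by (rule scaleC_add_right)
  show "(r *\<^sub>R a) *\<^sub>C x = r *\<^sub>R (a *\<^sub>C x)" for r a and x :: 'v
    by (simp add: scaleR_scaleC[of r "a *\<^sub>C x"] scaleC_scaleC scaleR_conv_of_real)
  show "a *\<^sub>C (r *\<^sub>R x) = r *\<^sub>R (a *\<^sub>C x)" for r a and x :: 'v
    by (simp add: scaleR_scaleC[where 'a='v] scaleC_scaleC mult.commute)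
  show "\<exists>K. \<forall>a (x::'v). norm (a *\<^sub>C x) \<le> norm a * norm x * K"
    by (rule exI[of _ 1]) (simp add: norm_scaleC)
qed

interpretation scaleC: bounded_bilinear "scaleC :: complex \<Rightarrow> 'v \<Rightarrow> 'v::complex_banach"
  by (rule bounded_bilinear_scaleC)

lemmas continuous_on_scaleC [continuous_intros] = scaleC.continuous_on

text \<open>
  All integrals along the imaginary axis are taken in the real parameter \<open>t\<close> with \<open>z = it\<close>; the factor
  \<open>i\<close> of \<open>dz\<close> is left out. Working with limits of integrals over compact intervals lets absolutely
  convergent integrals and principal values be treated alike, in a Banach space that need not be
  separable.
\<close>

definition pv_integral :: "(real \<Rightarrow> 'v::banach) \<Rightarrow> 'v \<Rightarrow> bool" where
  "pv_integral f J \<longleftrightarrow>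
     (\<forall>\<rho>. f integrable_on {-\<rho>..\<rho>}) \<and> ((\<lambda>\<rho>. integral {-\<rho>..\<rho>} f) \<longlongrightarrow> J) at_top"

lemma pv_integral_unique: "pv_integral f I \<Longrightarrow> pv_integral f J \<Longrightarrow> I = J"
  unfolding pv_integral_def using tendsto_unique trivial_limit_at_top_linorder by blast

lemma pv_integral_add:
  assumes "pv_integral f I" "pv_integral g J"
  shows "pv_integral (\<lambda>t. f t + g t) (I + J)"
  using assms unfolding pv_integral_def
  by (auto simp: integral_add intro: integrable_add tendsto_add)

lemma pv_integral_linear:
  assumes "pv_integral f I" "bounded_linear h"
  shows "pv_integral (\<lambda>t. h (f t)) (h I)"
proof -
  have int: "f integrable_on {-\<rho>..\<rho>}" for \<rho> using assms(1) by (auto simp: pv_integral_def)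
  have "integral {-\<rho>..\<rho>} (\<lambda>t. h (f t)) = h (integral {-\<rho>..\<rho>} f)" for \<rho>
    using integral_linear[OF int assms(2)] by (simp add: o_def)
  moreover have "(\<lambda>t. h (f t)) integrable_on {-\<rho>..\<rho>}" for \<rho>
    using integrable_linear[OF int assms(2)] by (simp add: o_def)
  ultimately show ?thesis using assms bounded_linear.tendsto[OF assms(2)]
    unfolding pv_integral_def by auto
qed

lemma pv_integral_minus: "pv_integral f I \<Longrightarrow> pv_integral (\<lambda>t. - f t) (- I)"
  using pv_integral_linear[of f I uminus] bounded_linear_minus[OF bounded_linear_ident] by auto

lemma pv_integral_diff:
  assumes "pv_integral f I" "pv_integral g J"
  shows "pv_integral (\<lambda>t. f t - g t) (I - J)"
  using pv_integral_add[OF assms(1) pv_integral_minus[OF assms(2)]] by simp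

lemma pv_integral_reflect:
  assumes "pv_integral f I" shows "pv_integral (\<lambda>t. f (- t)) I"
proof -
  have "f integrable_on {-\<rho>..\<rho>}" for \<rho> using assms by (auto simp: pv_integral_def)
  then have *: "((\<lambda>t. f (- t)) has_integral integral {-\<rho>..\<rho>} f) {-\<rho>..\<rho>}" for \<rho>
    using has_integral_reflect_lemma_real[OF integrable_integral, of f "-\<rho>" \<rho>] by simp
  then have "(\<lambda>t. f (- t)) integrable_on {-\<rho>..\<rho>}" "integral {-\<rho>..\<rho>} (\<lambda>t. f (- t)) = integral {-\<rho>..\<rho>} f" for \<rho>
    by (auto simp: integral_unique)
  then show ?thesis using assms unfolding pv_integral_def by auto
qed

text \<open>
  The increments of the integral of \<open>f\<close> over growing symmetric intervals are dominated by those of \<open>g\<close>,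
  which converge by monotonicity; hence the Cauchy criterion applies.
\<close>

lemma pv_integral_dominated:
  fixes f :: "real \<Rightarrow> 'v::banach" and g :: "real \<Rightarrow> real"
  assumes f: "continuous_on UNIV f" and g: "continuous_on UNIV g"
    and fg: "\<And>t. norm (f t) \<le> g t"
    and K: "\<And>\<rho>. 0 \<le> \<rho> \<Longrightarrow> integral {-\<rho>..\<rho>} g \<le> K"
  obtains I where "pv_integral f I" "norm I \<le> K"
proof -
  have intf: "f integrable_on {a..b}" for a b
    by (rule integrable_continuous_real) (rule continuous_on_subset[OF f], simp)
  have intg: "g integrable_on {a..b}" for a b
    by (rule integrable_continuous_real) (rule continuous_on_subset[OF g], simp)
  define F where "F n = integral {- real n..real n} f" for n :: nat
  have step: "norm (integral {-b..b} f - integral {-a..a} f) \<le> integral {-b..b} g - integral {-a..a} g"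
    if "0 \<le> a" "a \<le> b" for a b
  proof -
    have split: "integral {-b..b} h = integral {-b..-a} h + integral {-a..a} h + integral {a..b} h"
      if "\<And>c d. h integrable_on {c..d}" for h :: "real \<Rightarrow> 'c::banach"
      using Henstock_Kurzweil_Integration.integral_combine[of "-b" a b h]
        Henstock_Kurzweil_Integration.integral_combine[of "-b" "-a" a h] that
        \<open>0 \<le> a\<close> \<open>a \<le> b\<close> by simp
    have "norm (integral {-b..b} f - integral {-a..a} f) = norm (integral {-b..-a} f + integral {a..b} f)"
      using split[of f] intf by simp
    also have "\<dots> \<le> integral {-b..-a} g + integral {a..b} g"
      by (intro norm_triangle_mono integral_norm_bound_integral intf intg fg)
    also have "\<dots> = integral {-b..b} g - integral {-a..a} g" using split[of g] intg by simp
    finally show ?thesis .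
  qed
  define s where "s = (SUP \<rho>\<in>{0..}. integral {-\<rho>..\<rho>} g)"
  have bdd: "bdd_above ((\<lambda>\<rho>. integral {-\<rho>..\<rho>} g) ` {0..})"
    using K by (auto intro!: bdd_aboveI)
  have up: "integral {-\<rho>..\<rho>} g \<le> s" if "0 \<le> \<rho>" for \<rho>
    unfolding s_def using bdd that by (auto intro!: cSUP_upper)
  have tail: "\<exists>a\<ge>0. \<forall>b\<ge>a. \<forall>c\<ge>b. norm (integral {-c..c} f - integral {-b..b} f) < e" if "e > 0" for e
  proof -
    have "s - e < s" using that by simp
    then obtain a where a: "a \<ge> 0" "s - e < integral {-a..a} g"
      unfolding s_def using less_cSUP_iff[OF _ bdd] by fastforce
    have "norm (integral {-c..c} f - integral {-b..b} f) < e" if "b \<ge> a" "c \<ge> b" for b c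
      using step[of b c] step[of a b] up[of c] a that norm_ge_zero[of "integral {-b..b} f - integral {-a..a} f"]
      by linarith
    then show ?thesis using a by auto
  qed
  have "Cauchy F"
    unfolding Cauchy_iff
  proof (intro allI impI)
    fix e :: real assume "e > 0"
    then obtain a where a: "a \<ge> 0" "\<And>b c. b \<ge> a \<Longrightarrow> c \<ge> b \<Longrightarrow> norm (integral {-c..c} f - integral {-b..b} f) < e"
      using tail by blast
    obtain N :: nat where N: "real N \<ge> a" using real_arch_simple by blast
    have "norm (F m - F n) < e" if "m \<ge> N" "n \<ge> N" for m n
    proof (cases "m \<le> n")
      case True
      then show ?thesis using a(2)[of m n] N that by (simp add: F_def norm_minus_commute)
    next
      case False
      then show ?thesis using a(2)[of n m] N that by (simp add: F_def)
    qed
    then show "\<exists>N. \<forall>m\<ge>N. \<forall>n\<ge>N. norm (F m - F n) < e" by blast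
  qed
  then obtain I where I: "F \<longlonglongrightarrow> I" using Cauchy_convergent_iff convergent_def by blast
  have lim: "((\<lambda>\<rho>. integral {-\<rho>..\<rho>} f) \<longlongrightarrow> I) at_top"
  proof (rule tendstoI)
    fix e :: real assume "e > 0"
    then obtain a where a: "a \<ge> 0" "\<And>b c. b \<ge> a \<Longrightarrow> c \<ge> b \<Longrightarrow> norm (integral {-c..c} f - integral {-b..b} f) < e/2"
      using tail[of "e/2"] by auto
    have "norm (integral {-b..b} f - I) \<le> e/2" if "b \<ge> a" for b
    proof -
      have "(\<lambda>n. norm (integral {-b..b} f - F n)) \<longlonglongrightarrow> norm (integral {-b..b} f - I)"
        by (intro tendsto_intros I)
      moreover obtain N :: nat where "real N \<ge> b" using real_arch_simple by blast
      then have "b \<le> real n" if "n \<ge> N" for n using that by (meson of_nat_mono order_trans)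
      then have "\<forall>n\<ge>N. norm (integral {-b..b} f - F n) \<le> e/2"
        using a(2)[OF that] by (metis F_def norm_minus_commute less_imp_le)
      ultimately show ?thesis by (rule LIMSEQ_le_const2[OF _ exI])
    qed
    then show "\<forall>\<^sub>F \<rho> in at_top. dist (integral {-\<rho>..\<rho>} f) I < e"
      using \<open>e > 0\<close> unfolding eventually_at_top_linorder dist_norm by (fastforce intro!: exI[of _ a])
  qed
  have "norm (F n) \<le> K" for n
    using integral_norm_bound_integral[OF intf intg fg, of "- real n" "real n"] K[of "real n"] by (simp add: F_def)
  then have "norm I \<le> K" using LIMSEQ_le_const2[OF tendsto_norm[OF I]] by blast
  with lim intf show thesis by (intro that) (auto simp: pv_integral_def)
qed

lemma integral_decaying_power_le:
  assumes q: "1 < q" and "0 \<le> \<rho>"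
  shows "integral {-\<rho>..\<rho>} (\<lambda>t::real. (1 + \<bar>t\<bar>) powr (- q)) \<le> 2 / (q - 1)"
proof -
  let ?g = "\<lambda>t::real. (1 + \<bar>t\<bar>) powr (- q)"
  have cont: "continuous_on A ?g" for A by (intro continuous_intros) auto
  have int: "?g integrable_on {a..b}" for a b by (rule integrable_continuous_real) (rule cont)
  have d: "((\<lambda>t. - ((1 + t) powr (1 - q) / (q - 1))) has_vector_derivative ?g t) (at t within {0..\<rho>})"
    if "t \<in> {0..\<rho>}" for t
  proof -
    have "((\<lambda>t. (1 + t) powr (1 - q)) has_real_derivative (1 - q) * (1 + t) powr (1 - q - 1) * (0 + 1)) (at t within {0..\<rho>})"
      by (rule DERIV_chain2[OF has_real_derivative_powr]) (use that in \<open>auto intro!: derivative_eq_intros\<close>)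
    note d = DERIV_minus[OF DERIV_cdivide[OF this, of "q - 1"]]
    have eq: "- ((1 - q) * (1 + t) powr (1 - q - 1) * (0 + 1) / (q - 1)) = ?g t"
      using that q by (simp add: field_simps)
    show ?thesis
      unfolding has_real_derivative_iff_has_vector_derivative[symmetric]
      by (rule DERIV_cong[OF d eq])
  qed
  have "(?g has_integral - ((1 + \<rho>) powr (1 - q) / (q - 1)) - - ((1 + 0) powr (1 - q) / (q - 1))) {0..\<rho>}"
    using fundamental_theorem_of_calculus[OF \<open>0 \<le> \<rho>\<close> d] by blast
  then have "integral {0..\<rho>} ?g = (1 - (1 + \<rho>) powr (1 - q)) / (q - 1)"
    using q by (simp add: integral_unique diff_divide_distrib)
  also have "\<dots> \<le> 1 / (q - 1)" using q by (intro divide_right_mono) auto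
  finally have half: "integral {0..\<rho>} ?g \<le> 1 / (q - 1)" .
  have "integral {-\<rho>..0} ?g = integral {0..\<rho>} ?g"
    using has_integral_reflect_lemma_real[OF integrable_integral[OF int], of 0 \<rho>] by (simp add: integral_unique)
  moreover have "integral {-\<rho>..\<rho>} ?g = integral {-\<rho>..0} ?g + integral {0..\<rho>} ?g"
    using Henstock_Kurzweil_Integration.integral_combine[of "-\<rho>" 0 \<rho> ?g] int \<open>0 \<le> \<rho>\<close> by simp
  ultimately show ?thesis using half by simp
qed

lemma pv_integral_power_decay:
  fixes f :: "real \<Rightarrow> 'v::banach"
  assumes "continuous_on UNIV f" "1 < q" "0 \<le> C" "\<And>t. norm (f t) \<le> C * (1 + \<bar>t\<bar>) powr (- q)"
  obtains I where "pv_integral f I" "norm I \<le> C * (2 / (q - 1))"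
proof (rule pv_integral_dominated[OF assms(1) _ assms(4)])
  show "continuous_on UNIV (\<lambda>t::real. C * (1 + \<bar>t\<bar>) powr (- q))" by (intro continuous_intros) auto
  show "integral {-\<rho>..\<rho>} (\<lambda>t. C * (1 + \<bar>t\<bar>) powr (- q)) \<le> C * (2 / (q - 1))" if "0 \<le> \<rho>" for \<rho>
    using mult_left_mono[OF integral_decaying_power_le[OF assms(2) that] assms(3)] by simp
qed (use that in auto)

section \<open>Cauchy's theorem in a half-plane\<close>

text \<open>
  The functions below arise from resolvent equations, and these give a second-order Taylor estimate
  that is uniform on bounded sets, up to and including the boundary of the half-plane. Exchanging the
  roles of the two points in the estimate shows that the derivative is locally Lipschitz.
\<close>

lemma half_plane_derivative:
  fixes f f' :: "complex \<Rightarrow> 'v::complex_banach"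
  assumes quad: "\<And>r. \<exists>C. \<forall>z w. Re z \<le> 0 \<and> Re w \<le> 0 \<and> cmod z \<le> r \<and> cmod w \<le> r \<longrightarrow>
                    norm (f w - f z - (w - z) *\<^sub>C f' z) \<le> C * (cmod (w - z))\<^sup>2"
  shows "Re z \<le> 0 \<Longrightarrow> (f has_derivative (\<lambda>h. h *\<^sub>C f' z)) (at z within {z. Re z \<le> 0})"
    and "continuous_on {z. Re z \<le> 0} f'"
proof -
  show "(f has_derivative (\<lambda>h. h *\<^sub>C f' z)) (at z within {z. Re z \<le> 0})" if z: "Re z \<le> 0" for z
  proof -
    obtain C where C: "\<And>w. Re w \<le> 0 \<Longrightarrow> cmod w \<le> cmod z + 1 \<Longrightarrow>
        norm (f w - f z - (w - z) *\<^sub>C f' z) \<le> C * (cmod (w - z))\<^sup>2"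
      using quad[of "cmod z + 1"] z by fastforce
    show ?thesis
    proof (rule has_derivativeI_sandwich[of 1])
      show "bounded_linear (\<lambda>h. h *\<^sub>C f' z)" by (rule scaleC.bounded_linear_left)
      show "norm (f y - f z - (y - z) *\<^sub>C f' z) / norm (y - z) \<le> C * cmod (y - z)"
        if "y \<in> {z. Re z \<le> 0}" "y \<noteq> z" "dist y z < 1" for y
      proof -
        have "cmod y \<le> cmod z + 1" using that(3) norm_triangle_ineq2[of y z] by (simp add: dist_norm)
        then show ?thesis using C[of y] that by (simp add: field_simps power2_eq_square)
      qed
      show "((\<lambda>y. C * cmod (y - z)) \<longlongrightarrow> 0) (at z within {z. Re z \<le> 0})"
        by (auto intro!: tendsto_eq_intros)
    qed simp
  qed
  show "continuous_on {z. Re z \<le> 0} f'"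
    unfolding continuous_on_iff
  proof (intro ballI allI impI)
    fix z and e :: real assume z: "z \<in> {z. Re z \<le> 0}" and "e > 0"
    obtain C where C: "\<And>w v. Re w \<le> 0 \<Longrightarrow> cmod w \<le> cmod z + 1 \<Longrightarrow> Re v \<le> 0 \<Longrightarrow> cmod v \<le> cmod z + 1 \<Longrightarrow>
        norm (f w - f v - (w - v) *\<^sub>C f' v) \<le> C * (cmod (w - v))\<^sup>2"
      using quad[of "cmod z + 1"] by blast
    have *: "norm (f' w - f' z) \<le> 2 * C * cmod (w - z)"
      if w: "Re w \<le> 0" "dist w z < 1" for w
    proof (cases "w = z")
      case False
      have "cmod w \<le> cmod z + 1" using w(2) norm_triangle_ineq2[of w z] by (simp add: dist_norm)
      then have "norm (f w - f z - (w - z) *\<^sub>C f' z) \<le> C * (cmod (w - z))\<^sup>2"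
        "norm (f z - f w - (z - w) *\<^sub>C f' w) \<le> C * (cmod (w - z))\<^sup>2"
        using C[of w z] C[of z w] z w by (auto simp: norm_minus_commute)
      moreover have "(w - z) *\<^sub>C (f' w - f' z) = (f w - f z - (w - z) *\<^sub>C f' z) + (f z - f w - (z - w) *\<^sub>C f' w)"
        by (simp add: scaleC.diff_left scaleC.diff_right)
      ultimately have "cmod (w - z) * norm (f' w - f' z) \<le> 2 * (C * (cmod (w - z))\<^sup>2)"
        unfolding norm_scaleC[symmetric] by (metis add_mono mult_2 norm_triangle_le)
      then show ?thesis using False by (simp add: power2_eq_square)
    qed simp
    define d where "d = min 1 (e / (2 * \<bar>C\<bar> + 1))"
    have "dist (f' w) (f' z) < e" if "w \<in> {z. Re z \<le> 0}" "dist w z < d" for w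
    proof -
      have "dist w z < 1" "dist w z < e / (2 * \<bar>C\<bar> + 1)" using that by (auto simp: d_def)
      then have "(2 * \<bar>C\<bar> + 1) * dist w z < e" by (simp add: field_simps)
      moreover have "norm (f' w - f' z) \<le> 2 * C * cmod (w - z)" using * \<open>dist w z < 1\<close> that by auto
      moreover have "2 * C * cmod (w - z) \<le> (2 * \<bar>C\<bar> + 1) * dist w z"
        unfolding dist_norm by (intro mult_right_mono) auto
      ultimately show ?thesis by (simp add: dist_norm)
    qed
    moreover have "d > 0" using \<open>e > 0\<close> by (auto simp: d_def intro!: divide_pos_pos)
    ultimately show "\<exists>d>0. \<forall>x'\<in>{z. Re z \<le> 0}. dist x' z < d \<longrightarrow> dist (f' x') (f' z) < e" by blast
  qed
qed


lemma half_plane_path_derivative: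
  fixes f f' :: "complex \<Rightarrow> 'v::complex_banach"
  assumes "(f has_derivative (\<lambda>h. h *\<^sub>C f' (\<gamma> t))) (at (\<gamma> t) within A)"
    and "(\<gamma> has_vector_derivative d) (at t within I)" "\<gamma> ` I \<subseteq> A"
  shows "((\<lambda>t. f (\<gamma> t)) has_vector_derivative d *\<^sub>C f' (\<gamma> t)) (at t within I)"
proof -
  have "((\<lambda>t. f (\<gamma> t)) has_derivative (\<lambda>h. (h *\<^sub>R d) *\<^sub>C f' (\<gamma> t))) (at t within I)"
    using has_derivative_in_compose[OF assms(2)[unfolded has_vector_derivative_def]
        has_derivative_subset[OF assms(1,3)]] .
  then show ?thesis by (simp add: has_vector_derivative_def scaleC.scaleR_left)
qed

text \<open>
  Both sides vanish for \<open>\<rho> = 0\<close>. In polar coordinates, the derivative with respect to \<open>\<rho>\<close> of the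
  integrand \<open>z f(z)\<close>, \<open>z = \<rho> e\<^sup>i\<^sup>\<phi>\<close>, equals the derivative with respect to \<open>\<phi>\<close> of \<open>-i e\<^sup>i\<^sup>\<phi> f(z)\<close>: this is
  the Cauchy-Riemann equation. So the derivative of the right-hand side reduces to the two boundary
  terms at \<open>i\<rho>\<close> and \<open>-i\<rho>\<close>, which is the derivative of the left-hand side. Cauchy's theorem is thereby
  obtained for vector-valued functions without passing to scalar ones by linear functionals.
\<close>

lemma half_circle_Cauchy:
  fixes f f' :: "complex \<Rightarrow> 'v::complex_banach"
  assumes f: "\<And>z. Re z \<le> 0 \<Longrightarrow> (f has_derivative (\<lambda>h. h *\<^sub>C f' z)) (at z within {z. Re z \<le> 0})"
    and f': "continuous_on {z. Re z \<le> 0} f'" and \<rho>: "0 \<le> \<rho>"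
  shows "integral {-\<rho>..\<rho>} (\<lambda>t. f (\<i> * of_real t))
       = - integral {pi/2..3*pi/2} (\<lambda>\<phi>. (of_real \<rho> * cis \<phi>) *\<^sub>C f (of_real \<rho> * cis \<phi>))"
proof -
  let ?A = "{z. Re z \<le> 0}"
  let ?J = "{pi/2..3*pi/2}"
  have cf: "continuous_on ?A f"
    using f by (auto simp: continuous_on_eq_continuous_within intro: has_derivative_continuous)
  have cos: "cos \<phi> \<le> 0" if "\<phi> \<in> ?J" for \<phi>
  proof -
    have "0 \<le> cos (\<phi> - pi)" using that by (intro cos_ge_zero) auto
    then show ?thesis by simp
  qed
  have inA: "of_real r * cis \<phi> \<in> ?A" if "\<phi> \<in> ?J" "0 \<le> r" for r \<phi>
    using cos[OF that(1)] that(2) by (simp add: mult_nonneg_nonpos)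
  define H where "H r \<phi> = (of_real r * cis \<phi>) *\<^sub>C f (of_real r * cis \<phi>)" for r \<phi>
  define H' where "H' r \<phi> = cis \<phi> *\<^sub>C f (of_real r * cis \<phi>) + (of_real r * cis \<phi>) *\<^sub>C (cis \<phi> *\<^sub>C f' (of_real r * cis \<phi>))" for r \<phi>
  have dr: "((\<lambda>r. H r \<phi>) has_vector_derivative H' r \<phi>) (at r within {0..\<rho>})"
    if "r \<in> {0..\<rho>}" "\<phi> \<in> ?J" for r \<phi>
  proof -
    have g: "((\<lambda>r. of_real r * cis \<phi>) has_vector_derivative cis \<phi>) (at r within {0..\<rho>})"
      unfolding has_vector_derivative_def by (auto intro!: derivative_eq_intros simp: scaleR_conv_of_real)
    have "((\<lambda>r. f (of_real r * cis \<phi>)) has_vector_derivative cis \<phi> *\<^sub>C f' (of_real r * cis \<phi>)) (at r within {0..\<rho>})"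
      using inA[OF that(2)] that by (intro half_plane_path_derivative[where A = ?A, OF _ g] f) auto
    from scaleC.has_vector_derivative[OF g this] show ?thesis
      unfolding H_def H'_def by (simp add: add.commute)
  qed
  \<comment> \<open>The Cauchy-Riemann equation: \<open>H'\<close>, the derivative in \<open>r\<close>, is also a derivative in \<open>\<phi>\<close>.\<close>
  have dphi: "((\<lambda>\<phi>. (- \<i> * cis \<phi>) *\<^sub>C f (of_real r * cis \<phi>)) has_vector_derivative H' r \<phi>) (at \<phi> within ?J)"
    if "r \<in> {0..\<rho>}" "\<phi> \<in> ?J" for r \<phi>
  proof -
    have c: "(cis has_vector_derivative (\<i> * cis \<phi>)) (at \<phi> within ?J)"
      unfolding has_vector_derivative_def using has_derivative_cis[OF has_derivative_ident, of \<phi> ?J]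
      by (simp add: scaleR_conv_of_real mult_ac)
    have g: "((\<lambda>\<phi>. of_real r * cis \<phi>) has_vector_derivative of_real r * (\<i> * cis \<phi>)) (at \<phi> within ?J)"
      by (rule has_vector_derivative_mult_right[OF c])
    have "((\<lambda>\<phi>. f (of_real r * cis \<phi>)) has_vector_derivative (of_real r * (\<i> * cis \<phi>)) *\<^sub>C f' (of_real r * cis \<phi>)) (at \<phi> within ?J)"
      using inA that by (intro half_plane_path_derivative[where A = ?A, OF _ g] f) auto
    from scaleC.has_vector_derivative[OF has_vector_derivative_mult_right[OF c, of "-\<i>"] this] show ?thesis
      unfolding H'_def by (simp add: scaleC_scaleC mult_ac algebra_simps)
  qed
  have cH: "continuous_on ?J (H r)" if "r \<in> {0..\<rho>}" for r
    unfolding H_def using inA that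
    by (intro continuous_intros continuous_on_compose2[OF cf]) auto
  have cH': "continuous_on ({0..\<rho>} \<times> ?J) (\<lambda>(r, \<phi>). H' r \<phi>)"
    unfolding H'_def split_def using inA
    by (intro continuous_intros continuous_on_compose2[OF cf] continuous_on_compose2[OF f']) auto
  define K where "K r = integral ?J (H r)" for r
  have dK: "(K has_vector_derivative integral ?J (H' r)) (at r within {0..\<rho>})" if "r \<in> {0..\<rho>}" for r
    unfolding K_def box_real(2)[symmetric]
    by (rule leibniz_rule_vector_derivative)
      (use dr that cH' integrable_continuous_real[OF cH] in auto)
  have H'int: "integral ?J (H' r) = - (f (of_real r * \<i>) + f (- (of_real r * \<i>)))" if "r \<in> {0..\<rho>}" for r
  proof -
    have "(H' r has_integral ((- \<i> * cis (3*pi/2)) *\<^sub>C f (of_real r * cis (3*pi/2))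
            - (- \<i> * cis (pi/2)) *\<^sub>C f (of_real r * cis (pi/2)))) ?J"
      by (intro fundamental_theorem_of_calculus dphi that) auto
    moreover have "cis (3*pi/2) = -\<i>" "cis (pi/2) = \<i>"
      using cis_mult[of pi "pi/2"] by (simp_all add: complex_eq_iff field_simps)
    ultimately show ?thesis by (simp add: integral_unique scaleC_one scaleC.minus_left)
  qed
  have ci: "continuous_on I (\<lambda>t. f (\<i> * of_real t))" for I
    by (intro continuous_intros continuous_on_compose2[OF cf]) auto
  have int: "(\<lambda>t. f (\<i> * of_real t)) integrable_on {a..b}" for a b
    by (rule integrable_continuous_real) (rule ci)
  have cin: "continuous_on I (\<lambda>t. f (- (\<i> * of_real t)))" for I
    by (intro continuous_intros continuous_on_compose2[OF cf]) auto
  have intn: "(\<lambda>t. f (- (\<i> * of_real t))) integrable_on {a..b}" for a b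
    by (rule integrable_continuous_real) (rule cin)
  have "((\<lambda>r. - (f (of_real r * \<i>) + f (- (of_real r * \<i>)))) has_integral (K \<rho> - K 0)) {0..\<rho>}"
    using dK H'int \<rho> by (intro fundamental_theorem_of_calculus) auto
  moreover have "H 0 = (\<lambda>_. 0)" by (rule ext) (simp add: H_def)
  then have "K 0 = 0" by (simp add: K_def)
  ultimately have "((\<lambda>r. - (f (of_real r * \<i>) + f (- (of_real r * \<i>)))) has_integral K \<rho>) {0..\<rho>}" by simp
  from has_integral_neg[OF this]
  have hK: "((\<lambda>r. f (\<i> * of_real r) + f (- (\<i> * of_real r))) has_integral - K \<rho>) {0..\<rho>}"
    by (simp add: mult.commute add.commute)
  have "- K \<rho> = integral {0..\<rho>} (\<lambda>r. f (\<i> * of_real r)) + integral {0..\<rho>} (\<lambda>r. f (- (\<i> * of_real r)))"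
    using integral_unique[OF hK] integral_add[OF int intn] by metis
  also have "integral {0..\<rho>} (\<lambda>r. f (- (\<i> * of_real r))) = integral {-\<rho>..0} (\<lambda>t. f (\<i> * of_real t))"
    using has_integral_reflect_lemma_real[OF integrable_integral[OF int], of "-\<rho>" 0] by (simp add: integral_unique)
  also have "integral {0..\<rho>} (\<lambda>t. f (\<i> * of_real t)) + integral {-\<rho>..0} (\<lambda>t. f (\<i> * of_real t))
      = integral {-\<rho>..\<rho>} (\<lambda>t. f (\<i> * of_real t))"
    using Henstock_Kurzweil_Integration.integral_combine[of "-\<rho>" 0 \<rho> "\<lambda>t. f (\<i> * of_real t)"] int \<rho>
    by (simp add: add.commute)
  finally show ?thesis unfolding K_def H_def by simp
qed

text \<open>
  The half circle has angle \<open>\<pi>\<close>, and \<open>z f(z)\<close> is close to \<open>-y\<close> on all of it when its radius is large.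
\<close>

lemma half_plane_pv_integral:
  fixes f f' :: "complex \<Rightarrow> 'v::complex_banach"
  assumes quad: "\<And>r. \<exists>C. \<forall>z w. Re z \<le> 0 \<and> Re w \<le> 0 \<and> cmod z \<le> r \<and> cmod w \<le> r \<longrightarrow>
                    norm (f w - f z - (w - z) *\<^sub>C f' z) \<le> C * (cmod (w - z))\<^sup>2"
    and lim: "\<And>e. e > 0 \<Longrightarrow> \<exists>r. \<forall>z. Re z \<le> 0 \<and> cmod z > r \<longrightarrow> norm (z *\<^sub>C f z + y) < e"
  shows "pv_integral (\<lambda>t. f (\<i> * of_real t)) (pi *\<^sub>R y)"
proof -
  note d = half_plane_derivative[OF quad]
  let ?A = "{z. Re z \<le> 0}" let ?J = "{pi/2..3*pi/2}"
  have cf: "continuous_on ?A f"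
    using d(1) by (auto simp: continuous_on_eq_continuous_within intro: has_derivative_continuous)
  have int: "(\<lambda>t. f (\<i> * of_real t)) integrable_on {a..b}" for a b
    by (intro integrable_continuous_real continuous_intros continuous_on_compose2[OF cf]) auto
  have "((\<lambda>\<rho>. integral {-\<rho>..\<rho>} (\<lambda>t. f (\<i> * of_real t))) \<longlongrightarrow> pi *\<^sub>R y) at_top"
  proof (rule tendstoI)
    fix e :: real assume "e > 0"
    then obtain r where r: "\<And>z. Re z \<le> 0 \<Longrightarrow> cmod z > r \<Longrightarrow> norm (z *\<^sub>C f z + y) < e / 4"
      using lim[of "e / 4"] by auto
    have "dist (integral {-\<rho>..\<rho>} (\<lambda>t. f (\<i> * of_real t))) (pi *\<^sub>R y) < e" if "\<rho> \<ge> max 0 r + 1" for \<rho>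
    proof -
      let ?h = "\<lambda>\<phi>. (of_real \<rho> * cis \<phi>) *\<^sub>C f (of_real \<rho> * cis \<phi>)"
      have \<rho>: "0 \<le> \<rho>" "r < \<rho>" using that by auto
      have inA: "of_real \<rho> * cis \<phi> \<in> ?A" if "\<phi> \<in> ?J" for \<phi>
      proof -
        have "0 \<le> cos (\<phi> - pi)" using that by (intro cos_ge_zero) auto
        then show ?thesis using \<rho> by (simp add: mult_nonneg_nonpos)
      qed
      have hint: "?h integrable_on ?J" using inA
        by (intro integrable_continuous_real continuous_intros continuous_on_compose2[OF cf]) auto
      have b: "norm (?h \<phi> + y) \<le> e / 4" if "\<phi> \<in> ?J" for \<phi>
        using r[of "of_real \<rho> * cis \<phi>"] inA[OF that] \<rho> by (simp add: norm_mult less_imp_le)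
      have "((\<lambda>\<phi>. ?h \<phi> + y) has_integral integral ?J ?h + pi *\<^sub>R y) ?J"
        using has_integral_add[OF integrable_integral[OF hint] has_integral_const_real[of y "pi/2" "3*pi/2"]] by simp
      then have "norm (integral ?J ?h + pi *\<^sub>R y) \<le> e / 4 * measure lborel ?J"
        by (rule has_integral_bound_real[of "e / 4" "{}", rotated 2]) (use b \<open>e > 0\<close> in auto)
      also have "\<dots> < e" using pi_less_4 \<open>e > 0\<close> by (simp add: field_simps)
      finally show ?thesis
        using half_circle_Cauchy[of f f' \<rho>] d \<rho>(1) norm_minus_cancel[of "integral ?J ?h + pi *\<^sub>R y"]
        by (simp add: dist_norm)
    qed
    then show "\<forall>\<^sub>F \<rho> in at_top. dist (integral {-\<rho>..\<rho>} (\<lambda>t. f (\<i> * of_real t))) (pi *\<^sub>R y) < e"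
      unfolding eventually_at_top_linorder by blast
  qed
  with int show ?thesis by (simp add: pv_integral_def)
qed

text \<open>
  One factor \<open>P\<close> in the resolvent equation makes \<open>L(\<lambda>) P x\<close> a locally Lipschitz function of \<open>\<lambda>\<close>; applying
  the equation again, with a second factor \<open>P\<close>, shows that \<open>L(\<lambda>) P\<^sup>2 x\<close> has the derivative
  \<open>L(\<lambda>)\<^sup>2 P x\<close> with a quadratic remainder.
\<close>

lemma pseudo_resolvent_pv_integral:
  fixes L :: "complex \<Rightarrow> 'v::complex_banach \<Rightarrow> 'v"
  assumes id: "\<And>\<nu> \<mu> x. Re \<nu> \<le> 0 \<Longrightarrow> Re \<mu> \<le> 0 \<Longrightarrow> L \<nu> (P x) - L \<mu> (P x) = (\<nu> - \<mu>) *\<^sub>C L \<nu> (L \<mu> x)"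
    and comm: "\<And>\<nu> x. Re \<nu> \<le> 0 \<Longrightarrow> L \<nu> (P x) = P (L \<nu> x)"
    and bound: "\<And>\<nu> x. Re \<nu> \<le> 0 \<Longrightarrow> norm (L \<nu> x) \<le> K * (1 + cmod \<nu>) * norm x" and K: "0 \<le> K"
    and lim: "\<And>e. e > 0 \<Longrightarrow> \<exists>r. \<forall>\<nu>. Re \<nu> \<le> 0 \<and> cmod \<nu> > r \<longrightarrow> norm (\<nu> *\<^sub>C L \<nu> (P (P x)) + y) < e"
  shows "pv_integral (\<lambda>t. L (\<i> * of_real t) (P (P x))) (pi *\<^sub>R y)"
proof (rule half_plane_pv_integral[where f = "\<lambda>z. L z (P (P x))" and f' = "\<lambda>z. L z (L z (P x))"])
  fix r :: real
  define C where "C = (K * (1 + \<bar>r\<bar>)) ^ 3 * norm x"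
  have "norm (L w (P (P x)) - L z (P (P x)) - (w - z) *\<^sub>C L z (L z (P x))) \<le> C * (cmod (w - z))\<^sup>2"
    if zw: "Re z \<le> 0" "Re w \<le> 0" "cmod z \<le> r" "cmod w \<le> r" for z w
  proof -
    have "L w (P (P x)) - L z (P (P x)) = (w - z) *\<^sub>C L w (P (L z x))"
      using id[OF zw(2,1), of "P x"] comm[OF zw(1), of x] by simp
    moreover have "L w (P (L z x)) - L z (P (L z x)) = (w - z) *\<^sub>C L w (L z (L z x))"
      using id[OF zw(2,1), of "L z x"] by simp
    then have "(w - z) *\<^sub>C (L w (P (L z x)) - L z (P (L z x))) = (w - z) *\<^sub>C (w - z) *\<^sub>C L w (L z (L z x))" by simp
    then have "(w - z) *\<^sub>C L w (P (L z x)) - (w - z) *\<^sub>C L z (P (L z x)) = ((w - z) * (w - z)) *\<^sub>C L w (L z (L z x))"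
      by (simp only: scaleC.diff_right scaleC_scaleC)
    ultimately have eq: "L w (P (P x)) - L z (P (P x)) - (w - z) *\<^sub>C L z (L z (P x)) = ((w - z) * (w - z)) *\<^sub>C L w (L z (L z x))"
      using comm[OF zw(1), of x] by simp
    have b: "norm (L \<nu> u) \<le> K * (1 + \<bar>r\<bar>) * norm u" if "Re \<nu> \<le> 0" "cmod \<nu> \<le> r" for \<nu> u
    proof -
      have "K * (1 + cmod \<nu>) * norm u \<le> K * (1 + \<bar>r\<bar>) * norm u"
        using that K by (intro mult_right_mono mult_left_mono) auto
      then show ?thesis using bound[OF that(1), of u] by linarith
    qed
    define k where "k = K * (1 + \<bar>r\<bar>)"
    have k: "k \<ge> 0" using K by (simp add: k_def)
    have "norm (L w (L z (L z x))) \<le> k * (k * (k * norm x))"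
      using b[OF zw(2,4), of "L z (L z x)"] mult_left_mono[OF b[OF zw(1,3), of "L z x"] k]
        mult_left_mono[OF mult_left_mono[OF b[OF zw(1,3), of x] k] k]
      unfolding k_def[symmetric] by linarith
    then have "norm (L w (L z (L z x))) \<le> C" by (simp add: C_def k_def power3_eq_cube mult_ac)
    then show ?thesis unfolding eq norm_scaleC norm_mult power2_eq_square
      by (simp add: mult.commute[of _ "cmod (w - z) * cmod (w - z)"] mult_left_mono)
  qed
  then show "\<exists>C. \<forall>z w. Re z \<le> 0 \<and> Re w \<le> 0 \<and> cmod z \<le> r \<and> cmod w \<le> r \<longrightarrow>
      norm (L w (P (P x)) - L z (P (P x)) - (w - z) *\<^sub>C L z (L z (P x))) \<le> C * (cmod (w - z))\<^sup>2" by blast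
qed (rule lim)

text \<open>
  The reflected function \<open>z \<mapsto> -1 / (z + l)\<close> is holomorphic in the left half-plane and is a scalar
  resolvent, so the contour can be closed on the left.
\<close>

lemma pv_integral_inverse:
  assumes "Re l < 0"
  shows "pv_integral (\<lambda>t. 1 / (\<i> * of_real t - l)) (of_real pi)"
proof -
  define f where "f z = - 1 / (z + l)" for z
  have nz: "z + l \<noteq> 0" if "Re z \<le> 0" for z using that assms by (auto simp: complex_eq_iff)
  have "pv_integral (\<lambda>t. f (\<i> * of_real t) * id (id 1)) (pi *\<^sub>R 1)"
  proof (rule pseudo_resolvent_pv_integral[where K = "1 / \<bar>Re l\<bar>" and L = "\<lambda>z x. f z * x" and P = id])
    fix z w x :: complex assume "Re z \<le> 0" "Re w \<le> 0"
    then show "f z * id x - f w * id x = (z - w) *\<^sub>C (f z * (f w * x))"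
      using nz[of z] nz[of w] by (simp add: f_def scaleC_complex_def field_simps)
  next
    fix z x :: complex assume z: "Re z \<le> 0"
    have "\<bar>Re l\<bar> \<le> cmod (z + l)" using abs_Re_le_cmod[of "z + l"] z assms by simp
    moreover have "cmod (f z) = 1 / cmod (z + l)" by (simp add: f_def norm_divide)
    ultimately have "cmod (f z) \<le> 1 / \<bar>Re l\<bar>" using assms frac_le[of 1 1 "\<bar>Re l\<bar>" "cmod (z + l)"] by simp
    also have "\<dots> \<le> 1 / \<bar>Re l\<bar> * (1 + cmod z)" using mult_left_mono[of 1 "1 + cmod z" "1 / \<bar>Re l\<bar>"] by simp
    finally show "norm (f z * x) \<le> 1 / \<bar>Re l\<bar> * (1 + cmod z) * norm x"
      unfolding norm_mult by (intro mult_right_mono) auto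
  next
    fix e :: real assume e: "e > 0"
    have "norm (z *\<^sub>C (f z * id (id 1)) + 1) < e" if z: "Re z \<le> 0" "cmod z > cmod l + cmod l / e" for z
    proof -
      have eq: "z *\<^sub>C (f z * id (id 1)) + 1 = l / (z + l)" using nz[OF z(1)] by (simp add: f_def scaleC_complex_def field_simps)
      have "cmod l / e < cmod (z + l)" using z(2) norm_diff_ineq[of z l] by linarith
      moreover have "cmod (z + l) > 0" using nz[OF z(1)] by simp
      ultimately show ?thesis unfolding eq using e by (simp add: norm_divide field_simps)
    qed
    then show "\<exists>r. \<forall>z. Re z \<le> 0 \<and> cmod z > r \<longrightarrow> norm (z *\<^sub>C (f z * id (id 1)) + 1) < e" by blast
  qed auto
  then have "pv_integral (\<lambda>t. f (\<i> * of_real t)) (of_real pi)" by (simp add: scaleR_conv_of_real)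
  from pv_integral_reflect[OF this] show ?thesis
    by (rule back_subst[of "\<lambda>h. pv_integral h (of_real pi)"])
      (simp add: f_def fun_eq_iff divide_simps add_eq_0_iff nz)
qed

section \<open>Projections onto complementary closed subspaces\<close>

lemma proj_along_unique:
  assumes "complementary_closed U W" "u \<in> U" "x - u \<in> W"
  shows "proj_along U W x = u"
  unfolding proj_along_def
proof (rule the_equality)
  show "u \<in> U \<and> x - u \<in> W" using assms by simp
  fix v assume v: "v \<in> U \<and> x - v \<in> W"
  have "v - u \<in> U" using assms v by (auto simp: complementary_closed_def intro: complex_vector.subspace_diff)
  moreover have "(x - u) - (x - v) \<in> W"
    using assms(1,3) v complex_vector.subspace_diff[of W "x - u" "x - v"] by (simp add: complementary_closed_def)
  then have "v - u \<in> W" by simp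
  ultimately have "v - u = 0" using assms(1) unfolding complementary_closed_def by blast
  then show "v = u" by simp
qed

lemma
  assumes c: "complementary_closed U W"
  shows proj_along_mem: "proj_along U W x \<in> U"
    and proj_along_complement_mem: "x - proj_along U W x \<in> W"
    and proj_along_swap: "proj_along W U x = x - proj_along U W x"
    and proj_along_add: "proj_along U W (x + y) = proj_along U W x + proj_along U W y"
    and proj_along_scaleC: "proj_along U W (a *\<^sub>C x) = a *\<^sub>C proj_along U W x"
    and complementary_closed_swap: "complementary_closed W U"
proof -
  have sU: "complex_vector.subspace U" and sW: "complex_vector.subspace W"
    using c by (auto simp: complementary_closed_def)
  have ex: "\<exists>u\<in>U. x - u \<in> W" for x
    using c unfolding complementary_closed_def by (metis add_diff_cancel_left')
  show m1: "proj_along U W x \<in> U" and m2: "x - proj_along U W x \<in> W" for x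
    using ex[of x] proj_along_unique[OF c] by auto
  show sw: "complementary_closed W U"
    using c unfolding complementary_closed_def by (metis Int_commute add.commute)
  show "proj_along W U x = x - proj_along U W x"
    by (rule proj_along_unique[OF sw]) (use m1 m2 in auto)
  show "proj_along U W (x + y) = proj_along U W x + proj_along U W y"
  proof (rule proj_along_unique[OF c])
    have "(x - proj_along U W x) + (y - proj_along U W y) \<in> W"
      using m2 sW by (intro complex_vector.subspace_add)
    then show "x + y - (proj_along U W x + proj_along U W y) \<in> W" by (simp add: algebra_simps)
  qed (intro complex_vector.subspace_add sU m1)
  show "proj_along U W (a *\<^sub>C x) = a *\<^sub>C proj_along U W x"
  proof (rule proj_along_unique[OF c])
    have "a *\<^sub>C (x - proj_along U W x) \<in> W" by (intro complex_vector.subspace_scale sW m2)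
    then show "a *\<^sub>C x - a *\<^sub>C proj_along U W x \<in> W" by (simp add: scaleC.diff_right)
  qed (intro complex_vector.subspace_scale sU m1)
qed

lemma proj_along_eq_self: "complementary_closed U W \<Longrightarrow> u \<in> U \<Longrightarrow> proj_along U W u = u"
  by (rule proj_along_unique) (auto simp: complementary_closed_def complex_vector.subspace_0)

lemma proj_along_zero: "complementary_closed U W \<Longrightarrow> w \<in> W \<Longrightarrow> proj_along U W w = 0"
  by (rule proj_along_unique) (auto simp: complementary_closed_def complex_vector.subspace_0)

text \<open>
  Let \<open>A n\<close> be the set of all \<open>x\<close> whose projection has norm at most \<open>n\<close>. These sets cover the space, so
  the closure of one of them has interior points by Baire's theorem. This makes the projection bounded on a dense
  part of a ball, and successive approximation, as in the open mapping theorem, extends the bound to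
  all vectors: the images of the correction terms are summable, and closedness of the two subspaces
  identifies their sum.
\<close>

lemma proj_along_bounded:
  fixes U W :: "'v::complex_banach set"
  assumes c: "complementary_closed U W"
  shows "\<exists>C\<ge>0. \<forall>x. norm (proj_along U W x) \<le> C * norm x"
proof -
  let ?P = "proj_along U W"
  note add = proj_along_add[OF c]
  have scaleR: "?P (r *\<^sub>R x) = r *\<^sub>R ?P x" for r x
    by (simp add: scaleR_scaleC proj_along_scaleC[OF c])
  interpret P: linear ?P by standard (use add scaleR in auto)
  define A where "A n = {x. norm (?P x) \<le> real n}" for n :: nat
  have "\<exists>n. interior (closure (A n)) \<noteq> {}"
  proof (rule ccontr)
    assume "\<nexists>n. interior (closure (A n)) \<noteq> {}"
    then have "Met_TC.mtopology interior_of \<Union> (range (\<lambda>n. closure (A n))) = {}"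
      by (intro Met_TC.metric_Baire_category_alt) (auto simp: complete_UNIV)
    moreover have "x \<in> \<Union> (range (\<lambda>n. closure (A n)))" for x
      using real_arch_simple[of "norm (?P x)"] closure_subset by (fastforce simp: A_def)
    then have "\<Union> (range (\<lambda>n. closure (A n))) = UNIV" by blast
    ultimately show False by simp
  qed
  then obtain n x0 where x0: "x0 \<in> interior (closure (A n))" by auto
  then obtain r where r: "r > 0" "ball x0 r \<subseteq> closure (A n)" using mem_interior by blast
  \<comment> \<open>Multiples of differences of points of \<open>A n\<close> approximate every vector up to half its size.\<close>
  have approx: "\<exists>y. norm (?P y) \<le> 4 * real n / r * s \<and> norm (x - y) \<le> s / 2" if x: "norm x \<le> s" and s: "s > 0" for x s
  proof -
    let ?x = "(r / (2 * s)) *\<^sub>R x"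
    have nx: "norm ?x < r" using x s r(1) by (simp add: field_simps)
    have "x0 + ?x \<in> closure (A n)" "x0 \<in> closure (A n)" using r nx by (auto simp: dist_norm)
    then obtain a b where ab: "a \<in> A n" "b \<in> A n" "norm (a - (x0 + ?x)) < r/8" "norm (b - x0) < r/8"
      using r(1) unfolding closure_approachable dist_norm by (metis divide_pos_pos zero_less_numeral)
    have "norm (?P (a - b)) \<le> real n + real n"
      using ab norm_triangle_ineq4[of "?P a" "?P b"] by (simp add: A_def P.diff)
    moreover have "norm ((a - b) - ?x) \<le> r / 4"
    proof -
      have "(a - b) - ?x = (a - (x0 + ?x)) - (b - x0)" by simp
      then have "norm ((a - b) - ?x) \<le> norm (a - (x0 + ?x)) + norm (b - x0)"
        using norm_triangle_ineq4[of "a - (x0 + ?x)" "b - x0"]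
        by (simp add: algebra_simps)
      then show ?thesis using ab(3,4) by linarith
    qed
    ultimately have 1: "norm (?P (a - b)) \<le> 2 * real n" "norm ((a - b) - ?x) \<le> r / 4" by auto
    let ?y = "(2 * s / r) *\<^sub>R (a - b)"
    have "norm (?P ?y) \<le> 2 * s / r * (2 * real n)" using 1(1) s r(1)
      by (simp add: scaleR mult_left_mono divide_right_mono)
    moreover have "x - ?y = - ((2 * s / r) *\<^sub>R ((a - b) - ?x))"
      using r(1) s by (simp add: scaleR_diff_right)
    then have "norm (x - ?y) = 2 * s / r * norm ((a - b) - ?x)" using s r(1) by simp
    then have "norm (x - ?y) \<le> 2 * s / r * (r / 4)"
      using 1(2) s r(1) by (metis mult_left_mono divide_nonneg_pos less_imp_le mult_nonneg_nonneg zero_le_numeral)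
    ultimately show ?thesis using r(1) by (intro exI[of _ ?y]) (auto simp: field_simps)
  qed
  define M where "M = 4 * real n / r"
  have M: "M \<ge> 0" using r by (simp add: M_def)
  obtain Y where Y: "\<And>x s. norm x \<le> s \<Longrightarrow> s > 0 \<Longrightarrow> norm (?P (Y x s)) \<le> M * s \<and> norm (x - Y x s) \<le> s / 2"
    using approx unfolding M_def by metis
  have "norm (?P x) \<le> 2 * M * norm x" for x
  proof (cases "x = 0")
    case False
    define s where "s = norm x"
    have s: "s > 0" using False by (simp add: s_def)
    \<comment> \<open>Remainders of the successive approximation of \<open>x\<close>, halved in norm at each step.\<close>
    define R where "R = rec_nat x (\<lambda>k z. z - Y z (s / 2 ^ k))"
    have R0: "R 0 = x" and RS: "R (Suc k) = R k - Y (R k) (s / 2 ^ k)" for k by (simp_all add: R_def)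
    have Rk: "norm (R k) \<le> s / 2 ^ k" for k
    proof (induction k)
      case 0 then show ?case by (simp add: R0 s_def)
    next
      case (Suc k)
      then show ?case using Y[of "R k" "s / 2 ^ k"] s by (simp add: RS field_simps)
    qed
    define y where "y k = Y (R k) (s / 2 ^ k)" for k
    have y: "norm (?P (y k)) \<le> M * s * (1 / 2) ^ k" for k
      using Y[OF Rk[of k]] s by (simp add: y_def power_one_over field_simps)
    have sm: "summable (\<lambda>k. M * s * (1 / 2) ^ k)" by (intro summable_mult summable_geometric) simp
    have summ: "summable (\<lambda>k. norm (?P (y k)))" by (rule summable_comparison_test'[OF sm, of 0]) (use y in simp)
    define u where "u = (\<Sum>k. ?P (y k))"
    have u: "(\<lambda>k. ?P (y k)) sums u" unfolding u_def using summable_norm_cancel[OF summ] summable_sums by blast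
    have "sum y {..<k} = x - R k" for k by (induction k) (auto simp: R0 RS y_def)
    moreover have "R \<longlonglongrightarrow> 0"
    proof (rule Lim_null_comparison)
      show "\<forall>\<^sub>F k in sequentially. norm (R k) \<le> s * (1 / 2) ^ k" using Rk by (simp add: power_one_over field_simps)
      show "(\<lambda>k. s * (1 / 2) ^ k) \<longlonglongrightarrow> 0" by (intro tendsto_mult_right_zero LIMSEQ_realpow_zero) auto
    qed
    ultimately have ys: "(\<lambda>k. sum y {..<k}) \<longlonglongrightarrow> x" using tendsto_diff[OF tendsto_const, of R 0 _ x] by simp
    have Ps: "(\<lambda>k. ?P (sum y {..<k})) \<longlonglongrightarrow> u" using u by (simp add: sums_def P.sum)
    have "u \<in> U" by (rule closed_sequentially[OF _ _ Ps])
        (use c proj_along_mem[OF c] in \<open>auto simp: complementary_closed_def\<close>)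
    moreover have "x - u \<in> W" by (rule closed_sequentially[OF _ _ tendsto_diff[OF ys Ps]])
        (use c proj_along_complement_mem[OF c] in \<open>auto simp: complementary_closed_def\<close>)
    ultimately have "?P x = u" by (rule proj_along_unique[OF c])
    also have "norm u \<le> (\<Sum>k. M * s * (1 / 2) ^ k)"
      unfolding u_def by (rule order_trans[OF summable_norm[OF summ]]) (intro suminf_le y summ sm)
    also have "\<dots> = M * s * 2" using suminf_geometric[of "1/2::real"] by (subst suminf_mult) (auto intro!: summable_geometric)
    finally show ?thesis by (simp add: s_def mult_ac)
  qed (simp add: P.zero)
  then show ?thesis using M by (intro exI[of _ "2 * M"]) auto
qed

section \<open>Resolvents and their perturbation\<close>

text \<open>
  Membership in the resolvent set is kept together with a bound, because every argument below moves
  both from one point or operator to another.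
\<close>

definition resolvent_bound :: "'v set \<Rightarrow> ('v \<Rightarrow> 'v::complex_banach) \<Rightarrow> complex \<Rightarrow> real \<Rightarrow> bool" where
  "resolvent_bound D T z M \<longleftrightarrow> z \<in> resolvent_set UNIV D T \<and> bounded_by UNIV (resolvent D T z) M"

lemma resolvent_props:
  assumes "z \<in> resolvent_set X D T"
  shows "x \<in> X \<Longrightarrow> resolvent D T z x \<in> D"
    and "x \<in> X \<Longrightarrow> T (resolvent D T z x) - z *\<^sub>C resolvent D T z x = x"
    and "x \<in> D \<Longrightarrow> resolvent D T z (T x - z *\<^sub>C x) = x"
proof -
  have b: "bij_betw (\<lambda>x. T x - z *\<^sub>C x) D X" using assms by (auto simp: resolvent_set_def)
  then have i: "inj_on (\<lambda>x. T x - z *\<^sub>C x) D" and im: "(\<lambda>x. T x - z *\<^sub>C x) ` D = X"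
    by (auto simp: bij_betw_def)
  show "resolvent D T z x \<in> D" if "x \<in> X"
    unfolding resolvent_def using the_inv_into_into[OF i] im that by blast
  show "T (resolvent D T z x) - z *\<^sub>C resolvent D T z x = x" if "x \<in> X"
    unfolding resolvent_def using f_the_inv_into_f[OF i] im that by simp
  show "resolvent D T z (T x - z *\<^sub>C x) = x" if "x \<in> D"
    unfolding resolvent_def using the_inv_into_f_f[OF i that] by simp
qed

text \<open>
  A two-sided inverse is the resolvent; this avoids the description operator behind \<open>the_inv_into\<close>.
\<close>

lemma resolvent_setI:
  assumes "\<And>x. x \<in> X \<Longrightarrow> G x \<in> D" "\<And>x. x \<in> X \<Longrightarrow> T (G x) - z *\<^sub>C G x = x"
    and "\<And>x. x \<in> D \<Longrightarrow> T x - z *\<^sub>C x \<in> X" "\<And>x. x \<in> D \<Longrightarrow> G (T x - z *\<^sub>C x) = x"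
    and "\<And>x. x \<in> X \<Longrightarrow> norm (G x) \<le> M * norm x"
  shows "z \<in> resolvent_set X D T" and "\<And>x. x \<in> X \<Longrightarrow> resolvent D T z x = G x"
    and "bounded_by X (resolvent D T z) M"
proof -
  have b: "bij_betw (\<lambda>x. T x - z *\<^sub>C x) D X"
    by (rule bij_betwI[where g = G]) (use assms in auto)
  show eq: "resolvent D T z x = G x" if "x \<in> X" for x
    unfolding resolvent_def
    by (rule the_inv_into_f_eq) (use b assms that in \<open>auto simp: bij_betw_def\<close>)
  show "bounded_by X (resolvent D T z) M" using eq assms(5) by (simp add: bounded_by_def)
  with b show "z \<in> resolvent_set X D T" unfolding resolvent_set_def by blast
qed

lemma lin_operatorD:
  assumes "lin_operator X D S"
  shows "x \<in> D \<Longrightarrow> y \<in> D \<Longrightarrow> S (x + y) = S x + S y" "x \<in> D \<Longrightarrow> S (a *\<^sub>C x) = a *\<^sub>C S x"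
    "x \<in> D \<Longrightarrow> y \<in> D \<Longrightarrow> x + y \<in> D" "x \<in> D \<Longrightarrow> y \<in> D \<Longrightarrow> x - y \<in> D" "x \<in> D \<Longrightarrow> a *\<^sub>C x \<in> D" "0 \<in> D"
    "x \<in> D \<Longrightarrow> y \<in> D \<Longrightarrow> S (x - y) = S x - S y" "x \<in> D \<Longrightarrow> S x \<in> X" "x \<in> D \<Longrightarrow> x \<in> X"
    "complex_vector.subspace X" "closed X"
proof -
  show *: "x \<in> D \<Longrightarrow> y \<in> D \<Longrightarrow> S (x + y) = S x + S y" "x \<in> D \<Longrightarrow> S (a *\<^sub>C x) = a *\<^sub>C S x" for x y a
    using assms by (auto simp: lin_operator_def)
  have D: "complex_vector.subspace D" using assms by (simp add: lin_operator_def)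
  show "x \<in> D \<Longrightarrow> y \<in> D \<Longrightarrow> x + y \<in> D" "x \<in> D \<Longrightarrow> y \<in> D \<Longrightarrow> x - y \<in> D" "0 \<in> D" "x \<in> D \<Longrightarrow> a *\<^sub>C x \<in> D"
    using D by (auto intro: complex_vector.subspace_add complex_vector.subspace_diff
        complex_vector.subspace_scale complex_vector.subspace_0)
  show "S (x - y) = S x - S y" if "x \<in> D" "y \<in> D"
  proof -
    have "x - y \<in> D" using that D complex_vector.subspace_diff by blast
    from *(1)[OF this that(2)] show ?thesis by simp
  qed
  show "x \<in> D \<Longrightarrow> S x \<in> X" "x \<in> D \<Longrightarrow> x \<in> X" "complex_vector.subspace X" "closed X"
    using assms by (auto simp: lin_operator_def)
qed

lemma resolvent_linear:
  assumes l: "lin_operator X D T" and z: "z \<in> resolvent_set X D T"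
  shows "x \<in> X \<Longrightarrow> y \<in> X \<Longrightarrow> resolvent D T z (x + y) = resolvent D T z x + resolvent D T z y"
    and "x \<in> X \<Longrightarrow> resolvent D T z (a *\<^sub>C x) = a *\<^sub>C resolvent D T z x"
proof -
  note p = resolvent_props[OF z] and d = lin_operatorD[OF l]
  let ?G = "resolvent D T z"
  show "?G (x + y) = ?G x + ?G y" if "x \<in> X" "y \<in> X"
  proof -
    have "?G x + ?G y \<in> D" using p(1) that d(3) by blast
    moreover have "T (?G x + ?G y) - z *\<^sub>C (?G x + ?G y) = (T (?G x) - z *\<^sub>C ?G x) + (T (?G y) - z *\<^sub>C ?G y)"
      using p(1) that by (simp add: d(1) scaleC.add_right)
    then have "T (?G x + ?G y) - z *\<^sub>C (?G x + ?G y) = x + y" using p(2) that by simp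
    ultimately show ?thesis using p(3) by metis
  qed
  show "?G (a *\<^sub>C x) = a *\<^sub>C ?G x" if "x \<in> X"
  proof -
    have "a *\<^sub>C ?G x \<in> D" using p(1) that d(5) by blast
    moreover have "T (a *\<^sub>C ?G x) - z *\<^sub>C (a *\<^sub>C ?G x) = a *\<^sub>C (T (?G x) - z *\<^sub>C ?G x)"
      using p(1) that by (simp add: d(2) scaleC.diff_right scaleC_scaleC mult.commute)
    then have "T (a *\<^sub>C ?G x) - z *\<^sub>C (a *\<^sub>C ?G x) = a *\<^sub>C x" using p(2) that by simp
    ultimately show ?thesis using p(3) by metis
  qed
qed

lemma resolvent_bounded_linear:
  assumes l: "lin_operator UNIV D T" and z: "z \<in> resolvent_set UNIV D T"
  shows "bounded_linear (resolvent D T z)"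
proof -
  obtain M where "\<And>x. norm (resolvent D T z x) \<le> M * norm x"
    using z by (auto simp: resolvent_set_def bounded_by_def)
  then show ?thesis
    by (intro bounded_linear_intro[where K = M])
      (auto simp: resolvent_linear[OF l z] scaleR_scaleC mult.commute)
qed

text \<open>
  On \<open>D\<close> we have \<open>T - w = (1 + B (S - z)\<^sup>-\<^sup>1) (S - z)\<close>, and the first factor is invertible by the
  contraction principle. With \<open>B = R\<close> this treats the perturbed operator at the same point, and with
  \<open>B\<close> a multiple of the identity the same operator at a nearby point.
\<close>

lemma resolvent_perturbation:
  fixes S B :: "'v::complex_banach \<Rightarrow> 'v"
  assumes l: "lin_operator UNIV D S" and z: "resolvent_bound D S z M" and M: "0 \<le> M"
    and B_add: "\<And>x y. x \<in> D \<Longrightarrow> y \<in> D \<Longrightarrow> B (x + y) = B x + B y"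
    and q: "0 \<le> q" "q < 1" "\<And>x. norm (B (resolvent D S z x)) \<le> q * norm x"
    and T: "\<And>x. x \<in> D \<Longrightarrow> T x - w *\<^sub>C x = S x - z *\<^sub>C x + B x"
  shows "resolvent_bound D T w (M / (1 - q))"
proof -
  let ?G = "resolvent D S z"
  have z': "z \<in> resolvent_set UNIV D S" and Mb: "norm (?G x) \<le> M * norm x" for x
    using z by (auto simp: resolvent_bound_def bounded_by_def)
  note p = resolvent_props[OF z', simplified] and Gl = resolvent_linear[OF l z', simplified]
  have Gdiff: "?G (x - y) = ?G x - ?G y" for x y
    using Gl(1)[of "x - y" y] by simp
  have Bdiff: "B (?G x - ?G y) = B (?G x) - B (?G y)" for x y
  proof -
    have "?G x - ?G y \<in> D" using p(1)[of "x - y"] by (simp add: Gdiff)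
    from B_add[OF this p(1)[of y]] show ?thesis by simp
  qed
  have "\<exists>!y. x - B (?G y) = y" for x
  proof (rule banach_fix_type[OF q(1,2)], intro allI)
    show "dist (x - B (?G y)) (x - B (?G y')) \<le> q * dist y y'" for y y'
      using q(3)[of "y' - y"] by (simp add: dist_norm Gdiff Bdiff norm_minus_commute)
  qed
  then obtain E where E: "\<And>x. x - B (?G (E x)) = E x" and Eu: "\<And>x y. x - B (?G y) = y \<Longrightarrow> y = E x"
    by metis
  have En: "norm (E x) \<le> norm x / (1 - q)" for x
  proof -
    have "norm (E x) \<le> norm x + norm (B (?G (E x)))" by (metis E norm_triangle_ineq4)
    then have "norm (E x) * (1 - q) \<le> norm x" using q(3)[of "E x"] by (simp add: algebra_simps)
    then show ?thesis using q by (simp add: field_simps)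
  qed
  have "norm (?G (E x)) \<le> M / (1 - q) * norm x" for x
    using order_trans[OF Mb[of "E x"] mult_left_mono[OF En M]] by simp
  moreover have "T (?G (E x)) - w *\<^sub>C ?G (E x) = x" for x
    using T[OF p(1), of "E x"] p(2)[of "E x"] E[of x] by (simp add: algebra_simps)
  moreover have "?G (E (T x - w *\<^sub>C x)) = x" if "x \<in> D" for x
  proof -
    have "S x - z *\<^sub>C x = E (T x - w *\<^sub>C x)"
      by (rule Eu) (simp add: T that p(3))
    then show ?thesis using p(3)[OF that] by simp
  qed
  ultimately show ?thesis
    unfolding resolvent_bound_def using p(1) resolvent_setI[of UNIV "\<lambda>x. ?G (E x)" D T w "M / (1 - q)"] by simp
qed

lemma resolvent_bound_nearby:
  assumes l: "lin_operator UNIV D S" and z: "resolvent_bound D S z M" "0 \<le> M" and w: "cmod (w - z) * M \<le> 1 / 2"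
  shows "resolvent_bound D S w (2 * M)"
proof -
  have "resolvent_bound D S w (M / (1 - 1/2))"
  proof (rule resolvent_perturbation[OF l z, of "\<lambda>x. - ((w - z) *\<^sub>C x)"])
    show "norm (- ((w - z) *\<^sub>C resolvent D S z x)) \<le> 1 / 2 * norm x" for x
    proof -
      have "cmod (w - z) * norm (resolvent D S z x) \<le> cmod (w - z) * (M * norm x)"
        using z by (intro mult_left_mono) (auto simp: resolvent_bound_def bounded_by_def)
      also have "\<dots> \<le> 1 / 2 * norm x" using mult_right_mono[OF w norm_ge_zero[of x]] by simp
      finally show ?thesis by (simp add: norm_scaleC)
    qed
  qed (auto simp: scaleC.add_right scaleC.diff_left)
  then show ?thesis by (simp add: mult.commute)
qed

lemma resolvent_identity:
  assumes l: "lin_operator X D T" and z: "z \<in> resolvent_set X D T" and w: "w \<in> resolvent_set X D T" and x: "x \<in> X"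
  shows "resolvent D T z x - resolvent D T w x = (z - w) *\<^sub>C resolvent D T z (resolvent D T w x)"
proof -
  let ?G = "resolvent D T"
  note pz = resolvent_props[OF z] and pw = resolvent_props[OF w] and d = lin_operatorD[OF l]
  have gw: "?G w x \<in> D" using pw(1) x by blast
  have gX: "a *\<^sub>C ?G w x \<in> X" for a using gw d(5,9) by blast
  have "?G w x = ?G z (T (?G w x) - z *\<^sub>C ?G w x)" using pz(3) gw by simp
  also have "T (?G w x) - z *\<^sub>C ?G w x = x + (w - z) *\<^sub>C ?G w x"
    using pw(2)[OF x] by (simp add: scaleC.diff_left algebra_simps)
  also have "?G z \<dots> = ?G z x + (w - z) *\<^sub>C ?G z (?G w x)"
    using resolvent_linear[OF l z] x gX gw d(9) by simp
  finally show ?thesis by (simp add: scaleC.diff_left algebra_simps)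
qed

lemma resolvent_uminus:
  assumes l: "lin_operator X D S" and z: "z \<in> resolvent_set X D S"
  shows "- z \<in> resolvent_set X D (\<lambda>x. - S x)"
    and "x \<in> X \<Longrightarrow> resolvent D (\<lambda>x. - S x) (- z) x = - resolvent D S z x"
proof -
  note p = resolvent_props[OF z] and d = lin_operatorD[OF l]
  obtain M where M: "\<And>x. x \<in> X \<Longrightarrow> norm (resolvent D S z x) \<le> M * norm x"
    using z by (auto simp: resolvent_set_def bounded_by_def)
  have X: "S x - z *\<^sub>C x \<in> X" if "x \<in> D" for x
    using that d by (intro complex_vector.subspace_diff) auto
  have *: "- resolvent D S z x \<in> D" if "x \<in> X" for x
    using d(5)[OF p(1)[OF that], of "-1"] by (simp add: scaleC.minus_left scaleC_one)
  have S: "S (- resolvent D S z x) = - S (resolvent D S z x)" if "x \<in> X" for x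
    using d(2)[OF p(1)[OF that], of "-1"] by (simp add: scaleC.minus_left scaleC_one)
  have R: "resolvent D S z (- x) = - resolvent D S z x" if "x \<in> X" for x
    using resolvent_linear(2)[OF l z that, of "-1"] by (simp add: scaleC.minus_left scaleC_one)
  have g: "- resolvent D S z (- S x - (- z) *\<^sub>C x) = x" if "x \<in> D" for x
    using R[OF X[OF that]] p(3)[OF that] by (simp add: scaleC.minus_left)
  have mX: "- S x - (- z) *\<^sub>C x \<in> X" if "x \<in> D" for x
    using complex_vector.subspace_scale[OF d(10) X[OF that], of "-1"] by (simp add: scaleC.minus_left scaleC_one)
  note r = resolvent_setI[of X "\<lambda>x. - resolvent D S z x" D "\<lambda>x. - S x" "- z" M]
  show "- z \<in> resolvent_set X D (\<lambda>x. - S x)"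
    by (rule r(1)) (use * S p(2) M g mX in \<open>auto simp: scaleC.minus_left scaleC.minus_right\<close>)
  show "x \<in> X \<Longrightarrow> resolvent D (\<lambda>x. - S x) (- z) x = - resolvent D S z x"
    by (rule r(2)) (use * S p(2) M g mX in \<open>auto simp: scaleC.minus_left scaleC.minus_right\<close>)
qed

lemma resolvent_bound_mono:
  "resolvent_bound D T z M \<Longrightarrow> M \<le> M' \<Longrightarrow> resolvent_bound D T z M'"
  unfolding resolvent_bound_def bounded_by_def by (meson mult_right_mono norm_ge_zero order_trans)

lemma resolvent_boundD:
  assumes "resolvent_bound D T z M"
  shows "z \<in> resolvent_set UNIV D T" "norm (resolvent D T z x) \<le> M * norm x"
    "resolvent D T z x \<in> D" "T (resolvent D T z x) - z *\<^sub>C resolvent D T z x = x"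
    "x \<in> D \<Longrightarrow> resolvent D T z (T x - z *\<^sub>C x) = x"
  using assms resolvent_props[of z UNIV D T] by (auto simp: resolvent_bound_def bounded_by_def)

lemma resolvent_continuous_on_imaginary_axis:
  assumes l: "lin_operator UNIV D T" and rb: "\<And>t. resolvent_bound D T (\<i> * of_real t) M" and M: "0 \<le> M"
  shows "continuous_on UNIV (\<lambda>t. resolvent D T (\<i> * of_real t) x)"
proof (rule lipschitz_on_continuous_on)
  show "(M * (M * norm x))-lipschitz_on UNIV (\<lambda>t. resolvent D T (\<i> * of_real t) x)"
  proof (rule lipschitz_onI)
    fix s t :: real
    let ?G = "\<lambda>t. resolvent D T (\<i> * of_real t)"
    have "?G s x - ?G t x = (\<i> * of_real s - \<i> * of_real t) *\<^sub>C ?G s (?G t x)"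
      using resolvent_identity[OF l resolvent_boundD(1)[OF rb] resolvent_boundD(1)[OF rb]] by simp
    moreover have "cmod (\<i> * of_real s - \<i> * of_real t) = dist s t"
      by (simp add: dist_real_def norm_mult flip: right_diff_distrib of_real_diff)
    ultimately have "norm (?G s x - ?G t x) = dist s t * norm (?G s (?G t x))" by (simp add: norm_scaleC)
    also have "\<dots> \<le> dist s t * (M * (M * norm x))"
      by (intro mult_left_mono order_trans[OF resolvent_boundD(2)[OF rb]] resolvent_boundD(2)[OF rb] M) auto
    finally show "dist (?G s x) (?G t x) \<le> M * (M * norm x) * dist s t" by (simp add: dist_norm mult_ac)
  qed (use M in simp)
qed

section \<open>Resolvents of sectorially dichotomous operators\<close>

text \<open>
  Sectors and bisectors are handled as cones given by the real part, which avoids case distinctions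
  for the argument.
\<close>

lemma Arg_ge_iff:
  assumes "z \<noteq> 0" "0 \<le> \<theta>" "\<theta> \<le> pi"
  shows "\<theta> \<le> \<bar>Arg z\<bar> \<longleftrightarrow> Re z \<le> cos \<theta> * cmod z"
proof -
  have "Re z = cmod z * cos \<bar>Arg z\<bar>"
    by (metis Re_rcis cos_abs_real rcis_cmod_Arg)
  moreover have "\<bar>Arg z\<bar> \<le> pi" using Arg_bounded[of z] by auto
  then have "cos \<bar>Arg z\<bar> \<le> cos \<theta> \<longleftrightarrow> \<theta> \<le> \<bar>Arg z\<bar>" using assms by (intro cos_mono_le_eq) auto
  ultimately show ?thesis using assms(1) by (simp add: mult.commute)
qed

lemma Arg_le_iff:
  assumes "z \<noteq> 0" "0 \<le> \<theta>" "\<theta> \<le> pi"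
  shows "\<bar>Arg z\<bar> \<le> \<theta> \<longleftrightarrow> cos \<theta> * cmod z \<le> Re z"
proof -
  have "Re z = cmod z * cos \<bar>Arg z\<bar>"
    by (metis Re_rcis cos_abs_real rcis_cmod_Arg)
  moreover have "\<bar>Arg z\<bar> \<le> pi" using Arg_bounded[of z] by auto
  then have "cos \<theta> \<le> cos \<bar>Arg z\<bar> \<longleftrightarrow> \<bar>Arg z\<bar> \<le> \<theta>" using assms by (intro cos_mono_le_eq) auto
  ultimately show ?thesis using assms(1) by (simp add: mult.commute)
qed

text \<open>
  The family \<open>L\<close> is the resolvent of the part of \<open>S\<close> in \<open>U\<close>, preceded by the projection onto \<open>U\<close>. The
  condition \<open>Re z \<le> \<kappa> |z|\<close> describes the complement of an open sector together with its vertex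
  \<open>z = 0\<close>; at the vertex, the sectoriality estimate has to be supplemented by the assumption that
  \<open>0\<close> is in the resolvent set.
\<close>

lemma sectorial_part:
  fixes S :: "'v::complex_banach \<Rightarrow> 'v"
  assumes c: "complementary_closed U W" and sec: "sectorial U (D \<inter> U) S \<theta>"
    and \<theta>: "0 \<le> \<theta>" and zero: "0 \<in> resolvent_set U (D \<inter> U) S"
    and \<kappa>: "0 \<le> \<kappa>" "\<kappa> < cos \<theta>"
  obtains L :: "complex \<Rightarrow> 'v \<Rightarrow> 'v" and K where "0 \<le> K"
    "\<And>z x. Re z \<le> \<kappa> * cmod z \<Longrightarrow> L z x \<in> D \<inter> U"
    "\<And>z x. Re z \<le> \<kappa> * cmod z \<Longrightarrow> S (L z x) - z *\<^sub>C L z x = proj_along U W x"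
    "\<And>z x y. Re z \<le> \<kappa> * cmod z \<Longrightarrow> x \<in> D \<inter> U \<Longrightarrow> y \<in> W \<Longrightarrow> L z (S x - z *\<^sub>C x + y) = x"
    "\<And>z x. Re z \<le> \<kappa> * cmod z \<Longrightarrow> norm (L z x) \<le> K / (1 + cmod z) * norm x"
    "\<And>x. pv_integral (\<lambda>t. L (\<i> * of_real t) x) (pi *\<^sub>R proj_along U W x)"
proof -
  let ?D = "D \<inter> U" let ?P = "proj_along U W"
  let ?R = "resolvent ?D S"
  define L where "L z x = ?R z (?P x)" for z x
  have l: "lin_operator U ?D S" and dense: "U \<subseteq> closure ?D"
    using sec by (auto simp: sectorial_def dense_lin_operator_def)
  note d = lin_operatorD[OF l]
  note Pm = proj_along_mem[OF c] and Ps = proj_along_eq_self[OF c] and Pz = proj_along_zero[OF c]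
    and Pa = proj_along_add[OF c]
  obtain C where C: "0 \<le> C" "\<And>x. norm (?P x) \<le> C * norm x" using proj_along_bounded[OF c] by blast
  define \<theta>' where "\<theta>' = arccos \<kappa>"
  have \<kappa>1: "\<kappa> \<le> 1" using \<kappa> cos_le_one[of \<theta>] by linarith
  have \<theta>': "\<theta> < \<theta>'" "\<theta>' \<le> pi" "cos \<theta>' = \<kappa>" "0 \<le> \<theta>'"
  proof -
    have \<theta>pi: "\<theta> \<le> pi" using sec by (simp add: sectorial_def)
    show c': "cos \<theta>' = \<kappa>" "\<theta>' \<le> pi" "0 \<le> \<theta>'"
      using \<kappa> \<kappa>1 arccos_lbound[of \<kappa>] arccos_ubound[of \<kappa>] by (auto simp: \<theta>'_def cos_arccos)
    show "\<theta> < \<theta>'" using cos_mono_less_eq[of \<theta> \<theta>'] c' \<kappa> \<theta> \<theta>pi cos_mono_le_eq[of \<theta>' \<theta>] by (auto simp: not_le[symmetric])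
  qed
  obtain M where M: "M > 0" "\<And>z. \<theta>' \<le> \<bar>Arg z\<bar> \<Longrightarrow> cmod z > 0 \<Longrightarrow> bounded_by U (?R z) (M / cmod z)"
    using sec \<theta>' unfolding sectorial_def by blast
  have rho: "z \<in> resolvent_set U ?D S" if "Re z \<le> \<kappa> * cmod z" for z
  proof (cases "z = 0")
    case False
    then have "\<theta>' \<le> \<bar>Arg z\<bar>" using Arg_ge_iff[OF False \<theta>'(4,2)] that \<theta>' by simp
    then have "z \<notin> sector \<theta>" using \<theta>' by (simp add: sector_def)
    then show ?thesis using sec by (auto simp: sectorial_def spectrum_def)
  qed (use zero in simp)
  obtain M0 where "\<And>x. x \<in> U \<Longrightarrow> norm (?R 0 x) \<le> M0 * norm x"
    using zero by (auto simp: resolvent_set_def bounded_by_def)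
  then have M0: "norm (?R 0 x) \<le> \<bar>M0\<bar> * norm x" if "x \<in> U" for x
    using that mult_right_mono[of M0 "\<bar>M0\<bar>" "norm x"] by (meson abs_ge_self norm_ge_zero order_trans)
  have RU: "?R z x \<in> ?D" if "Re z \<le> \<kappa> * cmod z" "x \<in> U" for z x
    using resolvent_props(1)[OF rho] that by blast
  define K0 where "K0 = M + (1 + M) * \<bar>M0\<bar>"
  have K0: "K0 \<ge> 0" using M(1) by (simp add: K0_def)
  have Rb: "norm (?R z x) \<le> K0 / (1 + cmod z) * norm x" if z: "Re z \<le> \<kappa> * cmod z" and x: "x \<in> U" for z x
  proof -
    have "(1 + cmod z) * norm (?R z x) \<le> K0 * norm x"
    proof (cases "z = 0")
      case True
      have "\<bar>M0\<bar> * norm x \<le> K0 * norm x" using M(1) by (intro mult_right_mono) (auto simp: K0_def algebra_simps)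
      then show ?thesis using M0[OF x] True by simp
    next
      case False
      have "bounded_by U (?R z) (M / cmod z)"
        using Arg_ge_iff[OF False \<theta>'(4,2)] that \<theta>' False by (intro M(2)) auto
      then have b: "cmod z * norm (?R z y) \<le> M * norm y" if "y \<in> U" for y
        using that False by (auto simp: bounded_by_def field_simps)
      \<comment> \<open>The factor \<open>z\<close> of the resolvent identity cancels the singularity of \<open>M / |z|\<close> at \<open>0\<close>.\<close>
      have "?R z x = ?R 0 x + z *\<^sub>C ?R z (?R 0 x)"
        using resolvent_identity[OF l rho[OF z] zero x] by (simp add: algebra_simps)
      then have "norm (?R z x) \<le> norm (?R 0 x) + cmod z * norm (?R z (?R 0 x))"
        by (metis norm_scaleC norm_triangle_ineq)
      also have "\<dots> \<le> norm (?R 0 x) + M * norm (?R 0 x)"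
        using b[of "?R 0 x"] RU[of 0 x] x by auto
      also have "\<dots> = (1 + M) * norm (?R 0 x)" by (simp add: algebra_simps)
      also have "\<dots> \<le> (1 + M) * (\<bar>M0\<bar> * norm x)" using M0[OF x] M(1) by (intro mult_left_mono) auto
      finally show ?thesis using b[OF x] by (simp add: K0_def algebra_simps)
    qed
    then show ?thesis by (simp add: field_simps add_pos_nonneg)
  qed
  define K where "K = K0 * C"
  have K: "0 \<le> K" using K0 C by (simp add: K_def)
  have Lb: "norm (L z x) \<le> K / (1 + cmod z) * norm x" if "Re z \<le> \<kappa> * cmod z" for z x
  proof -
    have "norm (L z x) \<le> K0 / (1 + cmod z) * norm (?P x)" unfolding L_def using Rb[OF that Pm] .
    also have "\<dots> \<le> K0 / (1 + cmod z) * (C * norm x)"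
      using C K0 by (intro mult_left_mono) (auto intro!: divide_nonneg_nonneg)
    finally show ?thesis by (simp add: K_def)
  qed
  have left: "Re z \<le> \<kappa> * cmod z" if "Re z \<le> 0" for z
    using that \<kappa> by (meson mult_nonneg_nonneg norm_ge_zero order_trans)
  have pv: "pv_integral (\<lambda>t. L (\<i> * of_real t) x) (pi *\<^sub>R ?P x)" for x
  proof -
    have LP: "L z (?P u) = L z u" for z u by (simp add: L_def Ps Pm)
    have PL: "?P (L z u) = L z u" if "Re z \<le> 0" for z u
      using RU[OF left[OF that] Pm] by (intro Ps) (auto simp: L_def)
    have "pv_integral (\<lambda>t. L (\<i> * of_real t) (?P (?P x))) (pi *\<^sub>R ?P x)"
    proof (rule pseudo_resolvent_pv_integral[where K = K and L = L and P = ?P])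
      fix \<nu> \<mu> u assume "Re \<nu> \<le> 0" "Re \<mu> \<le> 0"
      then show "L \<nu> (?P u) - L \<mu> (?P u) = (\<nu> - \<mu>) *\<^sub>C L \<nu> (L \<mu> u)"
        unfolding LP using resolvent_identity[OF l rho rho Pm] PL left by (simp add: L_def)
    next
      fix \<nu> u assume z: "Re \<nu> \<le> 0"
      show "L \<nu> (?P u) = ?P (L \<nu> u)" using PL[OF z] LP by simp
      have "K / (1 + cmod \<nu>) \<le> K" using K by (simp add: field_simps add_pos_nonneg)
      also have "K \<le> K * (1 + cmod \<nu>)" using K by (simp add: algebra_simps)
      finally show "norm (L \<nu> u) \<le> K * (1 + cmod \<nu>) * norm u"
        using Lb[OF left[OF z], of u] by (meson mult_right_mono norm_ge_zero order_trans)
    next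
      fix e :: real assume e: "e > 0"
      \<comment> \<open>For \<open>v\<close> in the domain, \<open>z (S - z)\<^sup>-\<^sup>1 v = (S - z)\<^sup>-\<^sup>1 S v - v\<close>; other vectors are approximated
        by such, uniformly in \<open>z\<close>.\<close>
      have "e / (2 * (K0 + 1)) > 0" using e K0 by simp
      then obtain v where v: "v \<in> ?D" "norm (?P x - v) < e / (2 * (K0 + 1))"
        using dense Pm[of x] unfolding closure_approachable subset_iff dist_norm by (metis norm_minus_commute)
      define r where "r = 2 * K0 * norm (S v) / e + 1"
      have "norm (z *\<^sub>C L z (?P (?P x)) + ?P x) < e" if z: "Re z \<le> 0" "cmod z > r" for z
      proof -
        note zl = left[OF z(1)] and rl = resolvent_linear[OF l rho[OF left[OF z(1)]]]
        have r1: "r \<ge> 1" using K0 e by (simp add: r_def)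
        have vU: "v \<in> U" "S v \<in> U" "?P x - v \<in> U" using v d Pm complex_vector.subspace_diff[OF d(10)] by auto
        have "?R z (S v) = ?R z (S v - z *\<^sub>C v) + ?R z (z *\<^sub>C v)"
          using rl(1)[of "S v - z *\<^sub>C v" "z *\<^sub>C v"] vU complex_vector.subspace_diff[OF d(10)]
            complex_vector.subspace_scale[OF d(10)] by simp
        then have "?R z (S v) = v + z *\<^sub>C ?R z v"
          using resolvent_props(3)[OF rho[OF zl] v(1)] rl(2)[OF vU(1)] by simp
        moreover have "?R z (?P x) = ?R z (?P x - v) + ?R z v" using rl(1)[OF vU(3,1)] by simp
        ultimately have eq: "z *\<^sub>C L z (?P (?P x)) + ?P x = z *\<^sub>C ?R z (?P x - v) + (?P x - v) + ?R z (S v)"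
          by (simp add: LP L_def Ps Pm scaleC.add_right)
        have "norm (z *\<^sub>C L z (?P (?P x)) + ?P x) \<le> norm (z *\<^sub>C ?R z (?P x - v)) + norm (?P x - v) + norm (?R z (S v))"
          unfolding eq by (intro norm_triangle_le[OF add_mono] norm_triangle_ineq order_refl)
        also have "norm (z *\<^sub>C ?R z (?P x - v)) \<le> K0 * norm (?P x - v)"
        proof -
          have "cmod z * norm (?R z (?P x - v)) \<le> cmod z * (K0 / (1 + cmod z) * norm (?P x - v))"
            by (intro mult_left_mono Rb zl vU) auto
          also have "\<dots> = (cmod z / (1 + cmod z)) * (K0 * norm (?P x - v))" by simp
          also have "\<dots> \<le> 1 * (K0 * norm (?P x - v))"
            using K0 by (intro mult_right_mono) (auto simp: field_simps add_pos_nonneg)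
          finally show ?thesis by (simp add: norm_scaleC)
        qed
        also have "K0 * norm (?P x - v) + norm (?P x - v) = (K0 + 1) * norm (?P x - v)" by (simp add: algebra_simps)
        also have "\<dots> < e / 2" using v(2) K0 by (simp add: field_simps)
        also have "norm (?R z (S v)) \<le> e / 2"
        proof -
          have "norm (?R z (S v)) \<le> K0 / (1 + cmod z) * norm (S v)" by (rule Rb[OF zl vU(2)])
          also have "\<dots> = K0 * norm (S v) / (1 + cmod z)" by simp
          also have "\<dots> \<le> e / 2"
          proof -
            have "2 * (K0 * norm (S v)) / e \<le> 1 + cmod z" using z(2) by (simp add: r_def)
            then have "2 * (K0 * norm (S v)) \<le> (1 + cmod z) * e" using e by (simp add: field_simps)
            then show ?thesis using r1 z(2) by (simp add: field_simps)
          qed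
          finally show ?thesis .
        qed
        finally show ?thesis by simp
      qed
      then show "\<exists>r. \<forall>\<nu>. Re \<nu> \<le> 0 \<and> cmod \<nu> > r \<longrightarrow> norm (\<nu> *\<^sub>C L \<nu> (?P (?P x)) + ?P x) < e" by blast
    qed (rule K)
    then show ?thesis unfolding LP .
  qed
  show thesis
  proof (rule that[of K L, OF K])
    fix z x assume z: "Re z \<le> \<kappa> * cmod z"
    show "L z x \<in> D \<inter> U" unfolding L_def using RU[OF z Pm] .
    show "S (L z x) - z *\<^sub>C L z x = ?P x" unfolding L_def using resolvent_props(2)[OF rho[OF z] Pm] .
    show "norm (L z x) \<le> K / (1 + cmod z) * norm x" by (rule Lb[OF z])
  next
    fix z x y assume z: "Re z \<le> \<kappa> * cmod z" and x: "x \<in> D \<inter> U" and y: "y \<in> W"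
    have "S x - z *\<^sub>C x \<in> U" using x d by (intro complex_vector.subspace_diff) auto
    then have "?P (S x - z *\<^sub>C x + y) = S x - z *\<^sub>C x" using Pz[OF y] by (simp add: Pa Ps)
    then show "L z (S x - z *\<^sub>C x + y) = x"
      unfolding L_def using resolvent_props(3)[OF rho[OF z] x] by simp
  qed (rule pv)
qed

text \<open>
  The resolvent of \<open>S\<close> is the sum of the resolvents of its two parts; the part in \<open>W\<close> is treated by
  applying \<open>sectorial_part\<close> to \<open>-S\<close> at \<open>-z\<close>. That the domain of \<open>S\<close> splits along \<open>U\<close> and \<open>W\<close> follows
  from the invertibility of \<open>S\<close> and of both parts.
\<close>

lemma sectorially_dichotomous_resolvent:
  fixes S :: "'v::complex_banach \<Rightarrow> 'v"
  assumes sd: "sectorially_dichotomous D S \<theta>" and \<kappa>: "0 \<le> \<kappa>" "\<kappa> < cos \<theta>"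
  obtains K C Q where "0 \<le> K" "0 \<le> C"
    "\<And>z. \<bar>Re z\<bar> \<le> \<kappa> * cmod z \<Longrightarrow> resolvent_bound D S z (K / (1 + cmod z))"
    "\<And>x. pv_integral (\<lambda>t. resolvent D S (\<i> * of_real t) x) (Q x)"
    "\<And>x. norm (Q x) \<le> C * norm x"
proof -
  obtain U W where dw: "dichotomous_wrt D S U W" and su: "sectorial U (D \<inter> U) S \<theta>"
    and sw: "sectorial W (D \<inter> W) (\<lambda>x. - S x) \<theta>" and \<theta>: "0 \<le> \<theta>"
    using sd by (auto simp: sectorially_dichotomous_def)
  have c: "complementary_closed U W" and l: "lin_operator UNIV D S"
    using dw by (auto simp: dichotomous_wrt_def dense_lin_operator_def)
  obtain h where "h > 0" "vstrip h \<subseteq> resolvent_set UNIV D S" using dw by (auto simp: dichotomous_wrt_def)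
  then have z0: "0 \<in> resolvent_set UNIV D S" by (auto simp: vstrip_def)
  have u0: "0 \<in> resolvent_set U (D \<inter> U) S" and w0: "0 \<in> resolvent_set W (D \<inter> W) S"
    using dw unfolding dichotomous_wrt_def spectrum_def by fastforce+
  have lw: "lin_operator W (D \<inter> W) S"
    unfolding lin_operator_def
    using c l dw by (auto simp: complementary_closed_def lin_operator_def dichotomous_wrt_def
        intro: complex_vector.subspace_inter)
  note c' = complementary_closed_swap[OF c]
  have w0': "0 \<in> resolvent_set W (D \<inter> W) (\<lambda>x. - S x)" using resolvent_uminus(1)[OF lw w0] by simp
  obtain L1 K1 where L1: "0 \<le> K1"
    "\<And>z x. Re z \<le> \<kappa> * cmod z \<Longrightarrow> L1 z x \<in> D \<inter> U"
    "\<And>z x. Re z \<le> \<kappa> * cmod z \<Longrightarrow> S (L1 z x) - z *\<^sub>C L1 z x = proj_along U W x"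
    "\<And>z x y. Re z \<le> \<kappa> * cmod z \<Longrightarrow> x \<in> D \<inter> U \<Longrightarrow> y \<in> W \<Longrightarrow> L1 z (S x - z *\<^sub>C x + y) = x"
    "\<And>z x. Re z \<le> \<kappa> * cmod z \<Longrightarrow> norm (L1 z x) \<le> K1 / (1 + cmod z) * norm x"
    "\<And>x. pv_integral (\<lambda>t. L1 (\<i> * of_real t) x) (pi *\<^sub>R proj_along U W x)"
    by (rule sectorial_part[OF c su \<theta> u0 \<kappa>], rule that)
  obtain L2 K2 where L2: "0 \<le> K2"
    "\<And>z x. Re z \<le> \<kappa> * cmod z \<Longrightarrow> L2 z x \<in> D \<inter> W"
    "\<And>z x. Re z \<le> \<kappa> * cmod z \<Longrightarrow> - S (L2 z x) - z *\<^sub>C L2 z x = proj_along W U x"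
    "\<And>z x y. Re z \<le> \<kappa> * cmod z \<Longrightarrow> x \<in> D \<inter> W \<Longrightarrow> y \<in> U \<Longrightarrow> L2 z (- S x - z *\<^sub>C x + y) = x"
    "\<And>z x. Re z \<le> \<kappa> * cmod z \<Longrightarrow> norm (L2 z x) \<le> K2 / (1 + cmod z) * norm x"
    "\<And>x. pv_integral (\<lambda>t. L2 (\<i> * of_real t) x) (pi *\<^sub>R proj_along W U x)"
    by (rule sectorial_part[OF c' sw \<theta> w0' \<kappa>], rule that)
  note d = lin_operatorD[OF l]
  have sU: "complex_vector.subspace U" and sW: "complex_vector.subspace W"
    using c by (auto simp: complementary_closed_def)
  have SU: "S x \<in> U" if "x \<in> D \<inter> U" for x using dw that by (auto simp: dichotomous_wrt_def)
  have SW: "S x \<in> W" if "x \<in> D \<inter> W" for x using dw that by (auto simp: dichotomous_wrt_def)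
  have Psum: "proj_along U W x + proj_along W U x = x" for x by (simp add: proj_along_swap[OF c])
  define G where "G z x = L1 z x - L2 (- z) x" for z x
  have GD: "G z x \<in> D" and GS: "S (G z x) - z *\<^sub>C G z x = x" if z: "\<bar>Re z\<bar> \<le> \<kappa> * cmod z" for z x
  proof -
    have z1: "Re z \<le> \<kappa> * cmod z" "Re (- z) \<le> \<kappa> * cmod (- z)" using z by auto
    have m: "L1 z x \<in> D" "L2 (- z) x \<in> D" using L1(2)[OF z1(1)] L2(2)[OF z1(2)] by auto
    then show "G z x \<in> D" unfolding G_def by (rule d(4))
    have "S (G z x) - z *\<^sub>C G z x = (S (L1 z x) - z *\<^sub>C L1 z x) + (- S (L2 (-z) x) - (- z) *\<^sub>C L2 (-z) x)"
      using m by (simp add: G_def d(7) scaleC.diff_right scaleC.minus_left)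
    then show "S (G z x) - z *\<^sub>C G z x = x" using L1(3)[OF z1(1)] L2(3)[OF z1(2)] Psum by simp
  qed
  have GL: "G z (S x - z *\<^sub>C x) = x" if z: "\<bar>Re z\<bar> \<le> \<kappa> * cmod z" and x: "x \<in> D" for z x
  proof -
    have z1: "Re z \<le> \<kappa> * cmod z" "Re (- z) \<le> \<kappa> * cmod (- z)" using z by auto
    \<comment> \<open>The components of \<open>x\<close> are found in the domain by inverting the two parts of \<open>S\<close> on the
      components of \<open>S x\<close>.\<close>
    define a b where "a = L1 0 (S x)" and "b = - L2 0 (S x)"
    have ab: "a \<in> D \<inter> U" "b \<in> D \<inter> W"
    proof -
      show "a \<in> D \<inter> U" unfolding a_def by (rule L1(2)) simp
      have "L2 0 (S x) \<in> D \<inter> W" by (rule L2(2)) simp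
      then show "b \<in> D \<inter> W"
        unfolding b_def using d(4)[OF d(6), of "L2 0 (S x)"] complex_vector.subspace_neg[OF sW] by simp
    qed
    have "a + b = G 0 (S x)" by (simp add: a_def b_def G_def)
    then have "S (a + b) = S x" "a + b \<in> D" using GS[of 0 "S x"] GD[of 0 "S x"] by auto
    then have xab: "x = a + b" using resolvent_props(3)[OF z0] x by (metis complex_vector.scale_zero_left diff_zero)
    have Sx: "S x - z *\<^sub>C x = (S a - z *\<^sub>C a) + (S b - z *\<^sub>C b)"
      using ab d(1)[of a b] by (simp add: xab scaleC.add_right)
    have "S a - z *\<^sub>C a \<in> U" "S b - z *\<^sub>C b \<in> W"
      using ab SU SW sU sW by (auto intro!: complex_vector.subspace_diff complex_vector.subspace_scale)
    then have "L1 z (S x - z *\<^sub>C x) = a"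
      using L1(4)[OF z1(1) ab(1)] by (simp add: Sx)
    moreover have b': "- b \<in> D \<inter> W" using ab(2) d(4)[OF d(6), of b] complex_vector.subspace_neg[OF sW] by simp
    have "S (- b) = - S b" using d(7)[OF d(6), of b] d(7)[OF d(6) d(6)] ab by simp
    then have "L2 (- z) ((S b - z *\<^sub>C b) + (S a - z *\<^sub>C a)) = - b"
      using L2(4)[OF z1(2) b' \<open>S a - z *\<^sub>C a \<in> U\<close>] by (simp add: scaleC.minus_left scaleC.minus_right)
    then have "L2 (- z) (S x - z *\<^sub>C x) = - b" by (simp add: Sx add.commute)
    ultimately show ?thesis by (simp add: G_def xab)
  qed
  have Gb: "norm (G z x) \<le> (K1 + K2) / (1 + cmod z) * norm x" if z: "\<bar>Re z\<bar> \<le> \<kappa> * cmod z" for z x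
  proof -
    have z1: "Re z \<le> \<kappa> * cmod z" "Re (- z) \<le> \<kappa> * cmod (- z)" using z by auto
    have "norm (G z x) \<le> norm (L1 z x) + norm (L2 (- z) x)" unfolding G_def by (rule norm_triangle_ineq4)
    also have "\<dots> \<le> K1 / (1 + cmod z) * norm x + K2 / (1 + cmod (- z)) * norm x"
      by (intro add_mono L1(5)[OF z1(1)] L2(5)[OF z1(2)])
    finally show ?thesis by (simp add: add_divide_distrib ring_distribs)
  qed
  have rb: "resolvent_bound D S z ((K1 + K2) / (1 + cmod z))" and rG: "resolvent D S z x = G z x"
    if z: "\<bar>Re z\<bar> \<le> \<kappa> * cmod z" for z x
    using resolvent_setI[of UNIV "G z" D S z "(K1 + K2) / (1 + cmod z)"] GD[OF z] GS[OF z] GL[OF z] Gb[OF z]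
    unfolding resolvent_bound_def by auto
  obtain C1 where C1: "0 \<le> C1" "\<And>x. norm (proj_along U W x) \<le> C1 * norm x" using proj_along_bounded[OF c] by blast
  obtain C2 where C2: "0 \<le> C2" "\<And>x. norm (proj_along W U x) \<le> C2 * norm x" using proj_along_bounded[OF c'] by blast
  define Q where "Q x = pi *\<^sub>R proj_along U W x - pi *\<^sub>R proj_along W U x" for x
  show thesis
  proof (rule that[of "K1 + K2" "pi * (C1 + C2)" Q])
    show "0 \<le> K1 + K2" "0 \<le> pi * (C1 + C2)" using L1(1) L2(1) C1 C2 by auto
    show "resolvent_bound D S z ((K1 + K2) / (1 + cmod z))" if "\<bar>Re z\<bar> \<le> \<kappa> * cmod z" for z by (rule rb[OF that])
    show "norm (Q x) \<le> pi * (C1 + C2) * norm x" for x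
    proof -
      have "norm (Q x) \<le> pi * norm (proj_along U W x) + pi * norm (proj_along W U x)"
        unfolding Q_def using norm_triangle_ineq4[of "pi *\<^sub>R proj_along U W x" "pi *\<^sub>R proj_along W U x"] by simp
      also have "\<dots> \<le> pi * (C1 * norm x) + pi * (C2 * norm x)" by (intro add_mono mult_left_mono C1 C2) auto
      finally show ?thesis by (simp add: algebra_simps)
    qed
    show "pv_integral (\<lambda>t. resolvent D S (\<i> * of_real t) x) (Q x)" for x
    proof -
      have "pv_integral (\<lambda>t. L2 (\<i> * of_real (- t)) x) (pi *\<^sub>R proj_along W U x)"
        by (rule pv_integral_reflect[OF L2(6)])
      from pv_integral_diff[OF L1(6)[of x] this]
      show ?thesis using rG[of "\<i> * of_real _" x] \<kappa> by (simp add: Q_def G_def)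
    qed
  qed
qed

section \<open>Subordinate perturbations\<close>

lemma rpow_mono: "0 \<le> a \<Longrightarrow> a \<le> b \<Longrightarrow> 0 \<le> p \<Longrightarrow> rpow a p \<le> rpow b p"
  by (auto simp: rpow_def powr_mono2)

lemma rpow_nonneg: "0 \<le> rpow a p" by (simp add: rpow_def)

lemma rpow_mult: "0 \<le> a \<Longrightarrow> 0 \<le> b \<Longrightarrow> rpow (a * b) p = rpow a p * rpow b p"
  by (auto simp: rpow_def powr_mult)

lemma rpow_interpolate: "0 \<le> a \<Longrightarrow> rpow a (1 - p) * rpow a p = a"
  by (cases "a = 0") (auto simp: rpow_def simp flip: powr_add)

text \<open>
  With \<open>g = (S - z)\<^sup>-\<^sup>1 x\<close> we have \<open>\<parallel>g\<parallel> = O(\<parallel>x\<parallel> / (1 + |z|))\<close> and \<open>\<parallel>S g\<parallel> = \<parallel>x + z g\<parallel> = O(\<parallel>x\<parallel>)\<close>;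
  subordination interpolates between the two.
\<close>

lemma subordinate_resolvent_decay:
  assumes sub: "subordinate p DR R D S" and p: "p < 1" and K: "0 \<le> K"
  obtains C where "0 \<le> C" "\<And>z x. resolvent_bound D S z (K / (1 + cmod z)) \<Longrightarrow>
     norm (R (resolvent D S z x)) \<le> C * (1 + cmod z) powr (p - 1) * norm x"
proof -
  have p0: "0 \<le> p" using sub by (simp add: subordinate_def)
  obtain c where c: "0 \<le> c" "\<And>x. x \<in> D \<Longrightarrow> norm (R x) \<le> c * rpow (norm x) (1 - p) * rpow (norm (S x)) p"
    using sub by (auto simp: subordinate_def)
  let ?C = "c * rpow K (1 - p) * rpow (1 + K) p"
  show thesis
  proof (rule that[of ?C])
    show "0 \<le> ?C" using c K by (simp add: rpow_nonneg)
    fix z x assume rb: "resolvent_bound D S z (K / (1 + cmod z))"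
    let ?g = "resolvent D S z x"
    note r = resolvent_boundD[OF rb]
    have pos: "0 < 1 + cmod z" by (simp add: add_pos_nonneg)
    have 1: "norm ?g \<le> K * (inverse (1 + cmod z) * norm x)" using r(2)[of x] by (simp add: divide_inverse mult_ac)
    have "S ?g = x + z *\<^sub>C ?g" using r(4)[of x] by (simp add: algebra_simps)
    then have "norm (S ?g) \<le> norm x + cmod z * norm ?g" by (metis norm_scaleC norm_triangle_ineq)
    also have "cmod z * norm ?g \<le> K * norm x"
    proof -
      have "cmod z * norm ?g \<le> cmod z * (K / (1 + cmod z) * norm x)" by (intro mult_left_mono r(2)) auto
      also have "\<dots> = (cmod z / (1 + cmod z)) * (K * norm x)" by simp
      also have "\<dots> \<le> 1 * (K * norm x)" using K pos by (intro mult_right_mono) (auto simp: field_simps)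
      finally show ?thesis by simp
    qed
    finally have 2: "norm (S ?g) \<le> (1 + K) * norm x" by (simp add: algebra_simps)
    have "norm (R ?g) \<le> c * rpow (norm ?g) (1 - p) * rpow (norm (S ?g)) p" by (rule c(2)[OF r(3)])
    also have "\<dots> \<le> c * rpow (K * (inverse (1 + cmod z) * norm x)) (1 - p) * rpow ((1 + K) * norm x) p"
      using c(1) p p0 K 1 2 by (intro mult_mono rpow_mono) (auto simp: rpow_nonneg)
    also have "\<dots> = c * (rpow K (1 - p) * (rpow (inverse (1 + cmod z)) (1 - p) * rpow (norm x) (1 - p))) * (rpow (1 + K) p * rpow (norm x) p)"
      using K pos by (simp add: rpow_mult)
    also have "\<dots> = ?C * rpow (inverse (1 + cmod z)) (1 - p) * (rpow (norm x) (1 - p) * rpow (norm x) p)"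
      by (simp add: mult_ac)
    also have "rpow (norm x) (1 - p) * rpow (norm x) p = norm x" by (simp add: rpow_interpolate)
    also have "rpow (inverse (1 + cmod z)) (1 - p) = (1 + cmod z) powr (p - 1)"
      using p pos powr_minus[of "1 + cmod z" "1 - p"] by (simp add: rpow_def inverse_powr del: inverse_eq_divide)
    finally show "norm (R ?g) \<le> ?C * (1 + cmod z) powr (p - 1) * norm x" .
  qed
qed

lemma subordinate_perturbation_resolvent_bound:
  fixes S R :: "'v::complex_banach \<Rightarrow> 'v"
  assumes l: "lin_operator UNIV D S" and lR: "lin_operator UNIV DR R"
    and sub: "subordinate p DR R D S" and p: "p < 1"
    and rb: "\<And>z. z \<in> Z \<Longrightarrow> resolvent_bound D S z (K / (1 + cmod z))" and K: "0 \<le> K"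
  obtains r where "0 < r" "\<And>z. z \<in> Z \<Longrightarrow> r < cmod z \<Longrightarrow> resolvent_bound D (\<lambda>x. S x + R x) z (2 * K / (1 + cmod z))"
proof -
  obtain C where C: "0 \<le> C" "\<And>z x. resolvent_bound D S z (K / (1 + cmod z)) \<Longrightarrow>
     norm (R (resolvent D S z x)) \<le> C * (1 + cmod z) powr (p - 1) * norm x"
    using subordinate_resolvent_decay[OF sub p K] by blast
  \<comment> \<open>This radius makes the decaying factor \<open>C (1 + |z|)\<^sup>p\<^sup>-\<^sup>1\<close> at most \<open>C / (2 C + 1) < 1 / 2\<close>.\<close>
  define r where "r = (2 * C + 1) powr (1 / (1 - p))"
  have r: "r > 0" using C by (simp add: r_def)
  have sD: "D \<subseteq> DR" using sub by (simp add: subordinate_def)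
  have "resolvent_bound D (\<lambda>x. S x + R x) z (2 * K / (1 + cmod z))" if z: "z \<in> Z" "r < cmod z" for z
  proof -
    have pos: "0 < 1 + cmod z" by (simp add: add_pos_nonneg)
    have "2 * C + 1 = r powr (1 - p)" using p C by (simp add: r_def powr_powr)
    also have "\<dots> \<le> (1 + cmod z) powr (1 - p)" using z r p by (intro powr_mono2) auto
    finally have big: "2 * C + 1 \<le> (1 + cmod z) powr (1 - p)" .
    have "(1 + cmod z) powr (p - 1) = inverse ((1 + cmod z) powr (1 - p))"
      by (metis powr_minus minus_diff_eq)
    also have "\<dots> \<le> inverse (2 * C + 1)" using big C by (intro le_imp_inverse_le) auto
    finally have "C * (1 + cmod z) powr (p - 1) \<le> C * inverse (2 * C + 1)" using C by (intro mult_left_mono)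
    also have "\<dots> \<le> 1 / 2" using C by (simp add: field_simps)
    finally have half: "C * (1 + cmod z) powr (p - 1) \<le> 1 / 2" .
    have "resolvent_bound D (\<lambda>x. S x + R x) z (K / (1 + cmod z) / (1 - 1/2))"
    proof (rule resolvent_perturbation[OF l rb[OF z(1)], where B = R])
      show "norm (R (resolvent D S z x)) \<le> 1 / 2 * norm x" for x
        using C(2)[OF rb[OF z(1)], of x] mult_right_mono[OF half norm_ge_zero[of x]] by linarith
      show "R (x + y) = R x + R y" if "x \<in> D" "y \<in> D" for x y
        using lin_operatorD(1)[OF lR] that sD by blast
    qed (use K pos in \<open>auto simp: algebra_simps\<close>)
    then show ?thesis by (simp add: mult.commute)
  qed
  with r show thesis using that by blast
qed

text \<open>
  The points of the axis in the resolvent set form a closed set: if \<open>it\<close> is of regular type with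
  constant \<open>c\<close>, then the resolvents at points close to \<open>it\<close> are bounded by a fixed multiple of \<open>1 / c\<close>,
  so that the Neumann argument reaches \<open>it\<close> itself. Being also open and nonempty, the set is the whole
  axis.
\<close>

lemma imaginary_axis_subset_resolvent_set:
  assumes l: "lin_operator UNIV D T" and reg: "{z. Re z = 0} \<subseteq> regular_type D T"
    and s0: "\<i> * of_real s0 \<in> resolvent_set UNIV D T"
  shows "{z. Re z = 0} \<subseteq> resolvent_set UNIV D T"
proof -
  define A where "A = {t::real. \<i> * of_real t \<in> resolvent_set UNIV D T}"
  have near: "t \<in> A" if "resolvent_bound D T (\<i> * of_real s) M" "0 \<le> M" "\<bar>t - s\<bar> * M \<le> 1 / 2" for s t M
  proof -
    have "cmod (\<i> * of_real t - \<i> * of_real s) = \<bar>t - s\<bar>"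
      by (simp add: norm_mult flip: right_diff_distrib of_real_diff)
    with resolvent_bound_nearby[OF l that(1,2), of "\<i> * of_real t"] that(3)
    show ?thesis by (auto simp: A_def resolvent_bound_def)
  qed
  have "open A"
    unfolding open_dist
  proof
    fix s assume "s \<in> A"
    then have s: "\<i> * of_real s \<in> resolvent_set UNIV D T" by (simp add: A_def)
    then obtain M where "bounded_by UNIV (resolvent D T (\<i> * of_real s)) M" by (auto simp: resolvent_set_def)
    with s have "resolvent_bound D T (\<i> * of_real s) M" by (simp add: resolvent_bound_def)
    then have M: "resolvent_bound D T (\<i> * of_real s) (\<bar>M\<bar> + 1)" by (rule resolvent_bound_mono) simp
    have "t \<in> A" if "dist t s < 1 / (2 * (\<bar>M\<bar> + 1))" for t
    proof (rule near[OF M])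
      have "dist t s * (2 * (\<bar>M\<bar> + 1)) < 1" using that by (simp add: field_simps)
      then show "\<bar>t - s\<bar> * (\<bar>M\<bar> + 1) \<le> 1 / 2" by (simp add: dist_real_def algebra_simps)
    qed simp
    then show "\<exists>e>0. \<forall>t. dist t s < e \<longrightarrow> t \<in> A"
      by (intro exI[of _ "1 / (2 * (\<bar>M\<bar> + 1))"]) auto
  qed
  moreover have "closed A"
    unfolding closed_def open_dist
  proof
    fix t assume "t \<in> - A"
    have "\<i> * of_real t \<in> regular_type D T" using reg by auto
    then obtain c where c: "c > 0" "\<And>x. x \<in> D \<Longrightarrow> norm (T x - (\<i> * of_real t) *\<^sub>C x) \<ge> c * norm x"
      by (auto simp: regular_type_def)
    have "s \<in> - A" if st: "dist s t < c / 3" for s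
    proof
      assume "s \<in> A"
      then have s: "\<i> * of_real s \<in> resolvent_set UNIV D T" by (simp add: A_def)
      have "norm (resolvent D T (\<i> * of_real s) x) \<le> 3 / (2 * c) * norm x" for x
      proof -
        let ?g = "resolvent D T (\<i> * of_real s) x"
        note r = resolvent_props[OF s, simplified]
        have "T ?g - (\<i> * of_real t) *\<^sub>C ?g = x + (\<i> * of_real (s - t)) *\<^sub>C ?g"
          using r(2)[of x] by (simp add: algebra_simps scaleC.diff_left)
        then have "norm (T ?g - (\<i> * of_real t) *\<^sub>C ?g) \<le> norm x + \<bar>s - t\<bar> * norm ?g"
          using norm_triangle_ineq[of x "(\<i> * of_real (s - t)) *\<^sub>C ?g"] by (simp add: norm_scaleC norm_mult del: of_real_diff)
        also have "\<dots> \<le> norm x + c / 3 * norm ?g" using st by (intro add_left_mono mult_right_mono) (auto simp: dist_real_def)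
        finally have "c * norm ?g \<le> norm x + c / 3 * norm ?g" using c(2)[OF r(1), of x] by linarith
        then show ?thesis using c(1) by (simp add: field_simps)
      qed
      then have "resolvent_bound D T (\<i> * of_real s) (3 / (2 * c))"
        using s by (simp add: resolvent_bound_def bounded_by_def)
      then have "t \<in> A"
      proof (rule near)
        have "\<bar>t - s\<bar> \<le> c / 3" using st by (simp add: dist_real_def abs_minus_commute)
        then have "\<bar>t - s\<bar> * (3 / (2 * c)) \<le> c / 3 * (3 / (2 * c))" using c(1) by (intro mult_right_mono) auto
        then show "\<bar>t - s\<bar> * (3 / (2 * c)) \<le> 1 / 2" using c(1) by simp
      qed (use c in simp)
      with \<open>t \<in> - A\<close> show False by simp
    qed
    then show "\<exists>e>0. \<forall>s. dist s t < e \<longrightarrow> s \<in> - A" using c(1) by (intro exI[of _ "c/3"]) auto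
  qed
  ultimately have "A = {} \<or> A = UNIV" using clopen by blast
  then have A: "A = UNIV" using s0 by (auto simp: A_def)
  show ?thesis
  proof
    fix z assume "z \<in> {z. Re z = 0}"
    then have "z = \<i> * of_real (Im z)" by (simp add: complex_eq_iff)
    moreover have "Im z \<in> A" using A by simp
    ultimately show "z \<in> resolvent_set UNIV D T" by (simp add: A_def)
  qed
qed

text \<open>
  Outside a disc the strip lies in the cone. The bounded part of the axis is compact and covered by the
  open sets on which the resolvent is bounded by \<open>n\<close>, so that a single \<open>n\<close> works in a neighbourhood of
  uniform width.
\<close>

lemma resolvent_bound_strip:
  assumes l: "lin_operator UNIV D T" and ax: "{z. Re z = 0} \<subseteq> resolvent_set UNIV D T"
    and \<kappa>: "0 < \<kappa>" and r: "0 < r" and M: "0 \<le> M"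
    and cone: "\<And>z. \<bar>Re z\<bar> \<le> \<kappa> * cmod z \<Longrightarrow> r < cmod z \<Longrightarrow> resolvent_bound D T z (M / (1 + cmod z))"
  obtains \<delta> K where "0 < \<delta>" "0 \<le> K" "\<And>z. \<bar>Re z\<bar> \<le> \<delta> \<Longrightarrow> resolvent_bound D T z (K / (1 + cmod z))"
proof -
  define B where "B n = interior {z. resolvent_bound D T z (real n)}" for n :: nat
  define I where "I = (\<lambda>t. \<i> * of_real t) ` {-r..r}"
  have mono: "B m \<subseteq> B n" if "m \<le> n" for m n
    unfolding B_def using that by (intro interior_mono) (auto intro: resolvent_bound_mono)
  have cI: "compact I" unfolding I_def by (intro compact_continuous_image continuous_intros) auto
  have cov: "I \<subseteq> (\<Union>n\<in>UNIV. B n)"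
  proof
    fix z assume "z \<in> I"
    then have z: "z \<in> resolvent_set UNIV D T" using ax by (auto simp: I_def)
    then obtain N where "bounded_by UNIV (resolvent D T z) N" by (auto simp: resolvent_set_def)
    then have "resolvent_bound D T z N" using z by (simp add: resolvent_bound_def)
    moreover obtain m :: nat where m: "N \<le> real m" using real_arch_simple by blast
    ultimately have b: "resolvent_bound D T z (real (Suc m))" by (elim resolvent_bound_mono) simp
    have "ball z (1 / (2 * real (Suc m))) \<subseteq> {w. resolvent_bound D T w (real (2 * Suc m))}"
    proof
      fix w assume "w \<in> ball z (1 / (2 * real (Suc m)))"
      then have "cmod (w - z) * real (Suc m) \<le> 1 / 2" by (simp add: dist_norm norm_minus_commute field_simps)
      then show "w \<in> {w. resolvent_bound D T w (real (2 * Suc m))}"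
        using resolvent_bound_nearby[OF l b, of w] by simp
    qed
    then have "z \<in> B (2 * Suc m)"
      unfolding B_def mem_interior by (intro exI[of _ "1 / (2 * real (Suc m))"]) auto
    then show "z \<in> (\<Union>n\<in>UNIV. B n)" by blast
  qed
  obtain F where F: "finite F" "I \<subseteq> (\<Union>n\<in>F. B n)"
    using compactE_image[OF cI _ cov] by (auto simp: B_def)
  define N where "N = Max (insert 0 F)"
  have "I \<subseteq> B N"
  proof
    fix z assume "z \<in> I"
    then obtain n where "n \<in> F" "z \<in> B n" using F by blast
    then show "z \<in> B N" using mono[of n N] F(1) by (auto simp: N_def)
  qed
  then obtain e where e: "e > 0" "(\<Union>z\<in>I. ball z e) \<subseteq> B N"
    using compact_subset_open_imp_ball_epsilon_subset[OF cI, of "B N"] by (auto simp: B_def)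
  define \<delta> where "\<delta> = min (e / 2) (\<kappa> * r)"
  define K where "K = max M (real N * (1 + \<delta> + r))"
  have \<delta>: "\<delta> > 0" using e \<kappa> r by (simp add: \<delta>_def)
  show thesis
  proof (rule that[OF \<delta>, of K])
    show "0 \<le> K" using M by (simp add: K_def)
    fix z assume z: "\<bar>Re z\<bar> \<le> \<delta>"
    have pos: "0 < 1 + cmod z" by (simp add: add_pos_nonneg)
    show "resolvent_bound D T z (K / (1 + cmod z))"
    proof (cases "\<bar>Im z\<bar> \<le> r")
      case True
      have "\<i> * of_real (Im z) \<in> I" unfolding I_def using True by (intro imageI) auto
      moreover have "z - \<i> * of_real (Im z) = of_real (Re z)" by (simp add: complex_eq_iff)
      then have "dist (\<i> * of_real (Im z)) z < e" using z e(1) by (simp add: dist_norm norm_minus_commute \<delta>_def)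
      ultimately have "z \<in> B N" using e(2) mem_ball by blast
      then have "resolvent_bound D T z (real N)" using interior_subset by (fastforce simp: B_def)
      moreover have "real N \<le> K / (1 + cmod z)"
      proof -
        have "cmod z \<le> \<delta> + r" using cmod_le[of z] z True by linarith
        then have "real N * (1 + cmod z) \<le> real N * (1 + \<delta> + r)" by (intro mult_left_mono) auto
        then have "real N * (1 + cmod z) \<le> K" by (simp add: K_def)
        then show ?thesis using pos by (simp add: field_simps)
      qed
      ultimately show ?thesis by (rule resolvent_bound_mono)
    next
      case False
      then have rz: "r < cmod z" using abs_Im_le_cmod[of z] by linarith
      have "\<bar>Re z\<bar> \<le> \<kappa> * r" using z by (simp add: \<delta>_def)
      also have "\<dots> \<le> \<kappa> * cmod z" using rz \<kappa> by simp
      finally have "resolvent_bound D T z (M / (1 + cmod z))" using cone rz by blast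
      then show ?thesis by (rule resolvent_bound_mono) (use pos in \<open>auto simp: K_def intro!: divide_right_mono\<close>)
    qed
  qed
qed

text \<open>
  The difference of the two resolvents is \<open>(T - z)\<^sup>-\<^sup>1 R (S - z)\<^sup>-\<^sup>1\<close>, of order \<open>(1 + |z|)\<^sup>p\<^sup>-\<^sup>2\<close>, and
  therefore absolutely integrable.
\<close>

lemma subordinate_perturbation_pv_integral:
  fixes S R :: "'v::complex_banach \<Rightarrow> 'v"
  assumes l: "lin_operator UNIV D S" and lT: "lin_operator UNIV D (\<lambda>x. S x + R x)"
    and sub: "subordinate p DR R D S" and p: "p < 1" and K: "0 \<le> K" "0 \<le> K'"
    and S: "\<And>t. resolvent_bound D S (\<i> * of_real t) (K / (1 + \<bar>t\<bar>))"
    and T: "\<And>t. resolvent_bound D (\<lambda>x. S x + R x) (\<i> * of_real t) (K' / (1 + \<bar>t\<bar>))"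
    and pv: "\<And>x. pv_integral (\<lambda>t. resolvent D S (\<i> * of_real t) x) (Q x)"
    and Q: "\<And>x. norm (Q x) \<le> c * norm x" and c: "0 \<le> c"
  obtains Q' c' where "0 \<le> c'" "\<And>x. norm (Q' x) \<le> c' * norm x"
    "\<And>x. pv_integral (\<lambda>t. resolvent D (\<lambda>x. S x + R x) (\<i> * of_real t) x) (Q' x)"
proof -
  let ?G = "\<lambda>t. resolvent D S (\<i> * of_real t)" and ?H = "\<lambda>t. resolvent D (\<lambda>x. S x + R x) (\<i> * of_real t)"
  have S': "resolvent_bound D S (\<i> * of_real t) (K / (1 + cmod (\<i> * of_real t)))" for t
    using S[of t] by (simp add: norm_mult)
  obtain C where C: "0 \<le> C" "\<And>z x. resolvent_bound D S z (K / (1 + cmod z)) \<Longrightarrow>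
     norm (R (resolvent D S z x)) \<le> C * (1 + cmod z) powr (p - 1) * norm x"
    using subordinate_resolvent_decay[OF sub p K(1)] by blast
  have le: "k / (1 + \<bar>t\<bar>) \<le> k" if "0 \<le> k" for k t :: real using that by (simp add: field_simps)
  have cG: "continuous_on UNIV (\<lambda>t. ?G t x)" for x
    by (rule resolvent_continuous_on_imaginary_axis[OF l resolvent_bound_mono[OF S le] K(1)]) (rule K)
  have cH: "continuous_on UNIV (\<lambda>t. ?H t x)" for x
    by (rule resolvent_continuous_on_imaginary_axis[OF lT resolvent_bound_mono[OF T le] K(2)]) (rule K)
  define c1 where "c1 = K' * C * (2 / (1 - p))"
  have "\<exists>I. pv_integral (\<lambda>t. ?G t x - ?H t x) I \<and> norm I \<le> c1 * norm x" for x
  proof -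
    have b: "norm (?G t x - ?H t x) \<le> (K' * C * norm x) * (1 + \<bar>t\<bar>) powr (- (2 - p))" for t
    proof -
      note rS = resolvent_boundD[OF S[of t]] and rT = resolvent_boundD[OF T[of t]]
      have "?H t (S (?G t x) + R (?G t x) - (\<i> * of_real t) *\<^sub>C ?G t x) = ?G t x" using rT(5)[OF rS(3)] .
      also have "S (?G t x) + R (?G t x) - (\<i> * of_real t) *\<^sub>C ?G t x = x + R (?G t x)"
        using rS(4)[of x] by (simp add: algebra_simps)
      also have "?H t \<dots> = ?H t x + ?H t (R (?G t x))"
        using resolvent_linear(1)[OF lT rT(1)] by simp
      finally have "?G t x - ?H t x = ?H t (R (?G t x))" by (simp add: algebra_simps)
      then have "norm (?G t x - ?H t x) \<le> K' / (1 + \<bar>t\<bar>) * norm (R (?G t x))" using rT(2) by simp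
      also have "\<dots> \<le> K' / (1 + \<bar>t\<bar>) * (C * (1 + \<bar>t\<bar>) powr (p - 1) * norm x)"
        using C(2)[OF S', of t x] K by (intro mult_left_mono) (auto simp: norm_mult)
      also have "\<dots> = (K' * C * norm x) * ((1 + \<bar>t\<bar>) powr (p - 1) / (1 + \<bar>t\<bar>))" by (simp add: mult_ac)
      also have "(1 + \<bar>t\<bar>) powr (p - 1) / (1 + \<bar>t\<bar>) = (1 + \<bar>t\<bar>) powr (p - 1 - 1)"
        by (subst powr_diff) simp
      finally show ?thesis by (simp add: algebra_simps)
    qed
    obtain I where "pv_integral (\<lambda>t. ?G t x - ?H t x) I" "norm I \<le> (K' * C * norm x) * (2 / (2 - p - 1))"
      by (rule pv_integral_power_decay[OF _ _ _ b]) (use p K C in \<open>auto intro!: continuous_intros cG cH\<close>)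
    moreover have "(K' * C * norm x) * (2 / (2 - p - 1)) = c1 * norm x" by (simp add: c1_def algebra_simps)
    ultimately show ?thesis by auto
  qed
  then obtain I where I: "\<And>x. pv_integral (\<lambda>t. ?G t x - ?H t x) (I x)" "\<And>x. norm (I x) \<le> c1 * norm x" by metis
  have c1: "0 \<le> c1" using K C p by (simp add: c1_def)
  show thesis
  proof (rule that[of "c + c1" "\<lambda>x. Q x - I x"])
    show "0 \<le> c + c1" using c c1 by simp
    show "norm (Q x - I x) \<le> (c + c1) * norm x" for x
      using norm_triangle_ineq4[of "Q x" "I x"] Q[of x] I(2)[of x] by (simp add: algebra_simps)
    show "pv_integral (\<lambda>t. ?H t x) (Q x - I x)" for x
      using pv_integral_diff[OF pv[of x] I(1)[of x]] by simp
  qed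
qed

section \<open>Dichotomy from the resolvent on a strip\<close>

text \<open>
  The assumptions are symmetric under \<open>T \<mapsto> -T\<close>, \<open>Q \<mapsto> -Q\<close>. Only the left half-plane is therefore
  studied directly, and the right one is reached through \<open>strip_operator_uminus\<close>.
\<close>

locale strip_operator =
  fixes D :: "'v::complex_banach set" and T :: "'v \<Rightarrow> 'v" and \<delta> K C :: real and Q :: "'v \<Rightarrow> 'v"
  assumes lin: "lin_operator UNIV D T" and \<delta>: "0 < \<delta>" and K: "0 \<le> K"
    and bound: "\<And>z. \<bar>Re z\<bar> \<le> \<delta> \<Longrightarrow> resolvent_bound D T z (K / (1 + cmod z))"
    and pv: "\<And>x. pv_integral (\<lambda>t. resolvent D T (\<i> * of_real t) x) (pi *\<^sub>R Q x)"
    and Q_bound: "\<And>x. norm (Q x) \<le> C * norm x"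
begin

abbreviation G :: "complex \<Rightarrow> 'v \<Rightarrow> 'v" where "G \<equiv> resolvent D T"

text \<open>
  The operators constructed below arise from limits of integrals of resolvents on the axis, so that
  whatever commutes with the latter commutes with all of them. This replaces computations with double
  integrals.
\<close>

definition commutes :: "('v \<Rightarrow> 'v) \<Rightarrow> bool" where
  "commutes A \<longleftrightarrow> bounded_linear A \<and> (\<forall>a x. A (a *\<^sub>C x) = a *\<^sub>C A x) \<and>
     (\<forall>t x. A (G (\<i> * of_real t) x) = G (\<i> * of_real t) (A x))"

definition P :: "'v \<Rightarrow> 'v" where "P x = (1/2) *\<^sub>R (x + Q x)"

lemma strip: "\<bar>Re z\<bar> \<le> \<delta> \<Longrightarrow> z \<in> resolvent_set UNIV D T"
  using resolvent_boundD(1)[OF bound] .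

lemmas G_props = resolvent_boundD(3-5)[OF bound] and G_linear = resolvent_linear[OF lin strip, simplified]

lemma axis [simp]: "\<bar>Re (\<i> * of_real t)\<bar> \<le> \<delta>" "\<bar>Re 0\<bar> \<le> \<delta>" "0 \<le> \<delta>" using \<delta> by auto

lemma TG: "\<bar>Re z\<bar> \<le> \<delta> \<Longrightarrow> T (G z x) = x + z *\<^sub>C G z x"
  using G_props(2)[of z x] by (simp add: algebra_simps)

lemma G0_T: "x \<in> D \<Longrightarrow> G 0 (T x) = x"
  using G_props(3)[of 0 x] by (simp add: axis)

lemma G_bounded_linear: "\<bar>Re z\<bar> \<le> \<delta> \<Longrightarrow> bounded_linear (G z)"
  by (rule resolvent_bounded_linear[OF lin strip])

lemma commutesD:
  assumes "commutes A"
  shows "bounded_linear A" "A (a *\<^sub>C x) = a *\<^sub>C A x" "A (G (\<i> * of_real t) x) = G (\<i> * of_real t) (A x)"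
    "A (G 0 x) = G 0 (A x)" "A (x + y) = A x + A y" "A (x - y) = A x - A y" "A (r *\<^sub>R x) = r *\<^sub>R A x"
proof -
  show *: "bounded_linear A" "A (a *\<^sub>C x) = a *\<^sub>C A x"
    and **: "A (G (\<i> * of_real t) x) = G (\<i> * of_real t) (A x)" for t
    using assms by (auto simp: commutes_def)
  show "A (G 0 x) = G 0 (A x)" using **[of 0] by simp
  interpret bounded_linear A by (rule *(1))
  show "A (x + y) = A x + A y" "A (x - y) = A x - A y" "A (r *\<^sub>R x) = r *\<^sub>R A x"
    by (rule add diff scaleR)+
qed

lemma commutes_T:
  assumes A: "commutes A" and x: "x \<in> D"
  shows "A x \<in> D" "T (A x) = A (T x)"
proof -
  have "A x = G 0 (A (T x))" using commutesD(4)[OF A, of "T x"] G0_T[OF x] by simp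
  then show "A x \<in> D" "T (A x) = A (T x)" using G_props(1)[of 0] TG[of 0] by (simp_all add: axis)
qed

lemma commutes_G_strip: "commutes A \<Longrightarrow> \<bar>Re z\<bar> \<le> \<delta> \<Longrightarrow> A (G z x) = G z (A x)"
proof -
  assume A: "commutes A" and z: "\<bar>Re z\<bar> \<le> \<delta>"
  note D = G_props(1)[OF z]
  have "G z (T (A (G z x)) - z *\<^sub>C A (G z x)) = A (G z x)"
    by (rule G_props(3)[OF z commutes_T(1)[OF A D]])
  also have "T (A (G z x)) - z *\<^sub>C A (G z x) = A (T (G z x) - z *\<^sub>C G z x)"
    by (simp add: commutes_T(2)[OF A D] commutesD[OF A])
  finally show ?thesis using G_props(2)[OF z] by simp
qed

lemma commutes_G: 
  assumes z: "\<bar>Re z\<bar> \<le> \<delta>"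
  shows "commutes (G z)"
  unfolding commutes_def
proof (intro conjI allI)
  show "bounded_linear (G z)" by (rule G_bounded_linear[OF z])
  show "G z (a *\<^sub>C x) = a *\<^sub>C G z x" for a x by (rule G_linear(2)[OF z])
  show "G z (G (\<i> * of_real t) x) = G (\<i> * of_real t) (G z x)" for t x
  proof (cases "z = \<i> * of_real t")
    case False
    define w where "w = \<i> * of_real t"
    have w: "\<bar>Re w\<bar> \<le> \<delta>" unfolding w_def by (rule axis)
    have "(z - w) *\<^sub>C G z (G w x) = G z x - G w x"
      using resolvent_identity[OF lin strip[OF z] strip[OF w], of x] by simp
    moreover have "(w - z) *\<^sub>C G w (G z x) = G w x - G z x"
      using resolvent_identity[OF lin strip[OF w] strip[OF z], of x] by simp
    ultimately have "(z - w) *\<^sub>C G z (G w x) = (z - w) *\<^sub>C G w (G z x)"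
      by (metis minus_diff_eq scaleC.minus_left)
    then show ?thesis using False by (simp add: w_def)
  qed simp
qed

lemma Q_commute: "commutes A \<Longrightarrow> A (Q x) = Q (A x)"
proof -
  assume A: "commutes A"
  have "pv_integral (\<lambda>t. G (\<i> * of_real t) (A x)) (A (pi *\<^sub>R Q x))"
    using pv_integral_linear[OF pv[of x] commutesD(1)[OF A]] by (simp add: commutesD[OF A])
  from pv_integral_unique[OF this pv] show ?thesis by (simp add: commutesD[OF A])
qed

lemma Q_add: "Q (x + y) = Q x + Q y"
  using pv_integral_unique[OF pv[of "x + y"], of "pi *\<^sub>R Q x + pi *\<^sub>R Q y"] pv_integral_add[OF pv[of x] pv[of y]]
  by (simp add: G_linear flip: scaleR_add_right)

lemma Q_scaleC: "Q (a *\<^sub>C x) = a *\<^sub>C Q x"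
  using pv_integral_unique[OF pv[of "a *\<^sub>C x"], of "a *\<^sub>C pi *\<^sub>R Q x"]
    pv_integral_linear[OF pv[of x] scaleC.bounded_linear_right[of a]]
  by (simp add: G_linear scaleC.scaleR_right)

lemma commutes_Q: "commutes Q"
  unfolding commutes_def
proof (intro conjI allI)
  show "bounded_linear Q"
    by (rule bounded_linear_intro[where K = C]) (auto simp: Q_add scaleR_scaleC Q_scaleC Q_bound mult.commute)
  show "Q (a *\<^sub>C x) = a *\<^sub>C Q x" for a x by (rule Q_scaleC)
  show "Q (G (\<i> * of_real t) x) = G (\<i> * of_real t) (Q x)" for t x
    using Q_commute[OF commutes_G[OF axis(1)]] by simp
qed

lemma commutes_P: "commutes P"
  unfolding commutes_def
proof (intro conjI allI)
  note Q = commutesD[OF commutes_Q]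
  show "bounded_linear P"
    unfolding P_def by (intro bounded_linear_scaleR_right[THEN bounded_linear_compose] bounded_linear_add bounded_linear_ident Q(1))
  show "P (a *\<^sub>C x) = a *\<^sub>C P x" for a x by (simp add: P_def Q scaleC.add_right scaleC.scaleR_right)
  show "P (G (\<i> * of_real t) x) = G (\<i> * of_real t) (P x)" for t x
  proof -
    interpret bounded_linear "G (\<i> * of_real t)" by (rule G_bounded_linear[OF axis(1)])
    show ?thesis by (simp add: P_def Q add scaleR)
  qed
qed

lemma P_commute: "commutes A \<Longrightarrow> A (P x) = P (A x)"
  by (simp add: P_def commutesD Q_commute)

text \<open>
  For \<open>Re l \<le> -\<delta>\<close> this is \<open>2\<pi>\<close> times a vector that plays the role of \<open>(T - l)\<^sup>-\<^sup>1 P x\<close> where \<open>T - l\<close> need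
  not be invertible; the formula is the Cauchy integral of the resolvent along the axis.
\<close>

definition half_plane_integral :: "complex \<Rightarrow> 'v \<Rightarrow> 'v" where
  "half_plane_integral l x = (THE J. pv_integral (\<lambda>t. (1 / (\<i> * of_real t - l)) *\<^sub>C G (\<i> * of_real t) x) J)"

text \<open>
  The linear growth in \<open>l\<close> is a crude consequence of \<open>|it - l| \<ge> \<delta>\<close>; it is harmless, since \<open>Q_P_cube\<close>
  compensates for it by powers of \<open>T\<^sup>-\<^sup>1\<close>.
\<close>

lemma half_plane_integral_props:
  assumes l: "Re l \<le> - \<delta>"
  shows "pv_integral (\<lambda>t. (1 / (\<i> * of_real t - l)) *\<^sub>C G (\<i> * of_real t) x) (half_plane_integral l x)"
    and "norm (half_plane_integral l x) \<le> 2 * (1 + 1 / \<delta>) * K * (1 + cmod l) * norm x"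
proof -
  let ?f = "\<lambda>t. (1 / (\<i> * of_real t - l)) *\<^sub>C G (\<i> * of_real t) x"
  define c where "c = (1 + 1 / \<delta>) * (1 + cmod l) * K * norm x"
  have nz: "\<i> * of_real t - l \<noteq> 0" for t using l \<delta> by (auto simp: complex_eq_iff)
  have cG: "continuous_on UNIV (\<lambda>t. G (\<i> * of_real t) x)"
  proof (rule resolvent_continuous_on_imaginary_axis[OF lin _ K])
    show "resolvent_bound D T (\<i> * of_real t) K" for t
      by (rule resolvent_bound_mono[OF bound[OF axis(1)]]) (use K in \<open>simp add: field_simps add_pos_nonneg\<close>)
  qed
  have b: "norm (?f t) \<le> c * (1 + \<bar>t\<bar>) powr (- 2)" for t
  proof -
    let ?d = "cmod (\<i> * of_real t - l)"
    have d: "?d \<ge> \<delta>" using abs_Re_le_cmod[of "\<i> * of_real t - l"] l by simp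
    have "\<bar>t\<bar> = cmod (\<i> * of_real t)" by (simp add: norm_mult)
    also have "\<dots> \<le> ?d + cmod l" using norm_triangle_ineq2[of "\<i> * of_real t" l] by linarith
    finally have "1 + \<bar>t\<bar> \<le> (1 + cmod l) * 1 + ?d" by simp
    also have "\<dots> \<le> (1 + cmod l) * (?d / \<delta>) + (1 + cmod l) * ?d"
    proof (rule add_mono)
      show "(1 + cmod l) * 1 \<le> (1 + cmod l) * (?d / \<delta>)" using d \<delta> by (intro mult_left_mono) auto
      show "?d \<le> (1 + cmod l) * ?d" using mult_right_mono[of 1 "1 + cmod l" ?d] by simp
    qed
    finally have le: "1 + \<bar>t\<bar> \<le> (1 + 1 / \<delta>) * (1 + cmod l) * ?d" by (simp add: algebra_simps add_divide_distrib)
    have aux: "1 / a \<le> b / s" if "0 < a" "0 < s" "s \<le> b * a" for a b s :: real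
      using that by (simp add: field_simps)
    have i: "1 / ?d \<le> (1 + 1 / \<delta>) * (1 + cmod l) / (1 + \<bar>t\<bar>)" by (rule aux[OF _ _ le]) (use d \<delta> in auto)
    have "norm (?f t) = 1 / ?d * norm (G (\<i> * of_real t) x)" by (simp add: norm_scaleC norm_divide)
    also have "\<dots> \<le> (1 + 1 / \<delta>) * (1 + cmod l) / (1 + \<bar>t\<bar>) * (K / (1 + \<bar>t\<bar>) * norm x)"
      using resolvent_boundD(2)[OF bound[OF axis(1)], of t x] \<delta>
      by (intro mult_mono i) (auto simp: norm_mult)
    also have "\<dots> = c * (1 + \<bar>t\<bar>) powr (- 2)"
      by (simp add: c_def powr_minus powr_numeral power2_eq_square divide_inverse mult_ac)
    finally show ?thesis .
  qed
  obtain J where J: "pv_integral ?f J" "norm J \<le> c * (2 / (2 - 1))"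
    by (rule pv_integral_power_decay[OF _ _ _ b])
      (use nz K \<delta> in \<open>auto intro!: continuous_intros cG simp: c_def\<close>)
  have "half_plane_integral l x = J"
    unfolding half_plane_integral_def using J(1) pv_integral_unique by blast
  with J show "pv_integral ?f (half_plane_integral l x)"
    "norm (half_plane_integral l x) \<le> 2 * (1 + 1 / \<delta>) * K * (1 + cmod l) * norm x"
    by (auto simp: c_def algebra_simps add_divide_distrib)
qed

lemma half_plane_integral_commute:
  assumes A: "commutes A" and l: "Re l \<le> - \<delta>"
  shows "A (half_plane_integral l x) = half_plane_integral l (A x)"
proof (rule pv_integral_unique)
  show "pv_integral (\<lambda>t. (1 / (\<i> * of_real t - l)) *\<^sub>C G (\<i> * of_real t) (A x)) (A (half_plane_integral l x))"
    using pv_integral_linear[OF half_plane_integral_props(1)[OF l, of x] commutesD(1)[OF A]]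
    by (simp add: commutesD[OF A])
qed (rule half_plane_integral_props(1)[OF l])

text \<open>
  The equation \<open>(T - l) J = \<pi> x + \<pi> Q x\<close> in the form \<open>J = T\<^sup>-\<^sup>1 (\<pi> x + \<pi> Q x + l J)\<close>, which involves
  bounded operators only and can therefore be verified under the integral: at \<open>z = it\<close> the identity is
  \<open>1 / (z - l) + (T - z)\<^sup>-\<^sup>1 + l (T - z)\<^sup>-\<^sup>1 / (z - l) = T (T - z)\<^sup>-\<^sup>1 / (z - l)\<close>. The principal value of
  the first term is \<open>\<pi>\<close>, that of the second is \<open>\<pi> Q\<close>.
\<close>

lemma half_plane_integral_eq:
  assumes l: "Re l \<le> - \<delta>"
  shows "half_plane_integral l x = G 0 (pi *\<^sub>R x + pi *\<^sub>R Q x + l *\<^sub>C half_plane_integral l x)"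
proof (rule pv_integral_unique[OF half_plane_integral_props(1)[OF l]])
  let ?c = "\<lambda>t. 1 / (\<i> * of_real t - l)" and ?g = "\<lambda>t. G (\<i> * of_real t) x"
  have "pv_integral (\<lambda>t. ?c t *\<^sub>C x) (of_real pi *\<^sub>C x)"
    using l \<delta> by (intro pv_integral_linear[OF pv_integral_inverse] scaleC.bounded_linear_left) simp
  moreover have "pv_integral (\<lambda>t. l *\<^sub>C ?c t *\<^sub>C ?g t) (l *\<^sub>C half_plane_integral l x)"
    by (intro pv_integral_linear[OF half_plane_integral_props(1)[OF l]] scaleC.bounded_linear_right)
  ultimately have "pv_integral (\<lambda>t. G 0 (?c t *\<^sub>C x + ?g t + l *\<^sub>C ?c t *\<^sub>C ?g t))
      (G 0 (of_real pi *\<^sub>C x + pi *\<^sub>R Q x + l *\<^sub>C half_plane_integral l x))"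
    by (intro pv_integral_linear[OF pv_integral_add[OF pv_integral_add[OF _ pv]]] G_bounded_linear axis)
  moreover have "G 0 (?c t *\<^sub>C x + ?g t + l *\<^sub>C ?c t *\<^sub>C ?g t) = ?c t *\<^sub>C ?g t" for t
  proof -
    have nz: "\<i> * of_real t - l \<noteq> 0" using l \<delta> by (auto simp: complex_eq_iff)
    have "1 + l * ?c t = ?c t * (\<i> * of_real t)" using nz by (simp add: field_simps)
    then have "?g t + l *\<^sub>C ?c t *\<^sub>C ?g t = ?c t *\<^sub>C (\<i> * of_real t) *\<^sub>C ?g t"
      by (metis scaleC_add_left scaleC_one scaleC_scaleC)
    then have "?c t *\<^sub>C x + ?g t + l *\<^sub>C ?c t *\<^sub>C ?g t = ?c t *\<^sub>C T (?g t)"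
      by (simp add: TG[OF axis(1)] scaleC.add_right add.assoc)
    then show ?thesis by (simp add: G_linear(2)[OF axis(2)] G0_T[OF G_props(1)[OF axis(1)]])
  qed
  ultimately show "pv_integral (\<lambda>t. ?c t *\<^sub>C ?g t) (G 0 (pi *\<^sub>R x + pi *\<^sub>R Q x + l *\<^sub>C half_plane_integral l x))"
    by (simp add: scaleR_scaleC)
qed

text \<open>
  The proofs below rest on what the two formulas have in common: both yield right inverses of \<open>T - l\<close> up
  to the factor \<open>P\<close>, both are bounded by a multiple of \<open>1 + |l|\<close>, and both commute with whatever commutes
  with the resolvents on the axis.
\<close>

definition L :: "complex \<Rightarrow> 'v \<Rightarrow> 'v" where
  "L l x = (if - \<delta> \<le> Re l then G l (P x) else (1 / (2 * pi)) *\<^sub>R half_plane_integral l x)"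

lemma L_commute:
  assumes A: "commutes A" and l: "Re l \<le> 0"
  shows "A (L l x) = L l (A x)"
  using l P_commute[OF A] commutes_G_strip[OF A, of l]
  by (auto simp: L_def commutesD[OF A] half_plane_integral_commute[OF A])

lemma L_bounded:
  obtains M where "0 \<le> M" "\<And>l x. Re l \<le> 0 \<Longrightarrow> norm (L l x) \<le> M * (1 + cmod l) * norm x"
proof -
  obtain N where N: "0 \<le> N" "\<And>x. norm (P x) \<le> N * norm x"
    using bounded_linear.nonneg_bounded[OF commutesD(1)[OF commutes_P]] by (metis mult.commute)
  define M where "M = K * N + 2 * (1 + 1 / \<delta>) * K"
  have M: "0 \<le> M" "K * N \<le> M" "2 * (1 + 1 / \<delta>) * K \<le> M" using K N \<delta> by (auto simp: M_def)
  have "norm (L l x) \<le> M * (1 + cmod l) * norm x" if l: "Re l \<le> 0" for l x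
  proof (cases "- \<delta> \<le> Re l")
    case True
    then have s: "\<bar>Re l\<bar> \<le> \<delta>" using l by simp
    have "norm (L l x) \<le> K / (1 + cmod l) * norm (P x)"
      using resolvent_boundD(2)[OF bound[OF s]] True by (simp add: L_def)
    also have "\<dots> \<le> K * (N * norm x)" using K N by (intro mult_mono) (auto simp: field_simps add_pos_nonneg)
    also have "\<dots> = K * N * (1 * norm x)" by simp
    also have "\<dots> \<le> M * ((1 + cmod l) * norm x)" by (intro mult_mono mult_right_mono) (use M K N in auto)
    finally show ?thesis by simp
  next
    case False
    then have l': "Re l \<le> - \<delta>" by simp
    have "norm (L l x) = 1 / (2 * pi) * norm (half_plane_integral l x)" using False by (simp add: L_def)
    also have "\<dots> \<le> 1 * norm (half_plane_integral l x)"
      using pi_gt3 by (intro mult_right_mono) auto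
    also have "\<dots> \<le> 2 * (1 + 1 / \<delta>) * K * ((1 + cmod l) * norm x)" using half_plane_integral_props(2)[OF l', of x] by simp
    also have "\<dots> \<le> M * ((1 + cmod l) * norm x)" by (intro mult_right_mono M) auto
    finally show ?thesis by simp
  qed
  with M(1) show thesis using that by blast
qed

lemma L_eq:
  assumes l: "Re l \<le> 0"
  shows "L l x \<in> D" "T (L l x) = P x + l *\<^sub>C L l x"
proof -
  have "L l x \<in> D \<and> T (L l x) = P x + l *\<^sub>C L l x"
  proof (cases "- \<delta> \<le> Re l")
    case True
    then show ?thesis using G_props(1)[of l] TG[of l] l by (simp add: L_def)
  next
    case False
    then have l': "Re l \<le> - \<delta>" by simp
    have "L l x = G 0 ((1 / (2 * pi)) *\<^sub>R (pi *\<^sub>R x + pi *\<^sub>R Q x + l *\<^sub>C half_plane_integral l x))"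
      using False half_plane_integral_eq[OF l', of x] commutesD(7)[OF commutes_G[OF axis(2)]] by (simp add: L_def)
    also have "(1 / (2 * pi)) *\<^sub>R (pi *\<^sub>R x + pi *\<^sub>R Q x + l *\<^sub>C half_plane_integral l x) = P x + l *\<^sub>C L l x"
      using False by (simp add: L_def P_def scaleR_add_right scaleC.scaleR_right)
    finally have "L l x = G 0 (P x + l *\<^sub>C L l x)" .
    then show ?thesis using G_props(1)[OF axis(2)] TG[OF axis(2)] by (metis add.right_neutral complex_vector.scale_zero_left)
  qed
  then show "L l x \<in> D" "T (L l x) = P x + l *\<^sub>C L l x" by auto
qed

lemma commutes_L:
  assumes l: "Re l \<le> 0"
  shows "commutes (L l)"
  unfolding commutes_def
proof (intro conjI allI)
  show "L l (G (\<i> * of_real t) x) = G (\<i> * of_real t) (L l x)" for t x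
    using L_commute[OF commutes_G[OF axis(1)] l] by simp
  obtain M where M: "\<And>x. norm (L l x) \<le> M * (1 + cmod l) * norm x" using L_bounded l by metis
  have add: "L l (x + y) = L l x + L l y" for x y
  proof (cases "- \<delta> \<le> Re l")
    case True
    then show ?thesis using l by (simp add: L_def commutesD[OF commutes_P] G_linear)
  next
    case False
    then have l': "Re l \<le> - \<delta>" by simp
    have "half_plane_integral l (x + y) = half_plane_integral l x + half_plane_integral l y"
      using pv_integral_unique[OF half_plane_integral_props(1)[OF l', of "x + y"]]
        pv_integral_add[OF half_plane_integral_props(1)[OF l', of x] half_plane_integral_props(1)[OF l', of y]]
      by (simp add: G_linear(1)[OF axis(1)] scaleC.add_right)
    then show ?thesis using False by (simp add: L_def scaleR_add_right)
  qed
  show scale: "L l (a *\<^sub>C x) = a *\<^sub>C L l x" for a x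
  proof (cases "- \<delta> \<le> Re l")
    case True
    then show ?thesis using l by (simp add: L_def commutesD[OF commutes_P] G_linear)
  next
    case False
    then have l': "Re l \<le> - \<delta>" by simp
    have "half_plane_integral l (a *\<^sub>C x) = a *\<^sub>C half_plane_integral l x"
      using pv_integral_unique[OF half_plane_integral_props(1)[OF l', of "a *\<^sub>C x"]]
        pv_integral_linear[OF half_plane_integral_props(1)[OF l', of x] scaleC.bounded_linear_right[of a]]
      by (simp add: G_linear(2)[OF axis(1)] scaleC_scaleC mult.commute)
    then show ?thesis using False by (simp add: L_def scaleC.scaleR_right)
  qed
  show "bounded_linear (L l)"
    by (rule bounded_linear_intro[where K = "M * (1 + cmod l)"]) (use M in \<open>auto simp: add scaleR_scaleC scale mult_ac\<close>)
qed

text \<open>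
  Insert \<open>P = (T - m) L(m)\<close> behind \<open>L(l)\<close> and \<open>P = (T - l) L(l)\<close> behind \<open>L(m)\<close>, and let everything commute.
\<close>

lemma L_pseudo_resolvent:
  assumes l: "Re l \<le> 0" and m: "Re m \<le> 0"
  shows "L l (P x) - L m (P x) = (l - m) *\<^sub>C L l (L m x)"
proof -
  have *: "L a (P x) = T (L a (L b x)) - b *\<^sub>C L a (L b x)" if a: "Re a \<le> 0" and b: "Re b \<le> 0" for a b
  proof -
    note A = commutesD[OF commutes_L[OF a]] and t = commutes_T[OF commutes_L[OF a] L_eq(1)[OF b]]
    have "T (L a (L b x)) = L a (P x) + b *\<^sub>C L a (L b x)" using t L_eq(2)[OF b] by (simp add: A)
    then show ?thesis by simp
  qed
  have "L m (L l x) = L l (L m x)" by (rule L_commute[OF commutes_L[OF m] l])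
  then show ?thesis using *[OF l m] *[OF m l] by (simp add: scaleC.diff_left)
qed

text \<open>
  On vectors \<open>P\<^sup>3 w\<close> the principal value is that of \<open>L(it) P\<^sup>2 w\<close>, which can be computed by closing the
  contour on the left, as soon as \<open>l L(l) P\<^sup>2 w\<close> converges for \<open>|l| \<rightarrow> \<infinity>\<close>. This is arranged by taking \<open>w\<close> in
  the range of \<open>T\<^sup>-\<^sup>3\<close>: each of the first two factors \<open>T\<^sup>-\<^sup>1\<close> improves the growth \<open>O(|l|)\<close> of \<open>L(l)\<close> by one
  order, and the third gives the limit. Finally \<open>T\<^sup>-\<^sup>3\<close> commutes with \<open>Q\<close> and is injective.
\<close>

lemma Q_P_cube: "Q (P (P (P x))) = P (P (P x))"
proof -
  let ?g = "\<lambda>x. G 0 (G 0 (G 0 x))"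
  define v where "v = P (P x)"
  define w where "w = ?g x"
  obtain M where M: "0 \<le> M" "\<And>l x. Re l \<le> 0 \<Longrightarrow> norm (L l x) \<le> M * (1 + cmod l) * norm x"
    using L_bounded by blast
  note G0 = commutesD[OF commutes_G[OF axis(2)]] and PG = P_commute[OF commutes_G[OF axis(2)]]
  have "pv_integral (\<lambda>t. L (\<i> * of_real t) (P (P w))) (pi *\<^sub>R ?g (P v))"
  proof (rule pseudo_resolvent_pv_integral[where L = L and P = P, OF L_pseudo_resolvent _ M(2,1)])
    show "L l (P x) = P (L l x)" if "Re l \<le> 0" for l x by (rule L_commute[OF commutes_P that, symmetric])
    fix e :: real assume e: "e > 0"
    define c where "c = 2 * M * norm v + norm (G 0 (P v)) + norm (G 0 (G 0 (P v)))"
    have c: "c \<ge> 0" using M(1) by (simp add: c_def)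
    have "norm (l *\<^sub>C L l (P (P w)) + ?g (P v)) < e" if l: "Re l \<le> 0" "cmod l > 1 + c / e" for l
    proof -
      have "c / e \<ge> 0" using c e by simp
      then have l1: "cmod l \<ge> 1" "cmod l > c / e" using l(2) by linarith+
      have l0: "l \<noteq> 0" using l1(1) by auto
      have il: "inverse (cmod l) \<le> 1" using l1(1) by (simp add: inverse_le_1_iff del: inverse_eq_divide)
      \<comment> \<open>Each factor \<open>T\<^sup>-\<^sup>1\<close> in front of \<open>L(l)\<close> gains a factor \<open>1 / l\<close>, up to a term free of \<open>L(l)\<close>.\<close>
      have rec: "G 0 (L l v) = inverse l *\<^sub>C (L l v - G 0 (P v))"
      proof -
        have "L l v = G 0 (P v + l *\<^sub>C L l v)" using G0_T[OF L_eq(1)[OF l(1), of v]] L_eq(2)[OF l(1), of v] by simp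
        then have "L l v - G 0 (P v) = l *\<^sub>C G 0 (L l v)" using G0(5,2) by (metis add_diff_cancel_left')
        then show ?thesis using l0 by (simp add: scaleC_scaleC scaleC_one)
      qed
      have PPw: "L l (P (P w)) = ?g (L l v)"
        using L_commute[OF commutes_G[OF axis(2)] l(1)] PG by (simp add: w_def v_def)
      have "l *\<^sub>C ?g (L l v) + ?g (P v) = G 0 (G 0 (l *\<^sub>C G 0 (L l v) + G 0 (P v)))" by (simp only: G0(2,5))
      also have "l *\<^sub>C G 0 (L l v) + G 0 (P v) = L l v"
        unfolding rec using l0 by (simp add: scaleC_scaleC scaleC_one)
      also have "G 0 (G 0 (L l v)) = inverse l *\<^sub>C (inverse l *\<^sub>C (L l v - G 0 (P v)) - G 0 (G 0 (P v)))"
        by (simp add: rec G0(2,6))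
      finally have "norm (l *\<^sub>C L l (P (P w)) + ?g (P v))
          = inverse (cmod l) * norm (inverse l *\<^sub>C (L l v - G 0 (P v)) - G 0 (G 0 (P v)))"
        by (simp add: PPw norm_scaleC norm_inverse)
      also have "\<dots> \<le> inverse (cmod l) * c"
      proof (rule mult_left_mono)
        have "norm (inverse l *\<^sub>C (L l v - G 0 (P v))) = inverse (cmod l) * norm (L l v - G 0 (P v))"
          by (simp add: norm_scaleC norm_inverse)
        also have "\<dots> \<le> inverse (cmod l) * (M * (1 + cmod l) * norm v + norm (G 0 (P v)))"
          using norm_triangle_ineq4[of "L l v" "G 0 (P v)"] M(2)[OF l(1), of v] by (intro mult_left_mono) auto
        also have "\<dots> = M * (inverse (cmod l) + 1) * norm v + inverse (cmod l) * norm (G 0 (P v))"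
          using l0 by (simp add: divide_inverse[symmetric] add_divide_distrib distrib_left distrib_right) (simp add: field_simps)
        also have "\<dots> \<le> M * 2 * norm v + 1 * norm (G 0 (P v))"
          using il M(1) by (intro add_mono mult_mono) auto
        finally show "norm (inverse l *\<^sub>C (L l v - G 0 (P v)) - G 0 (G 0 (P v))) \<le> c"
          using norm_triangle_ineq4[of "inverse l *\<^sub>C (L l v - G 0 (P v))" "G 0 (G 0 (P v))"] by (simp add: c_def)
      qed simp
      also have "inverse (cmod l) * c < e" using l1(2) e l0 by (simp add: field_simps)
      finally show ?thesis .
    qed
    then show "\<exists>r. \<forall>l. Re l \<le> 0 \<and> cmod l > r \<longrightarrow> norm (l *\<^sub>C L l (P (P w)) + ?g (P v)) < e" by blast
  qed auto
  moreover have "L (\<i> * of_real t) (P (P w)) = G (\<i> * of_real t) (P (P (P w)))" for t using \<delta> by (simp add: L_def)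
  moreover have "P (P (P w)) = ?g (P v)" using PG by (simp add: w_def v_def)
  ultimately have "pv_integral (\<lambda>t. G (\<i> * of_real t) (?g (P v))) (pi *\<^sub>R ?g (P v))" by simp
  from pv_integral_unique[OF pv this] have "Q (?g (P v)) = ?g (P v)" by simp
  moreover have "Q (?g (P v)) = ?g (Q (P v))" using Q_commute[OF commutes_G[OF axis(2)]] by simp
  ultimately have *: "?g (Q (P v)) = ?g (P v)" by simp
  have TG0: "T (G 0 x) = x" for x using TG[OF axis(2), of x] by simp
  have inj: "x = y" if "G 0 x = G 0 y" for x y by (metis that TG0)
  from inj[OF inj[OF inj[OF *]]] have "Q (P v) = P v" .
  then show ?thesis by (simp add: v_def)
qed

text \<open>
  On the eigenspace \<open>P\<close> is the identity, so \<open>L(l)\<close> is an inverse of \<open>T - l\<close> there.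
\<close>

lemma left_half_plane_resolvent:
  assumes l: "Re l \<le> 0"
  shows "l \<in> resolvent_set {x. Q x = x} (D \<inter> {x. Q x = x}) T"
proof -
  obtain M where M: "\<And>x. norm (L l x) \<le> M * (1 + cmod l) * norm x" using L_bounded l by metis
  note Q = commutesD[OF commutes_Q] and A = commutesD[OF commutes_L[OF l]]
  have P: "P x = x" if "Q x = x" for x using that by (simp add: P_def flip: scaleR_2)
  have QL: "Q (L l x) = L l (Q x)" for x by (rule L_commute[OF commutes_Q l])
  show ?thesis
  proof (rule resolvent_setI(1)[where G = "L l" and M = "M * (1 + cmod l)"])
    fix x assume x: "x \<in> {x. Q x = x}"
    show "L l x \<in> D \<inter> {x. Q x = x}" using L_eq(1)[OF l] x by (simp add: QL)
    show "T (L l x) - l *\<^sub>C L l x = x" using L_eq(2)[OF l] x P by simp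
    show "norm (L l x) \<le> M * (1 + cmod l) * norm x" by (rule M)
  next
    fix x assume x: "x \<in> D \<inter> {x. Q x = x}"
    then have D: "x \<in> D" by simp
    show "T x - l *\<^sub>C x \<in> {x. Q x = x}"
      using x by (simp add: Q flip: commutes_T(2)[OF commutes_Q D])
    have "L l (T x - l *\<^sub>C x) = T (L l x) - l *\<^sub>C L l x"
      by (simp add: A commutes_T(2)[OF commutes_L[OF l] D])
    then show "L l (T x - l *\<^sub>C x) = x" using L_eq(2)[OF l, of x] P x by simp
  qed
qed

lemma strip_operator_uminus: "strip_operator D (\<lambda>x. - T x) \<delta> K C (\<lambda>x. - Q x)"
proof
  have "(- 1) *\<^sub>C x = - x" for x :: 'v by (simp add: scaleC.minus_left scaleC_one)
  with lin show "lin_operator UNIV D (\<lambda>x. - T x)" by (auto simp: lin_operator_def scaleC.minus_right)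
  have m: "- z \<in> resolvent_set UNIV D (\<lambda>x. - T x)" "resolvent D (\<lambda>x. - T x) (- z) x = - G z x"
    if "\<bar>Re z\<bar> \<le> \<delta>" for z x
    using resolvent_uminus[OF lin strip[OF that]] by auto
  show "resolvent_bound D (\<lambda>x. - T x) z (K / (1 + cmod z))" if "\<bar>Re z\<bar> \<le> \<delta>" for z
  proof -
    have z: "\<bar>Re (- z)\<bar> \<le> \<delta>" using that by simp
    show ?thesis
      using m[OF z] resolvent_boundD(2)[OF bound[OF z]] by (simp add: resolvent_bound_def bounded_by_def)
  qed
  show "pv_integral (\<lambda>t. resolvent D (\<lambda>x. - T x) (\<i> * of_real t) x) (pi *\<^sub>R - Q x)" for x
  proof -
    have "resolvent D (\<lambda>x. - T x) (\<i> * of_real t) x = - G (\<i> * of_real (- t)) x" for t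
      using m(2)[of "\<i> * of_real (- t)"] \<delta> by simp
    then show ?thesis using pv_integral_minus[OF pv_integral_reflect[OF pv[of x]]] by simp
  qed
  show "norm (- Q x) \<le> C * norm x" for x using Q_bound by simp
qed (use \<delta> K in auto)

text \<open>
  With \<open>N = 1 - P\<close>, \<open>Q_P_cube\<close> for \<open>T\<close> and for \<open>-T\<close> reads \<open>N P\<^sup>3 = 0\<close> and \<open>P N\<^sup>3 = 0\<close>. Multiplying \<open>N P\<close> by
  powers of \<open>P + N = 1\<close> shows \<open>N P = 0\<close>, which is equivalent to \<open>Q\<^sup>2 = 1\<close>.
\<close>

lemma Q_involution: "Q (Q x) = x"
proof -
  define N where "N x = (1/2) *\<^sub>R (x - Q x)" for x
  interpret m: strip_operator D "\<lambda>x. - T x" \<delta> K C "\<lambda>x. - Q x" by (rule strip_operator_uminus)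
  have mP: "m.P = N" by (simp add: fun_eq_iff m.P_def N_def)
  note Q = commutesD[OF commutes_Q]
  have Nl: "N (x + y) = N x + N y" and PN: "P (N x) = N (P x)" for x y
    by (simp_all add: N_def P_def Q scaleR_add_right scaleR_diff_right algebra_simps)
  have PNsum: "P x + N x = x" for x by (simp add: P_def N_def flip: scaleR_add_right scaleR_2)
  have 0: "N (P (P (P x))) = 0" for x by (simp add: N_def Q_P_cube)
  have "- Q (N (N (N x))) = N (N (N x))" for x using m.Q_P_cube unfolding mP .
  then have 1: "P (N (N (N x))) = 0" for x by (simp add: P_def minus_equation_iff add_eq_0_iff)
  have NPP: "N (P (P x)) = 0" for x
  proof -
    have "N (P (P x)) = N (N (P (P x)))" for x
      using Nl[of "P (P (P x))" "N (P (P x))"] PNsum[of "P (P x)"] 0 by simp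
    then show ?thesis using 1[of "P x"] PN by metis
  qed
  have "N (P x) = 0" for x
  proof -
    have "N (P x) = N (N (P x))" for x
      using Nl[of "P (P x)" "N (P x)"] PNsum[of "P x"] NPP by simp
    then show ?thesis using 1[of x] PN by metis
  qed
  then show ?thesis by (simp add: N_def P_def Q scaleR_add_right)
qed

lemma strip_dichotomy:
  assumes dense: "UNIV \<subseteq> closure D"
  shows "dichotomous_wrt D T {x. Q x = x} {x. Q x = - x}"
    and "proj_along {x. Q x = x} {x. Q x = - x} x - proj_along {x. Q x = - x} {x. Q x = x} x = Q x"
proof -
  interpret m: strip_operator D "\<lambda>x. - T x" \<delta> K C "\<lambda>x. - Q x" by (rule strip_operator_uminus)
  let ?U = "{x. Q x = x}" let ?W = "{x. Q x = - x}"
  note Q = commutesD[OF commutes_Q]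
  have cQ: "continuous_on UNIV Q" using linear_continuous_on[OF Q(1)] .
  have Q0: "Q 0 = 0" using Q(2)[of 0 0] by simp
  have mem: "P x \<in> ?U" "x - P x \<in> ?W" for x
    by (simp_all add: P_def Q Q_involution algebra_simps flip: scaleR_2)
  have sU: "complex_vector.subspace ?U" and sW: "complex_vector.subspace ?W"
    by (auto simp: complex_vector.subspace_def Q Q0 scaleC.minus_right)
  have c: "complementary_closed ?U ?W"
    unfolding complementary_closed_def
  proof (intro conjI allI sU sW)
    show "closed ?U" "closed ?W" by (auto intro!: closed_Collect_eq continuous_intros cQ)
    have "x = 0" if "x = - x" for x :: 'v using that by (metis add.right_inverse scaleR_2 scaleR_eq_0_iff zero_neq_numeral)
    then show "?U \<inter> ?W = {0}" using Q0 by force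
    show "\<exists>u\<in>?U. \<exists>w\<in>?W. x = u + w" for x
      using mem[of x] by (intro bexI[of _ "P x"] bexI[of _ "x - P x"]) auto
  qed
  have p: "proj_along ?U ?W x = P x" for x by (rule proj_along_unique[OF c mem])
  show "proj_along ?U ?W x - proj_along ?W ?U x = Q x"
  proof -
    have "P x + P x = x + Q x" by (simp add: P_def flip: scaleR_add_left)
    then show ?thesis by (simp add: proj_along_swap[OF c] p algebra_simps)
  qed
  have TQ: "Q (T x) = T (Q x)" if "x \<in> D" for x using commutes_T(2)[OF commutes_Q that] by simp
  have Tm: "T (- x) = - T x" if "x \<in> D" for x
    using lin_operatorD(2)[OF lin that, of "-1"] by (simp add: scaleC.minus_left scaleC_one)
  have Qm: "Q (- x) = - Q x" for x using Q(6)[of 0 x] Q0 by simp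
  have lW: "lin_operator ?W (D \<inter> ?W) (\<lambda>x. - T x)"
    using m.lin sW TQ Tm Qm c unfolding lin_operator_def complementary_closed_def
    by (auto intro!: complex_vector.subspace_inter)
  show "dichotomous_wrt D T ?U ?W"
    unfolding dichotomous_wrt_def dense_lin_operator_def
  proof (intro conjI lin dense c exI[of _ \<delta>] \<delta>)
    show "vstrip \<delta> \<subseteq> resolvent_set UNIV D T" using strip by (auto simp: vstrip_def)
    show "T ` (D \<inter> ?U) \<subseteq> ?U" "T ` (D \<inter> ?W) \<subseteq> ?W" using TQ Tm by auto
    show "spectrum ?U (D \<inter> ?U) T \<subseteq> {z. Re z > 0}"
      using left_half_plane_resolvent by (auto simp: spectrum_def not_less[symmetric])
    have W: "{x. - Q x = x} = ?W" by (auto simp: minus_equation_iff) 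
    have "z \<in> resolvent_set ?W (D \<inter> ?W) T" if "Re z \<ge> 0" for z
      using resolvent_uminus(1)[OF lW, of "- z"] m.left_half_plane_resolvent[of "- z"] that unfolding W by simp
    then have "Re z < 0" if "z \<notin> resolvent_set ?W (D \<inter> ?W) T" for z using that not_le by blast
    then show "spectrum ?W (D \<inter> ?W) T \<subseteq> {z. Re z < 0}" unfolding spectrum_def by blast
  qed
qed

end

section \<open>Bisectors, the dichotomy gap and the perturbation theorem\<close>

lemma mem_bisector_complement_iff:
  assumes "0 \<le> \<theta>" "\<theta> \<le> pi / 2" "0 \<le> r"
  shows "z \<in> bisector_complement \<theta> r \<longleftrightarrow> \<bar>Re z\<bar> \<le> cos \<theta> * cmod z \<and> r < cmod z"
proof (cases "z = 0")
  case False
  then show ?thesis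
    using assms Arg_ge_iff[OF False, of \<theta>] Arg_le_iff[OF False, of "pi - \<theta>"]
    unfolding bisector_complement_def by auto
qed (use assms in \<open>auto simp: bisector_complement_def\<close>)

lemma bisectorialI:
  assumes T: "dense_lin_operator UNIV D T" and \<theta>: "0 \<le> \<theta>" "\<theta> < pi / 2" and r: "0 \<le> r" and M: "0 \<le> M"
    and rb: "\<And>z. \<bar>Re z\<bar> \<le> cos \<theta> * cmod z \<Longrightarrow> r < cmod z \<Longrightarrow> resolvent_bound D T z (M / (1 + cmod z))"
  shows "bisectorial UNIV D T \<theta> r" "bisector_complement \<theta> r \<subseteq> resolvent_set UNIV D T"
proof -
  note mem = mem_bisector_complement_iff[OF \<theta>(1) less_imp_le[OF \<theta>(2)] r]
  show sub: "bisector_complement \<theta> r \<subseteq> resolvent_set UNIV D T"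
    using rb resolvent_boundD(1) unfolding mem subset_iff by blast
  show "bisectorial UNIV D T \<theta> r"
    unfolding bisectorial_def
  proof (intro conjI T \<theta> r allI impI subsetI)
    fix z assume "z \<in> spectrum UNIV D T"
    then have "z \<notin> bisector_complement \<theta> r" using sub by (auto simp: spectrum_def)
    then consider "cmod z \<le> r" | "r < cmod z" "cos \<theta> * cmod z < Re z" | "r < cmod z" "cos \<theta> * cmod z < Re (- z)"
      unfolding mem by (smt (verit) uminus_complex.simps(1))
    then show "z \<in> sector \<theta> \<union> uminus ` sector \<theta> \<union> {z. cmod z \<le> r}"
    proof cases
      case 2
      then have "z \<noteq> 0" using r by auto
      then have "z \<in> sector \<theta>" using 2 \<theta> Arg_le_iff[of z \<theta>] by (simp add: sector_def)
      then show ?thesis by simp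
    next
      case 3
      then have "- z \<noteq> 0" using r by auto
      then have "- z \<in> sector \<theta>" using 3 \<theta> Arg_le_iff[of "- z" \<theta>] by (simp add: sector_def)
      then show ?thesis by (auto intro!: image_eqI[of z uminus "- z"])
    qed simp
  next
    fix \<theta>' assume \<theta>': "\<theta> < \<theta>' \<and> \<theta>' \<le> pi / 2"
    have "bounded_by UNIV (resolvent D T z) ((M + 1) / cmod z)" if "z \<in> bisector_complement \<theta>' r" for z
    proof -
      have "z \<in> bisector_complement \<theta> r" using that \<theta>' by (auto simp: bisector_complement_def)
      then have z: "\<bar>Re z\<bar> \<le> cos \<theta> * cmod z" "r < cmod z" by (simp_all add: mem)
      have "M / (1 + cmod z) \<le> (M + 1) / cmod z" using M z r by (intro frac_le) auto
      from resolvent_bound_mono[OF rb[OF z] this] show ?thesis by (simp add: resolvent_bound_def)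
    qed
    then show "\<exists>M>0. \<forall>z\<in>bisector_complement \<theta>' r. bounded_by UNIV (resolvent D T z) (M / cmod z)"
      using M by (intro exI[of _ "M + 1"]) auto
  qed
qed

lemma vstrip_gap_subset:
  "{z. ereal \<bar>Re z\<bar> < dichotomy_gap D T} \<subseteq> resolvent_set UNIV D T"
  unfolding dichotomy_gap_def by (fastforce simp: less_Sup_iff vstrip_def)

lemma dichotomy_gap_pos:
  "0 < h \<Longrightarrow> vstrip h \<subseteq> resolvent_set UNIV D T \<Longrightarrow> 0 < dichotomy_gap D T"
  unfolding dichotomy_gap_def less_Sup_iff by (intro bexI[of _ "ereal h"]) auto

theorem corollary3p10:
  fixes S R T :: "'v::complex_banach \<Rightarrow> 'v" and DS DR D :: "'v set" and \<theta> p :: real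
  assumes "0 \<le> \<theta>" and "\<theta> < pi / 2"
    and "sectorially_dichotomous DS S \<theta>"
    and "lin_operator UNIV DR R"
    and "subordinate p DR R DS S" and "p < 1"
    and "D = DS \<inter> DR" and "T = (\<lambda>x. S x + R x)"
    and "{z. Re z = 0} \<subseteq> regular_type D T"
  shows "\<exists>h Vp Vm \<theta>''.
           dichotomous_wrt D T Vp Vm \<and> dichotomy_gap D T = h \<and> 0 < h \<and>
           (\<forall>x. \<exists>I. has_pv_integral_iR (\<lambda>z. resolvent D T z x) I \<and>
              (1 / (complex_of_real pi * \<i>)) *\<^sub>C I = proj_along Vp Vm x - proj_along Vm Vp x) \<and>
           \<theta> < \<theta>'' \<and> \<theta>'' < pi / 2 \<and> bisectorial UNIV D T \<theta>'' 0 \<and>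
           (\<forall>\<theta>'. \<theta> < \<theta>' \<and> \<theta>' < pi / 2 \<longrightarrow>
              (\<exists>r'\<ge>0. bisectorial UNIV D T \<theta>' r' \<and>
                 {z. ereal \<bar>Re z\<bar> < h} \<union> bisector_complement \<theta>'' 0 \<union> bisector_complement \<theta>' r'
                   \<subseteq> resolvent_set UNIV D T))"
proof -
  have D: "D = DS" and sDR: "DS \<subseteq> DR" using assms(5,7) by (auto simp: subordinate_def)
  have dS: "dense_lin_operator UNIV DS S"
    using assms(3) by (auto simp: sectorially_dichotomous_def dichotomous_wrt_def)
  then have lS: "lin_operator UNIV DS S" and dense: "UNIV \<subseteq> closure D" by (auto simp: dense_lin_operator_def D)
  have lT: "lin_operator UNIV D T"
    using lS assms(4) sDR unfolding lin_operator_def D assms(8) by (auto simp: scaleC.add_right subset_iff)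
  have dT: "dense_lin_operator UNIV D T" using lT dense by (simp add: dense_lin_operator_def)
  have cone: "\<exists>r M. 0 < r \<and> 0 \<le> M \<and> (\<forall>z. \<bar>Re z\<bar> \<le> \<kappa> * cmod z \<longrightarrow> r < cmod z \<longrightarrow> resolvent_bound D T z (M / (1 + cmod z)))"
    if \<kappa>: "0 \<le> \<kappa>" "\<kappa> < cos \<theta>" for \<kappa>
  proof -
    obtain K where K: "0 \<le> K" "\<And>z. \<bar>Re z\<bar> \<le> \<kappa> * cmod z \<Longrightarrow> resolvent_bound DS S z (K / (1 + cmod z))"
      using sectorially_dichotomous_resolvent[OF assms(3) \<kappa>] by metis
    obtain r where "0 < r" "\<And>z. z \<in> {z. \<bar>Re z\<bar> \<le> \<kappa> * cmod z} \<Longrightarrow> r < cmod z \<Longrightarrow> resolvent_bound D T z (2 * K / (1 + cmod z))"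
      using subordinate_perturbation_resolvent_bound[OF lS assms(4-6), of "{z. \<bar>Re z\<bar> \<le> \<kappa> * cmod z}" K] K
      unfolding D assms(8) by auto
    then show ?thesis using K(1) by (intro exI[of _ r] exI[of _ "2 * K"]) auto
  qed
  have cos\<theta>: "0 < cos \<theta>" using assms(1,2) by (intro cos_gt_zero_pi) auto
  \<comment> \<open>Any cone strictly between the axis and the sector of \<open>S\<close> would do.\<close>
  define \<kappa> where "\<kappa> = cos \<theta> / 2"
  have \<kappa>: "0 < \<kappa>" "\<kappa> < cos \<theta>" using cos\<theta> by (auto simp: \<kappa>_def)
  obtain r M where r: "0 < r" and M: "0 \<le> M"
    and rM: "\<And>z. \<bar>Re z\<bar> \<le> \<kappa> * cmod z \<Longrightarrow> r < cmod z \<Longrightarrow> resolvent_bound D T z (M / (1 + cmod z))"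
    using cone[of \<kappa>] \<kappa> by auto
  have "\<i> * of_real (r + 1) \<in> resolvent_set UNIV D T"
    using rM[of "\<i> * of_real (r + 1)"] r \<kappa> by (auto simp: norm_mult resolvent_bound_def simp del: of_real_add)
  then have axis: "{z. Re z = 0} \<subseteq> resolvent_set UNIV D T"
    using imaginary_axis_subset_resolvent_set[OF lT assms(9)] by blast
  obtain \<delta> K where \<delta>: "0 < \<delta>" and K: "0 \<le> K" and strip: "\<And>z. \<bar>Re z\<bar> \<le> \<delta> \<Longrightarrow> resolvent_bound D T z (K / (1 + cmod z))"
    using resolvent_bound_strip[OF lT axis \<kappa>(1) r M rM] by metis
  obtain KS c QS where S: "0 \<le> KS" "0 \<le> c"
    "\<And>z. \<bar>Re z\<bar> \<le> 0 * cmod z \<Longrightarrow> resolvent_bound DS S z (KS / (1 + cmod z))"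
    "\<And>x. pv_integral (\<lambda>t. resolvent DS S (\<i> * of_real t) x) (QS x)" "\<And>x. norm (QS x) \<le> c * norm x"
    using sectorially_dichotomous_resolvent[OF assms(3) order_refl cos\<theta>] by metis
  obtain Q0 C where Q0: "0 \<le> C" "\<And>x. norm (Q0 x) \<le> C * norm x"
    "\<And>x. pv_integral (\<lambda>t. resolvent D T (\<i> * of_real t) x) (Q0 x)"
  proof (rule subordinate_perturbation_pv_integral[OF lS lT[unfolded D assms(8)] assms(5,6) S(1) K _ _ S(4,5,2)])
    show "resolvent_bound DS S (\<i> * of_real t) (KS / (1 + \<bar>t\<bar>))" for t
      using S(3)[of "\<i> * of_real t"] by (simp add: norm_mult)
    show "resolvent_bound DS (\<lambda>x. S x + R x) (\<i> * of_real t) (K / (1 + \<bar>t\<bar>))" for t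
      using strip[of "\<i> * of_real t"] \<delta> by (simp add: norm_mult D assms(8))
  qed (rule that; simp add: D assms(8))
  define Q where "Q x = (1 / pi) *\<^sub>R Q0 x" for x
  interpret T: strip_operator D T \<delta> K C Q
  proof
    show "norm (Q x) \<le> C * norm x" for x
    proof -
      have "norm (Q x) = 1 / pi * norm (Q0 x)" by (simp add: Q_def)
      also have "\<dots> \<le> 1 * norm (Q0 x)" using pi_gt3 by (intro mult_right_mono) auto
      finally show ?thesis using Q0(2)[of x] by simp
    qed
    show "pv_integral (\<lambda>t. resolvent D T (\<i> * of_real t) x) (pi *\<^sub>R Q x)" for x
      using Q0(3)[of x] by (simp add: Q_def)
  qed (use lT \<delta> K strip in auto)
  let ?U = "{x. Q x = x}" let ?W = "{x. Q x = - x}"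
  note dich = T.strip_dichotomy[OF dense]
  have gap: "0 < dichotomy_gap D T"
    by (rule dichotomy_gap_pos[OF \<delta>]) (use T.strip in \<open>auto simp: vstrip_def\<close>)
  have pv: "\<exists>I. has_pv_integral_iR (\<lambda>z. resolvent D T z x) I \<and>
              (1 / (complex_of_real pi * \<i>)) *\<^sub>C I = proj_along ?U ?W x - proj_along ?W ?U x" for x
  proof (intro exI conjI)
    show "has_pv_integral_iR (\<lambda>z. resolvent D T z x) (\<i> *\<^sub>C pi *\<^sub>R Q x)"
      using pv_integral_linear[OF T.pv[of x] scaleC.bounded_linear_right[of \<i>]]
      unfolding has_pv_integral_iR_def pv_integral_def by auto
    show "(1 / (complex_of_real pi * \<i>)) *\<^sub>C \<i> *\<^sub>C pi *\<^sub>R Q x = proj_along ?U ?W x - proj_along ?W ?U x"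
      unfolding dich(2) by (simp add: scaleR_scaleC scaleC_scaleC scaleC_one)
  qed
  \<comment> \<open>The cone is so thin that inside the disc of radius \<open>r\<close>, where the estimate on the wider cone
    may fail, it lies in the strip.\<close>
  define \<kappa>2 where "\<kappa>2 = min \<kappa> (\<delta> / r)"
  define \<theta>2 where "\<theta>2 = arccos \<kappa>2"
  have \<kappa>2: "0 < \<kappa>2" "\<kappa>2 \<le> \<kappa>" "\<kappa>2 * r \<le> \<delta>" using \<kappa> \<delta> r by (auto simp: \<kappa>2_def min_def field_simps)
  have \<kappa>21: "\<kappa>2 < 1" using \<kappa>2(2) \<kappa>(2) cos_le_one[of \<theta>] by linarith
  have cos\<theta>2: "cos \<theta>2 = \<kappa>2" "0 \<le> \<theta>2" "\<theta>2 \<le> pi"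
    using \<kappa>2 \<kappa>21 arccos_lbound[of \<kappa>2] arccos_ubound[of \<kappa>2] by (auto simp: \<theta>2_def cos_arccos)
  have \<theta>2: "\<theta> < \<theta>2" "\<theta>2 < pi / 2"
  proof -
    show "\<theta> < \<theta>2" using cos_mono_less_eq[of \<theta>2 \<theta>] cos\<theta>2 \<kappa>2 \<kappa> assms(1,2) by auto
    show "\<theta>2 < pi / 2" using cos_mono_less_eq[of "pi / 2" \<theta>2] cos\<theta>2 \<kappa>2 by auto
  qed
  have rb2: "resolvent_bound D T z (max M K / (1 + cmod z))" if z: "\<bar>Re z\<bar> \<le> cos \<theta>2 * cmod z" for z
  proof -
    have le: "M / (1 + cmod z) \<le> max M K / (1 + cmod z)" "K / (1 + cmod z) \<le> max M K / (1 + cmod z)"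
      by (intro divide_right_mono; simp)+
    show ?thesis
    proof (cases "r < cmod z")
      case True
      have "\<bar>Re z\<bar> \<le> \<kappa> * cmod z"
        using z \<kappa>2(2) unfolding cos\<theta>2 by (meson mult_right_mono norm_ge_zero order_trans)
      from resolvent_bound_mono[OF rM[OF this True] le(1)] show ?thesis .
    next
      case False
      then have "\<kappa>2 * cmod z \<le> \<kappa>2 * r" using \<kappa>2 by (intro mult_left_mono) auto
      then have "\<bar>Re z\<bar> \<le> \<delta>" using z \<kappa>2(3) unfolding cos\<theta>2 by linarith
      from resolvent_bound_mono[OF strip[OF this] le(2)] show ?thesis .
    qed
  qed
  have bis2: "bisectorial UNIV D T \<theta>2 0" "bisector_complement \<theta>2 0 \<subseteq> resolvent_set UNIV D T"
    using bisectorialI[OF dT cos\<theta>2(2) \<theta>2(2) order_refl, of "max M K"] rb2 K by auto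
  have rest: "\<exists>r'\<ge>0. bisectorial UNIV D T \<theta>' r' \<and>
      {z. ereal \<bar>Re z\<bar> < dichotomy_gap D T} \<union> bisector_complement \<theta>2 0 \<union> bisector_complement \<theta>' r'
        \<subseteq> resolvent_set UNIV D T" if \<theta>': "\<theta> < \<theta>'" "\<theta>' < pi / 2" for \<theta>'
  proof -
    have "0 \<le> cos \<theta>'" "cos \<theta>' < cos \<theta>"
      using \<theta>' assms(1,2) cos_mono_less_eq[of \<theta>' \<theta>] by (auto intro: cos_ge_zero)
    then obtain r' M' where rM': "0 < r'" "0 \<le> M'"
      "\<And>z. \<bar>Re z\<bar> \<le> cos \<theta>' * cmod z \<Longrightarrow> r' < cmod z \<Longrightarrow> resolvent_bound D T z (M' / (1 + cmod z))"
      using cone by blast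
    have "0 \<le> \<theta>'" using \<theta>' assms(1) by simp
    from bisectorialI[OF dT this \<theta>'(2) less_imp_le[OF rM'(1)] rM'(2,3)] bis2(2) vstrip_gap_subset[of D T] rM'(1)
    show ?thesis by (intro exI[of _ r']) auto
  qed
  show ?thesis
    by (rule exI[of _ "dichotomy_gap D T"], rule exI[of _ ?U], rule exI[of _ ?W], rule exI[of _ \<theta>2])
      (intro conjI refl allI impI dich(1) gap pv \<theta>2 bis2(1) rest; simp)
qed

end
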